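(* Let $\sigma$ be a positive Borel measure on $[0,1]$ with $\int_{[0,1]}x^2\,d\sigma(x)<\infty$. Put $\gamma_k=\int_{[0,1]}x^{2k}d\sigma(x)$ for $k\ge1$ and $w_n=\sum_{k=1}^n\gamma_k$, $w=\{w_n\}_{n\ge1}$. If $f\in H^2$ and $\theta$ is an inner function, then $$\|f\theta\|_w^2=\|f\|_w^2+\int_{\mathbb T}dm(\zeta)\int_{[0,1]}r^2|f(r\zeta)|^2\,\frac{1-|\theta(r\zeta)|^2}{1-r^2}\,d\sigma(r),$$ where at $r=1$ the quantity $f(r\zeta)$ means the boundary value $f(\zeta)$ and $(1-|\theta(r\zeta)|^2)/(1-r^2)$ is interpreted as $|\theta'(\zeta)|$, the modulus of the angular derivative of $\theta$ at $\zeta$ (equal to $\infty$ if $\theta$ has no angular derivative at $\zeta$); both sides take values in $[0,\infty]$.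
   Context: $\mathbb T$ is the unit circle with normalized arclength $m$; $H^2$ the Hardy space on the unit disk $\mathbb D$. Inner function: $\theta\in H^\infty$ with $|\theta|=1$ a.e. on $\mathbb T$. For a nonnegative sequence $w$ and $f$ with Taylor coefficients $\widehat f(k)$, $\|f\|_w=\big(\sum_{k\ge1}w_k|\widehat f(k)|^2\big)^{1/2}$. A function $\varphi\in H^\infty$ with $\|\varphi\|_\infty=1$ has an angular derivative at $\zeta\in\mathbb T$ if $\varphi$ and $\varphi'$ have nontangential limits at $\zeta$, the limit of $\varphi$ having modulus $1$; $\theta'(\zeta)$ denotes the nontangential limit of $\theta'$. *)

theory Defs
  imports "HOL-Analysis.Analysis"
begin

definition taylor_coeff :: "(complex \<Rightarrow> complex) \<Rightarrow> nat \<Rightarrow> complex" where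
  "taylor_coeff f k = (deriv ^^ k) f 0 / of_nat (fact k)"

definition H2 :: "(complex \<Rightarrow> complex) set" where
  "H2 = {f. f holomorphic_on ball 0 1 \<and> summable (\<lambda>k. (cmod (taylor_coeff f k))^2)}"

definition circle_measure :: "complex measure" where
  "circle_measure = distr (uniform_measure lborel {0..2*pi}) borel cis"

definition radial_limit :: "(complex \<Rightarrow> complex) \<Rightarrow> complex \<Rightarrow> complex" where
  "radial_limit f \<zeta> =
     (if \<exists>L. ((\<lambda>r::real. f (of_real r * \<zeta>)) \<longlongrightarrow> L) (at_left 1)
      then Lim (at_left 1) (\<lambda>r::real. f (of_real r * \<zeta>)) else 0)"

definition inner_function :: "(complex \<Rightarrow> complex) \<Rightarrow> bool" where
  "inner_function \<theta> \<longleftrightarrow> \<theta> holomorphic_on ball 0 1 \<and> bounded (\<theta> ` ball 0 1) \<and>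
     (AE \<zeta> in circle_measure. \<exists>L. ((\<lambda>r::real. \<theta> (of_real r * \<zeta>)) \<longlongrightarrow> L) (at_left 1) \<and> cmod L = 1)"

definition stolz_angle :: "complex \<Rightarrow> real \<Rightarrow> complex set" where
  "stolz_angle \<zeta> \<alpha> = {z. cmod z < 1 \<and> cmod (z - \<zeta>) < \<alpha> * (1 - cmod z)}"

definition nt_tendsto :: "(complex \<Rightarrow> complex) \<Rightarrow> complex \<Rightarrow> complex \<Rightarrow> bool" where
  "nt_tendsto g \<zeta> L \<longleftrightarrow> (\<forall>\<alpha>>1. (g \<longlongrightarrow> L) (at \<zeta> within stolz_angle \<zeta> \<alpha>))"

definition has_angular_derivative :: "(complex \<Rightarrow> complex) \<Rightarrow> complex \<Rightarrow> bool" where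
  "has_angular_derivative \<phi> \<zeta> \<longleftrightarrow>
     (\<exists>L. nt_tendsto \<phi> \<zeta> L \<and> cmod L = 1) \<and> (\<exists>D. nt_tendsto (deriv \<phi>) \<zeta> D)"

definition angular_derivative_modulus :: "(complex \<Rightarrow> complex) \<Rightarrow> complex \<Rightarrow> ennreal" where
  "angular_derivative_modulus \<theta> \<zeta> =
     (if has_angular_derivative \<theta> \<zeta>
      then ennreal (cmod (THE D. nt_tendsto (deriv \<theta>) \<zeta> D)) else \<infinity>)"

definition w_norm_sq :: "(nat \<Rightarrow> ennreal) \<Rightarrow> (complex \<Rightarrow> complex) \<Rightarrow> ennreal" where
  "w_norm_sq w f = (\<Sum>k. w (Suc k) * ennreal ((cmod (taylor_coeff f (Suc k)))^2))"

end

theory Submission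
  imports Defs "HOL-Complex_Analysis.Complex_Analysis"
begin

text \<open>
  Write \<open>w\<^sub>n\<close> as an integral over \<open>\<sigma>\<close>: the weighted norm becomes the \<open>\<sigma>\<close>-integral of
  \<open>S\<^sub>r g = (\<Sum>k. (r\<^sup>2 + \<dots> + r\<^sup>2\<^sup>k) * \<bar>g\<^sub>k\<bar>\<^sup>2)\<close>, so it suffices to treat each \<open>r\<close> separately.
  For \<open>r < 1\<close>, summing the geometric progression turns \<open>S\<^sub>r g\<close> into
  \<open>r\<^sup>2 / (1 - r\<^sup>2)\<close> times the difference of the squared norms of \<open>g\<close> and of its dilation
  \<open>z \<mapsto> g (r * z)\<close>; multiplication by \<open>\<theta>\<close> preserves the former, and Parseval's identity computes the
  change of the latter.

  The case \<open>r = 1\<close> is Carleson's formula for the Dirichlet integral, obtained as the limit \<open>r \<rightarrow> 1\<close>.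
  By the Julia-Caratheodory theorem the quotients \<open>Q\<^sub>r = (1 - \<bar>\<theta> (r * \<zeta>)\<bar>\<^sup>2) / (1 - r\<^sup>2)\<close> converge to
  \<open>\<bar>\<theta>' \<zeta>\<bar>\<close> (possibly \<open>\<infinity>\<close>) and satisfy \<open>Q\<^sub>r \<le> 4 / (1 + r)\<^sup>2 * \<bar>\<theta>' \<zeta>\<bar>\<close>. If \<open>f\<close> has finite Dirichlet
  integral, then \<open>\<integral> \<bar>f'\<bar>\<^sup>2\<close> is finite along almost every radius, which yields radial limits
  without Fatou's theorem, and \<open>\<integral> \<bar>f (r * \<zeta>) - f \<zeta>\<bar>\<^sup>2 Q\<^sub>r \<le> (\<Sum>k. k * \<bar>f\<^sub>k\<bar>\<^sup>2 * (1 - r\<^sup>k)) \<rightarrow> 0\<close> because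
  \<open>Q\<^sub>r \<le> 1 / (1 - r)\<close>. Fatou's lemma gives the other inequality. If the Dirichlet integral of \<open>f\<close>
  is infinite, so is that of \<open>f * \<theta>\<close>.
\<close>

section \<open>Schwarz-Pick inequalities\<close>

text \<open>The hard direction at r = 1 is the upper bound: there Fatou's lemma points the wrong
  way, and nothing dominates f (r \<zeta>) pointwise by boundary values. The integrand is therefore
  split by |a|^2 <= (1 + e) |b|^2 + (1 + 1/e) |a - b|^2 with a = f (r \<zeta>) and b = f \<zeta>. On
  the first part the sharp bound for Q_r is used, whose constant 4 / (1 + r)^2 tends to 1; it is
  Julia's lemma evaluated on the radius. The second part tolerates the crude bound. Letting r tend
  to 1 for fixed e, and then e to 0, loses nothing. The angular derivative is reached through the
  right half-plane. There Julia's lemma becomes nonnegativity of a real part, and the Schwarz-Pick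
  inequality for such functions carries information from the radius into Stolz angles, for the
  function and its derivative alike. Identities between possibly infinite sums are written
  additively, because cancellation in [0, \<infinity>] needs a finite term.\<close>

lemma one_minus_cnj_mult_nonzero:
  fixes a z :: complex
  assumes "cmod a < 1" "cmod z \<le> 1"
  shows "1 - cnj a * z \<noteq> 0"
proof
  assume "1 - cnj a * z = 0"
  then have "cmod (cnj a * z) = 1" by simp
  moreover have "cmod (cnj a * z) \<le> cmod a * 1"
    unfolding norm_mult complex_mod_cnj by (intro mult_left_mono assms) auto
  ultimately show False using assms by simp
qed

text \<open>Divided by the left side, this is the formula for 1 - \<rho>^2, where \<rho> is the
  pseudohyperbolic distance of \<open>a\<close> and \<open>b\<close>. It converts between the two
  usual forms of the Schwarz-Pick inequality.\<close>

lemma moebius_norm_identity: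
  fixes a b :: complex
  shows "(cmod (1 - cnj a * b))\<^sup>2 = (cmod (a - b))\<^sup>2 + (1 - (cmod a)\<^sup>2) * (1 - (cmod b)\<^sup>2)"
  unfolding cmod_power2 by (simp add: power2_eq_square algebra_simps)

text \<open>Composing with the disc automorphisms that exchange \<open>a\<close> and
  \<open>\<phi> a\<close> with 0 reduces this to Schwarz's lemma at the origin.\<close>

lemma Schwarz_Pick:
  assumes hol: "\<phi> holomorphic_on ball 0 1"
    and lt: "\<And>z. cmod z < 1 \<Longrightarrow> cmod (\<phi> z) < 1"
    and a: "cmod a < 1" and z: "cmod z < 1"
  shows "cmod (\<phi> z - \<phi> a) * cmod (1 - cnj a * z) \<le> cmod (z - a) * cmod (1 - cnj (\<phi> a) * \<phi> z)"
proof -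
  let ?M = "Moebius_function 0"
  define \<psi> where "\<psi> = ?M (\<phi> a) \<circ> (\<phi> \<circ> ?M (-a))"
  have \<phi>a: "cmod (\<phi> a) < 1" using lt a by blast
  have na: "cmod (-a) < 1" using a by simp
  have im: "?M (-a) ` ball 0 1 \<subseteq> ball 0 1"
    using Moebius_function_norm_lt_1[OF na] by (auto simp: image_subset_iff)
  have "\<phi> \<circ> ?M (-a) holomorphic_on ball 0 1"
    by (rule holomorphic_on_compose_gen[OF Moebius_function_holomorphic[OF na] hol im])
  moreover have "(\<phi> \<circ> ?M (-a)) ` ball 0 1 \<subseteq> ball 0 1"
    using im lt by (fastforce simp: image_subset_iff)
  ultimately have h\<psi>: "\<psi> holomorphic_on ball 0 1"
    unfolding \<psi>_def by (rule holomorphic_on_compose_gen[OF _ Moebius_function_holomorphic[OF \<phi>a]])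
  have \<psi>0: "\<psi> 0 = 0"
    by (simp add: \<psi>_def Moebius_function_of_zero Moebius_function_eq_zero)
  have \<psi>lt: "cmod (\<psi> u) < 1" if "cmod u < 1" for u
    unfolding \<psi>_def o_def
    by (intro Moebius_function_norm_lt_1 lt na that \<phi>a)
  have "cmod (\<psi> (?M a z)) \<le> cmod (?M a z)"
    by (rule Schwarz_Lemma(1)[OF h\<psi> \<psi>0 \<psi>lt Moebius_function_norm_lt_1[OF a z]])
  moreover have "\<psi> (?M a z) = ?M (\<phi> a) (\<phi> z)"
    unfolding \<psi>_def o_def using Moebius_function_compose[of "-a" a z] a z by simp
  ultimately have "cmod ((\<phi> z - \<phi> a) / (1 - cnj (\<phi> a) * \<phi> z)) \<le> cmod ((z - a) / (1 - cnj a * z))"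
    by (simp add: Moebius_function_simple)
  moreover have "1 - cnj (\<phi> a) * \<phi> z \<noteq> 0" "1 - cnj a * z \<noteq> 0"
    using one_minus_cnj_mult_nonzero \<phi>a lt[OF z] a z by (auto simp: less_imp_le)
  ultimately show ?thesis by (simp add: norm_divide field_simps)
qed

lemma Schwarz_Pick_closed:
  assumes hol: "\<theta> holomorphic_on ball 0 1"
    and le: "\<And>z. cmod z < 1 \<Longrightarrow> cmod (\<theta> z) \<le> 1"
    and a: "cmod a < 1" and z: "cmod z < 1"
  shows "(cmod (1 - cnj (\<theta> a) * \<theta> z))\<^sup>2 * ((1 - (cmod z)\<^sup>2) * (1 - (cmod a)\<^sup>2))
         \<le> (1 - (cmod (\<theta> z))\<^sup>2) * (1 - (cmod (\<theta> a))\<^sup>2) * (cmod (1 - cnj a * z))\<^sup>2"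
proof -
  define A where "A = (\<lambda>s::real. (cmod (1 - cnj (s * \<theta> a) * (s * \<theta> z)))\<^sup>2 * ((1 - (cmod z)\<^sup>2) * (1 - (cmod a)\<^sup>2)))"
  define B where "B = (\<lambda>s::real. (1 - (cmod (s * \<theta> z))\<^sup>2) * (1 - (cmod (s * \<theta> a))\<^sup>2) * (cmod (1 - cnj a * z))\<^sup>2)"
  have AB: "A s \<le> B s" if s: "0 \<le> s" "s < 1" for s
  proof -
    define \<phi> where "\<phi> = (\<lambda>z. complex_of_real s * \<theta> z)"
    have h: "\<phi> holomorphic_on ball 0 1"
      unfolding \<phi>_def by (intro holomorphic_intros hol)
    have l: "cmod (\<phi> u) < 1" if "cmod u < 1" for u
    proof -
      have "cmod (\<phi> u) \<le> s * 1"
        unfolding \<phi>_def norm_mult using s le[OF that] by (intro mult_mono) auto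
      then show ?thesis using s by simp
    qed
    have "(cmod (\<phi> z - \<phi> a) * cmod (1 - cnj a * z))\<^sup>2 \<le> (cmod (z - a) * cmod (1 - cnj (\<phi> a) * \<phi> z))\<^sup>2"
      by (intro power_mono Schwarz_Pick[OF h l a z]) auto
    then have "(cmod (\<phi> a - \<phi> z))\<^sup>2 * (cmod (1 - cnj a * z))\<^sup>2 \<le> (cmod (a - z))\<^sup>2 * (cmod (1 - cnj (\<phi> a) * \<phi> z))\<^sup>2"
      by (simp add: power_mult_distrib norm_minus_commute)
    then have "(cmod (1 - cnj (\<phi> a) * \<phi> z))\<^sup>2 * ((1 - (cmod z)\<^sup>2) * (1 - (cmod a)\<^sup>2))
         \<le> (1 - (cmod (\<phi> z))\<^sup>2) * (1 - (cmod (\<phi> a))\<^sup>2) * (cmod (1 - cnj a * z))\<^sup>2"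
    proof -
      \<comment> \<open>\<open>M\<close> and \<open>K\<close> stand for the squared denominators
        belonging to \<phi> and to the identity, \<open>m\<close> and \<open>k\<close> for the
        corresponding products of 1 - |.|^2. The product \<open>M * K\<close> cancels.\<close>
      have *: "M * k \<le> m * K" if "(M - m) * K \<le> (K - k) * M" for M m K k :: real
        using that by (simp add: algebra_simps)
      have e1: "(cmod (a - z))\<^sup>2 = (cmod (1 - cnj a * z))\<^sup>2 - (1 - (cmod z)\<^sup>2) * (1 - (cmod a)\<^sup>2)"
        using moebius_norm_identity[of a z] by (simp add: mult.commute)
      have e2: "(cmod (\<phi> a - \<phi> z))\<^sup>2 = (cmod (1 - cnj (\<phi> a) * \<phi> z))\<^sup>2 - (1 - (cmod (\<phi> z))\<^sup>2) * (1 - (cmod (\<phi> a))\<^sup>2)"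
        using moebius_norm_identity[of "\<phi> a" "\<phi> z"] by (simp add: mult.commute)
      assume "(cmod (\<phi> a - \<phi> z))\<^sup>2 * (cmod (1 - cnj a * z))\<^sup>2 \<le> (cmod (a - z))\<^sup>2 * (cmod (1 - cnj (\<phi> a) * \<phi> z))\<^sup>2"
      then show ?thesis unfolding e1 e2 by (rule *)
    qed
    then show ?thesis unfolding A_def B_def \<phi>_def .
  qed
  have "(A \<longlongrightarrow> A 1) (at_left 1)" "(B \<longlongrightarrow> B 1) (at_left 1)"
    unfolding A_def B_def by (intro tendsto_intros)+
  moreover have "\<forall>\<^sub>F s in at_left (1::real). A s \<le> B s"
    using eventually_at_left_real[OF zero_less_one] by eventually_elim (auto intro: AB)
  ultimately have "A 1 \<le> B 1"
    by (intro tendsto_le[of "at_left (1::real)" B "B 1" A "A 1"]) auto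
  then show ?thesis by (simp add: A_def B_def)
qed

text \<open>The map w -> (w - b) / (w + cnj b) sends the right half-plane to the disc and b to 0.
  Shifting \<open>G\<close> by e > 0 makes the real part strictly positive, so the denominator
  cannot vanish; the shift is removed at the end by e -> 0.\<close>

lemma Schwarz_Pick_right_half_plane:
  assumes hol: "G holomorphic_on ball 0 1"
    and re: "\<And>z. cmod z < 1 \<Longrightarrow> 0 \<le> Re (G z)"
    and a: "cmod a < 1" and z: "cmod z < 1"
  shows "cmod (G z - G a) * cmod (1 - cnj a * z) \<le> cmod (z - a) * cmod (G z + cnj (G a))"
proof -
  have *: "cmod (G z - G a) * cmod (1 - cnj a * z) \<le> cmod (z - a) * cmod (G z + cnj (G a) + 2 * of_real e)"
    if e: "0 < e" for e :: real
  proof -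
    define b where "b = G a + of_real e"
    define \<phi> where "\<phi> = (\<lambda>z. (G z + of_real e - b) / (G z + of_real e + cnj b))"
    have pos: "0 < Re (G u + of_real e)" if "cmod u < 1" for u
      using re[OF that] e by simp
    have bpos: "0 < Re b" using pos[OF a] by (simp add: b_def)
    have nz: "G u + of_real e + cnj b \<noteq> 0" if "cmod u < 1" for u
    proof -
      have "0 < Re (G u + of_real e + cnj b)" using pos[OF that] bpos by simp
      then show ?thesis by (metis less_irrefl zero_complex.sel(1))
    qed
    have h: "\<phi> holomorphic_on ball 0 1"
      unfolding \<phi>_def by (intro holomorphic_intros hol) (use nz in auto)
    have l: "cmod (\<phi> u) < 1" if "cmod u < 1" for u
    proof -
      let ?g = "G u + of_real e"
      have "(cmod (?g + cnj b))\<^sup>2 = (cmod (?g - b))\<^sup>2 + 4 * Re ?g * Re b"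
        unfolding cmod_power2 by (simp add: power2_eq_square algebra_simps)
      moreover have "0 < 4 * Re ?g * Re b" using pos[OF that] bpos by simp
      ultimately have "(cmod (?g - b))\<^sup>2 < (cmod (?g + cnj b))\<^sup>2" by linarith
      then have "cmod (?g - b) < cmod (?g + cnj b)" by (rule power2_less_imp_less) simp
      then show ?thesis unfolding \<phi>_def norm_divide using nz[OF that] by simp
    qed
    have "\<phi> a = 0" by (simp add: \<phi>_def b_def)
    then have "cmod (\<phi> z) * cmod (1 - cnj a * z) \<le> cmod (z - a)"
      using Schwarz_Pick[OF h l a z] by simp
    then have "cmod (G z + of_real e - b) * cmod (1 - cnj a * z) \<le> cmod (z - a) * cmod (G z + of_real e + cnj b)"
      using nz[OF z] unfolding \<phi>_def norm_divide by (simp add: field_simps)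
    then show ?thesis by (simp add: b_def algebra_simps)
  qed
  have "((\<lambda>e::real. cmod (z - a) * cmod (G z + cnj (G a) + 2 * of_real e)) \<longlongrightarrow>
      cmod (z - a) * cmod (G z + cnj (G a) + 2 * of_real 0)) (at_right 0)"
    by (intro tendsto_intros)
  moreover have "\<forall>\<^sub>F e in at_right (0::real). cmod (G z - G a) * cmod (1 - cnj a * z) \<le> cmod (z - a) * cmod (G z + cnj (G a) + 2 * of_real e)"
    using eventually_at_right_less by eventually_elim (rule *)
  ultimately show ?thesis
    using tendsto_lowerbound[of _ _ "at_right (0::real)"] by fastforce
qed

text \<open>Infinitesimal form of the previous inequality: divide by |z - a| and let z tend to
  \<open>a\<close>.\<close>

lemma Schwarz_Pick_right_half_plane_deriv:
  assumes hol: "G holomorphic_on ball 0 1"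
    and re: "\<And>z. cmod z < 1 \<Longrightarrow> 0 \<le> Re (G z)"
    and a: "cmod a < 1"
  shows "cmod (deriv G a) * (1 - (cmod a)\<^sup>2) \<le> 2 * Re (G a)"
proof -
  have "G field_differentiable at a"
    using hol a by (auto intro: holomorphic_on_imp_differentiable_at)
  then have d: "(G has_field_derivative deriv G a) (at a)"
    using DERIV_deriv_iff_field_differentiable by blast
  then have "((\<lambda>z. (G z - G a) / (z - a)) \<longlongrightarrow> deriv G a) (at a)"
    by (simp add: has_field_derivative_iff)
  then have 1: "((\<lambda>z. cmod ((G z - G a) / (z - a)) * cmod (1 - cnj a * z)) \<longlongrightarrow> cmod (deriv G a) * cmod (1 - cnj a * a)) (at a)"
    by (intro tendsto_intros)
  have "(G \<longlongrightarrow> G a) (at a)" using DERIV_isCont[OF d] by (simp add: isCont_def)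
  then have 2: "((\<lambda>z. cmod (G z + cnj (G a))) \<longlongrightarrow> cmod (G a + cnj (G a))) (at a)"
    by (intro tendsto_intros)
  have "\<forall>\<^sub>F z in at a. z \<in> ball 0 1 - {a}"
    using a by (intro eventually_at_in_open) auto
  then have "\<forall>\<^sub>F z in at a. cmod ((G z - G a) / (z - a)) * cmod (1 - cnj a * z) \<le> cmod (G z + cnj (G a))"
  proof eventually_elim
    case (elim z)
    with Schwarz_Pick_right_half_plane[OF hol re a, of z] show ?case
      by (simp add: norm_divide field_simps)
  qed
  then have "cmod (deriv G a) * cmod (1 - cnj a * a) \<le> cmod (G a + cnj (G a))"
    by (intro tendsto_le[OF _ 2 1]) auto
  moreover have "1 - cnj a * a = of_real (1 - (cmod a)\<^sup>2)"
    by (simp only: of_real_diff of_real_1 complex_norm_square mult.commute)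
  moreover have "0 \<le> 1 - (cmod a)\<^sup>2" using a by (simp add: power_le_one less_imp_le)
  moreover have "cmod (G a + cnj (G a)) = 2 * Re (G a)"
    using re[OF a] by (simp add: complex_add_cnj norm_mult)
  ultimately show ?thesis by (metis norm_of_real abs_of_nonneg)
qed

section \<open>Julia's lemma\<close>

definition Julia_quotient :: "(complex \<Rightarrow> complex) \<Rightarrow> complex \<Rightarrow> real \<Rightarrow> real" where
  "Julia_quotient \<theta> \<zeta> r = (1 - (cmod (\<theta> (of_real r * \<zeta>)))\<^sup>2) / (1 - r\<^sup>2)"

section \<open>Stolz angles and radial approach\<close>

lemma filterlim_radial_stolz:
  assumes "cmod \<zeta> = 1" "1 < \<alpha>"
  shows "filterlim (\<lambda>r::real. of_real r * \<zeta>) (at \<zeta> within stolz_angle \<zeta> \<alpha>) (at_left 1)"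
proof -
  have "((\<lambda>r::real. of_real r * \<zeta>) \<longlongrightarrow> of_real 1 * \<zeta>) (at_left 1)"
    by (intro tendsto_intros)
  moreover have "\<forall>\<^sub>F r in at_left (1::real). of_real r * \<zeta> \<in> stolz_angle \<zeta> \<alpha> \<and> of_real r * \<zeta> \<noteq> \<zeta>"
    using eventually_at_left_real[OF zero_less_one]
  proof eventually_elim
    case (elim r)
    have "cmod (of_real r * \<zeta> - \<zeta>) = cmod (of_real (r - 1) * \<zeta>)" by (simp add: algebra_simps)
    also have "\<dots> = 1 - r" using elim assms by (simp add: norm_mult del: of_real_diff)
    finally have *: "cmod (of_real r * \<zeta> - \<zeta>) = 1 - r" .
    moreover have "1 * (1 - r) < \<alpha> * (1 - r)" using elim assms by (intro mult_strict_right_mono) auto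
    moreover have "of_real r * \<zeta> \<noteq> \<zeta>" using * elim by auto
    ultimately show ?case using elim assms by (simp add: stolz_angle_def norm_mult)
  qed
  ultimately show ?thesis by (simp add: filterlim_at)
qed

lemma at_within_stolz_nonbot:
  assumes "cmod \<zeta> = 1" "1 < \<alpha>"
  shows "at \<zeta> within stolz_angle \<zeta> \<alpha> \<noteq> bot"
proof
  assume "at \<zeta> within stolz_angle \<zeta> \<alpha> = bot"
  with filterlim_radial_stolz[OF assms] have "at_left (1::real) = bot"
    by (simp add: filterlim_def bot_unique filtermap_bot_iff)
  then show False by simp
qed

lemma nt_tendsto_unique:
  assumes "cmod \<zeta> = 1" "nt_tendsto g \<zeta> D" "nt_tendsto g \<zeta> E"
  shows "D = E"
proof (rule tendsto_unique[where f = g])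
  show "at \<zeta> within stolz_angle \<zeta> 2 \<noteq> bot" by (rule at_within_stolz_nonbot) (use assms in auto)
qed (use assms in \<open>auto simp: nt_tendsto_def\<close>)

lemma nt_tendsto_radial:
  assumes "cmod \<zeta> = 1" "nt_tendsto g \<zeta> D"
  shows "((\<lambda>r::real. g (of_real r * \<zeta>)) \<longlongrightarrow> D) (at_left 1)"
proof -
  have "(g \<longlongrightarrow> D) (at \<zeta> within stolz_angle \<zeta> 2)"
    using assms by (simp add: nt_tendsto_def)
  then show ?thesis
    by (rule filterlim_compose[OF _ filterlim_radial_stolz]) (use assms in simp_all)
qed

text \<open>Inside a Stolz angle the points \<open>z\<close> and \<open>\<bar>z\<bar> * \<zeta>\<close> have bounded hyperbolic distance, so
  the Schwarz-Pick inequality transfers the radial estimate to \<open>z\<close>.\<close>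

lemma nt_half_plane:
  assumes hol: "G holomorphic_on ball 0 1"
    and re: "\<And>z. cmod z < 1 \<Longrightarrow> 0 \<le> Re (G z)"
    and \<zeta>: "cmod \<zeta> = 1"
    and rad: "((\<lambda>r::real. of_real (1 - r) * G (of_real r * \<zeta>)) \<longlongrightarrow> 0) (at_left 1)"
    and \<alpha>: "1 < \<alpha>"
  shows "((\<lambda>z. (\<zeta> - z) * G z) \<longlongrightarrow> 0) (at \<zeta> within stolz_angle \<zeta> \<alpha>)"
    and "((\<lambda>z. (\<zeta> - z)\<^sup>2 * deriv G z) \<longlongrightarrow> 0) (at \<zeta> within stolz_angle \<zeta> \<alpha>)"
proof -
  let ?F = "at \<zeta> within stolz_angle \<zeta> \<alpha>"
  \<comment> \<open>The constant comes out of the comparison below: |G z - G a| <= 4 (\<alpha> +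
    1)^2 |G a| with a = |z| \<zeta>, followed by the triangle inequality.\<close>
  define K where "K = 1 + 4 * (\<alpha> + 1)\<^sup>2"
  have ev: "\<forall>\<^sub>F z in ?F. z \<in> stolz_angle \<zeta> \<alpha>" by (simp add: eventually_at_filter)
  have "(cmod \<longlongrightarrow> cmod \<zeta>) ?F" by (intro tendsto_intros)
  with ev have "filterlim cmod (at_left 1) ?F"
    using \<zeta> by (auto simp: filterlim_at stolz_angle_def elim: eventually_mono)
  with rad have "((\<lambda>z. of_real (1 - cmod z) * G (of_real (cmod z) * \<zeta>)) \<longlongrightarrow> 0) ?F"
    by (rule filterlim_compose)
  then have lim0: "((\<lambda>z. C * cmod (of_real (1 - cmod z) * G (of_real (cmod z) * \<zeta>))) \<longlongrightarrow> 0) ?F" for C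
    by (intro tendsto_mult_right_zero tendsto_norm_zero)
  have bound: "cmod (G z) \<le> K * cmod (G (of_real (cmod z) * \<zeta>))"
    if z: "z \<in> stolz_angle \<zeta> \<alpha>" for z
  proof -
    define r where "r = cmod z"
    define a where "a = of_real r * \<zeta>"
    have r: "0 \<le> r" "r < 1" and zs: "cmod (z - \<zeta>) \<le> \<alpha> * (1 - r)"
      using z by (auto simp: stolz_angle_def r_def)
    have a: "cmod a = r" using r \<zeta> by (simp add: a_def norm_mult)
    define N M X where "N = cmod (1 - cnj a * z)" and "M = cmod (a - z)" and "X = cmod (G z - G a)"
    have NM: "N\<^sup>2 = M\<^sup>2 + (1 - r\<^sup>2) * (1 - r\<^sup>2)"
      unfolding N_def M_def using moebius_norm_identity[of a z] a by (simp add: r_def)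
    have "1 - cnj a * z = cnj \<zeta> * ((\<zeta> - z) + of_real (1 - r) * z)"
      using \<zeta> complex_norm_square[of \<zeta>] by (simp add: a_def algebra_simps)
    then have "N = cmod ((\<zeta> - z) + of_real (1 - r) * z)"
      using \<zeta> by (simp add: N_def norm_mult)
    also have "\<dots> \<le> cmod (\<zeta> - z) + cmod (of_real (1 - r) * z)" by (rule norm_triangle_ineq)
    also have "cmod (of_real (1 - r) * z) = (1 - r) * r"
      using r by (simp add: norm_mult r_def del: of_real_diff)
    also have "cmod (\<zeta> - z) + (1 - r) * r \<le> \<alpha> * (1 - r) + (1 - r) * 1"
      using zs r by (intro add_mono mult_left_mono) (auto simp: norm_minus_commute)
    finally have N: "N \<le> (\<alpha> + 1) * (1 - r)" by (simp add: algebra_simps)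
    have nn: "0 \<le> M" "0 \<le> N" "0 \<le> X" by (simp_all add: M_def N_def X_def)
    have MN: "M \<le> N"
      by (rule power2_le_imp_le) (use NM nn in auto)
    \<comment> \<open>\<open>M / N\<close> is the pseudohyperbolic distance of z and a. Since
      \<open>N\<close> is at most a multiple of 1 - r, the identity for N^2 - M^2 bounds
      \<open>N - M\<close> below by a multiple of 1 - r, which keeps \<open>M / N\<close> away from
      1.\<close>
    have "(1 - r) * (1 - r) \<le> (1 - r\<^sup>2) * (1 - r\<^sup>2)"
      using r by (intro mult_mono) (auto simp: power2_eq_square mult_left_le mult_le_one)
    also have "\<dots> = (N - M) * (N + M)" using NM by (simp add: power2_eq_square algebra_simps)
    also have "\<dots> \<le> (N - M) * (2 * ((\<alpha> + 1) * (1 - r)))"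
      using MN N by (intro mult_left_mono) auto
    finally have "(1 - r) * (1 - r) \<le> (2 * (\<alpha> + 1) * (N - M)) * (1 - r)" by (simp add: algebra_simps)
    then have NM2: "1 - r \<le> 2 * (\<alpha> + 1) * (N - M)"
      by (rule mult_right_le_imp_le) (use r in simp)
    have "X * N \<le> M * cmod (G z + cnj (G a))"
      using Schwarz_Pick_right_half_plane[OF hol re, of a z] a r
      by (simp add: X_def N_def M_def norm_minus_commute r_def)
    \<comment> \<open>Writing the sum through the difference makes \<open>X\<close> reappear on the
      right with factor \<open>M\<close>; it is absorbed on the left, leaving the factor
      \<open>N - M\<close>.\<close>
    also have "G z + cnj (G a) = (G z - G a) + of_real (2 * Re (G a))"
      by (simp add: complex_eq_iff)
    also have "cmod \<dots> \<le> X + cmod (of_real (2 * Re (G a)))"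
      unfolding X_def by (rule norm_triangle_ineq)
    also have "cmod (of_real (2 * Re (G a))) \<le> 2 * cmod (G a)"
      using abs_Re_le_cmod[of "G a"] by (simp add: norm_mult)
    finally have "X * N \<le> M * (X + 2 * cmod (G a))" using nn by (simp add: mult_left_mono)
    then have "X * (N - M) \<le> M * (2 * cmod (G a))" by (simp add: algebra_simps)
    also have "\<dots> \<le> ((\<alpha> + 1) * (1 - r)) * (2 * cmod (G a))"
      using MN N by (intro mult_right_mono) auto
    finally have XNM: "X * (N - M) \<le> ((\<alpha> + 1) * (1 - r)) * (2 * cmod (G a))" .
    have "X * (1 - r) \<le> X * (2 * (\<alpha> + 1) * (N - M))"
      using NM2 nn by (intro mult_left_mono)
    also have "\<dots> = 2 * (\<alpha> + 1) * (X * (N - M))" by simp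
    also have "\<dots> \<le> 2 * (\<alpha> + 1) * (((\<alpha> + 1) * (1 - r)) * (2 * cmod (G a)))"
      using XNM \<alpha> by (intro mult_left_mono) auto
    also have "\<dots> = (4 * (\<alpha> + 1)\<^sup>2 * cmod (G a)) * (1 - r)"
      by (simp add: power2_eq_square algebra_simps)
    finally have "X \<le> 4 * (\<alpha> + 1)\<^sup>2 * cmod (G a)"
      by (rule mult_right_le_imp_le) (use r in simp)
    moreover have "cmod (G z) \<le> X + cmod (G a)"
      using norm_triangle_ineq[of "G z - G a" "G a"] by (simp add: X_def)
    ultimately show ?thesis by (simp add: K_def a_def r_def algebra_simps)
  qed
  have K: "0 \<le> K" by (simp add: K_def)
  show "((\<lambda>z. (\<zeta> - z) * G z) \<longlongrightarrow> 0) ?F"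
  proof (rule Lim_null_comparison[OF _ lim0[of "\<alpha> * K"]], use ev in eventually_elim)
    case (elim z)
    then have z: "cmod z < 1" "cmod (\<zeta> - z) \<le> \<alpha> * (1 - cmod z)"
      by (auto simp: stolz_angle_def norm_minus_commute)
    have "cmod ((\<zeta> - z) * G z) \<le> (\<alpha> * (1 - cmod z)) * (K * cmod (G (of_real (cmod z) * \<zeta>)))"
      unfolding norm_mult using z bound[OF elim] \<alpha> by (intro mult_mono) auto
    also have "\<dots> = \<alpha> * K * cmod (of_real (1 - cmod z) * G (of_real (cmod z) * \<zeta>))"
      using z by (simp add: norm_mult del: of_real_diff)
    finally show ?case .
  qed
  show "((\<lambda>z. (\<zeta> - z)\<^sup>2 * deriv G z) \<longlongrightarrow> 0) ?F"
  proof (rule Lim_null_comparison[OF _ lim0[of "\<alpha>\<^sup>2 * (2 * K)"]], use ev in eventually_elim)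
    case (elim z)
    then have z: "cmod z < 1" "cmod (\<zeta> - z) \<le> \<alpha> * (1 - cmod z)"
      by (auto simp: stolz_angle_def norm_minus_commute)
    \<comment> \<open>The derivative is traded for Re G at the price of one factor 1 - |z|; this is
      why \<zeta> - z enters squared.\<close>
    have "cmod (deriv G z) * (1 - cmod z) \<le> cmod (deriv G z) * (1 - (cmod z)\<^sup>2)"
      using z by (intro mult_left_mono) (auto simp: power2_eq_square mult_left_le)
    also have "\<dots> \<le> 2 * Re (G z)" by (rule Schwarz_Pick_right_half_plane_deriv[OF hol re z(1)])
    also have "\<dots> \<le> 2 * (K * cmod (G (of_real (cmod z) * \<zeta>)))"
      using bound[OF elim] complex_Re_le_cmod[of "G z"] by simp
    finally have d: "cmod (deriv G z) * (1 - cmod z) \<le> 2 * (K * cmod (G (of_real (cmod z) * \<zeta>)))" .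
    have "cmod ((\<zeta> - z)\<^sup>2 * deriv G z) = (cmod (\<zeta> - z))\<^sup>2 * cmod (deriv G z)"
      by (simp add: norm_mult norm_power)
    also have "\<dots> \<le> (\<alpha> * (1 - cmod z))\<^sup>2 * cmod (deriv G z)"
      using z by (intro mult_right_mono power_mono) auto
    also have "\<dots> = \<alpha>\<^sup>2 * (1 - cmod z) * (cmod (deriv G z) * (1 - cmod z))"
      by (simp add: power2_eq_square)
    also have "\<dots> \<le> \<alpha>\<^sup>2 * (1 - cmod z) * (2 * (K * cmod (G (of_real (cmod z) * \<zeta>))))"
      using z d by (intro mult_left_mono) auto
    also have "\<dots> = \<alpha>\<^sup>2 * (2 * K) * cmod (of_real (1 - cmod z) * G (of_real (cmod z) * \<zeta>))"
      using z by (simp add: norm_mult del: of_real_diff)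
    finally show ?case .
  qed
qed

section \<open>Julia's lemma at a boundary point with unimodular radial limit\<close>

locale Julia_point =
  fixes \<theta> :: "complex \<Rightarrow> complex" and \<zeta> L :: complex
  assumes hol: "\<theta> holomorphic_on ball 0 1"
    and le: "\<And>z. cmod z < 1 \<Longrightarrow> cmod (\<theta> z) \<le> 1"
    and \<zeta>: "cmod \<zeta> = 1"
    and L: "cmod L = 1"
    and lim: "((\<lambda>r::real. \<theta> (of_real r * \<zeta>)) \<longlongrightarrow> L) (at_left 1)"
begin

abbreviation Q :: "real \<Rightarrow> real" where "Q \<equiv> Julia_quotient \<theta> \<zeta>"

lemma Q_nonneg:
  assumes "0 \<le> r" "r < 1"
  shows "0 \<le> Q r"
proof -
  have "cmod (\<theta> (of_real r * \<zeta>)) \<le> 1" by (rule le) (use assms \<zeta> in \<open>simp add: norm_mult\<close>)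
  then have "(cmod (\<theta> (of_real r * \<zeta>)))\<^sup>2 \<le> 1" by (simp add: power_le_one)
  moreover have "r\<^sup>2 \<le> 1" using assms by (simp add: power_le_one)
  ultimately show ?thesis by (simp add: Julia_quotient_def)
qed

lemma ev_radial: "\<forall>\<^sub>F r in at_left (1::real). 0 < r \<and> r < 1"
  using eventually_at_left_real[OF zero_less_one] by simp

text \<open>Schwarz-Pick at the two points z and r \<zeta>, divided by 1 - r^2, contains the
  quotient \<open>Q r\<close>; then r tends to 1. The hypothesis says only that \<open>Q r\<close>
  comes close to or below c for radii arbitrarily near 1, so c may be the lower limit of
  \<open>Q\<close>.\<close>

lemma Julia:
  assumes freq: "\<And>e. 0 < e \<Longrightarrow> \<exists>\<^sub>F r in at_left 1. Q r \<le> c + e" and z: "cmod z < 1"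
  shows "(cmod (L - \<theta> z))\<^sup>2 * (1 - (cmod z)\<^sup>2) \<le> (1 - (cmod (\<theta> z))\<^sup>2) * c * (cmod (\<zeta> - z))\<^sup>2"
proof -
  define h where "h = (\<lambda>e (r::real). (cmod (1 - cnj (\<theta> (of_real r * \<zeta>)) * \<theta> z))\<^sup>2 * (1 - (cmod z)\<^sup>2)
      - (1 - (cmod (\<theta> z))\<^sup>2) * (c + e) * (cmod (1 - cnj (of_real r * \<zeta>) * z))\<^sup>2)"
  define l where "l = (\<lambda>e::real. (cmod (1 - cnj L * \<theta> z))\<^sup>2 * (1 - (cmod z)\<^sup>2)
      - (1 - (cmod (\<theta> z))\<^sup>2) * (c + e) * (cmod (1 - cnj (of_real 1 * \<zeta>) * z))\<^sup>2)"
  have tz: "(cmod (\<theta> z))\<^sup>2 \<le> 1" using le[OF z] by (simp add: power_le_one)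
  \<comment> \<open>The inequality \<open>h e r \<le> 0\<close> is available only for frequently
    many r. A positive limit would make \<open>h e r\<close> eventually positive and so contradict
    one of these radii.\<close>
  have "l e \<le> 0" if e: "0 < e" for e
  proof (rule ccontr)
    assume "\<not> l e \<le> 0"
    moreover have "(h e \<longlongrightarrow> l e) (at_left 1)"
      unfolding h_def l_def by (intro tendsto_intros lim)
    ultimately have "\<forall>\<^sub>F r in at_left 1. 0 < h e r" by (intro order_tendstoD) auto
    with freq[OF e] ev_radial have "\<exists>\<^sub>F r in at_left 1. Q r \<le> c + e \<and> 0 < h e r \<and> 0 < r \<and> r < 1"
      by (simp add: frequently_eventually_frequently eventually_conj)
    then obtain r where r: "Q r \<le> c + e" "0 < h e r" "0 < r" "r < 1"
      by (auto dest: frequently_ex)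
    let ?a = "of_real r * \<zeta>"
    have a: "cmod ?a = r" using r \<zeta> by (simp add: norm_mult)
    have r2: "0 < 1 - r\<^sup>2" using r by (simp add: power_less_one_iff)
    have "(cmod (1 - cnj (\<theta> ?a) * \<theta> z))\<^sup>2 * ((1 - (cmod z)\<^sup>2) * (1 - r\<^sup>2))
      \<le> (1 - (cmod (\<theta> z))\<^sup>2) * (1 - (cmod (\<theta> ?a))\<^sup>2) * (cmod (1 - cnj ?a * z))\<^sup>2"
      using Schwarz_Pick_closed[OF hol le, of ?a z] a r z by simp
    also have "1 - (cmod (\<theta> ?a))\<^sup>2 = Q r * (1 - r\<^sup>2)" using r2 by (simp add: Julia_quotient_def)
    also have "(1 - (cmod (\<theta> z))\<^sup>2) * (Q r * (1 - r\<^sup>2)) * (cmod (1 - cnj ?a * z))\<^sup>2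
       = ((1 - (cmod (\<theta> z))\<^sup>2) * Q r * (cmod (1 - cnj ?a * z))\<^sup>2) * (1 - r\<^sup>2)" by simp
    also have "\<dots> \<le> ((1 - (cmod (\<theta> z))\<^sup>2) * (c + e) * (cmod (1 - cnj ?a * z))\<^sup>2) * (1 - r\<^sup>2)"
      using r2 r tz by (intro mult_right_mono mult_left_mono) auto
    finally have "((cmod (1 - cnj (\<theta> ?a) * \<theta> z))\<^sup>2 * (1 - (cmod z)\<^sup>2)) * (1 - r\<^sup>2)
      \<le> ((1 - (cmod (\<theta> z))\<^sup>2) * (c + e) * (cmod (1 - cnj ?a * z))\<^sup>2) * (1 - r\<^sup>2)"
      by (simp add: mult.assoc)
    then have "h e r \<le> 0" using r2 by (simp add: h_def mult_le_cancel_right)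
    with r show False by simp
  qed
  moreover have "(l \<longlongrightarrow> l 0) (at_right 0)"
    unfolding l_def by (intro tendsto_intros)
  ultimately have l0: "l 0 \<le> 0"
    by (intro tendsto_upperbound[of l "l 0" "at_right 0"] eventually_mono[OF eventually_at_right_less]) auto
  have *: "cmod (1 - cnj u * v) = cmod (u - v)" if "cmod u = 1" for u v
  proof -
    have "1 - cnj u * v = cnj u * (u - v)"
      using that complex_norm_square[of u] by (simp add: algebra_simps)
    then show ?thesis using that by (simp add: norm_mult)
  qed
  show ?thesis using l0 *[OF L] *[OF \<zeta>] by (simp add: l_def)
qed

text \<open>Julia's lemma at the point r \<zeta> itself, with |L - \<theta> (r \<zeta>)| >= 1 - t.
  Cancelling (1 - t)(1 - r) gives (1 - t)(1 + r) <= (1 + t) c (1 - r); the constant arises from (1 +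
  t)^2 <= 4. A bound near c on some radii thus yields a bound on all of them.\<close>

lemma Q_le:
  assumes freq: "\<And>e. 0 < e \<Longrightarrow> \<exists>\<^sub>F r in at_left 1. Q r \<le> c + e" and c: "0 \<le> c" and r: "0 \<le> r" "r < 1"
  shows "Q r \<le> 4 / (1 + r)\<^sup>2 * c"
proof -
  define t where "t = cmod (\<theta> (of_real r * \<zeta>))"
  have z: "cmod (of_real r * \<zeta>) = r" using r \<zeta> by (simp add: norm_mult)
  have t: "0 \<le> t" "t \<le> 1" unfolding t_def using le[of "of_real r * \<zeta>"] z r by auto
  have "cmod (\<zeta> - of_real r * \<zeta>) = cmod (of_real (1 - r) * \<zeta>)" by (simp add: algebra_simps)
  also have "\<dots> = 1 - r" using r \<zeta> by (simp add: norm_mult del: of_real_diff)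
  finally have *: "cmod (\<zeta> - of_real r * \<zeta>) = 1 - r" .
  have r2: "0 < 1 - r\<^sup>2" using r by (simp add: power_less_one_iff)
  show ?thesis
  proof (cases "t = 1")
    case True
    then show ?thesis using c by (simp add: Julia_quotient_def t_def[symmetric])
  next
    case False
    with t have t1: "t < 1" by simp
    have "1 - t \<le> cmod (L - \<theta> (of_real r * \<zeta>))"
      using norm_triangle_ineq2[of L "\<theta> (of_real r * \<zeta>)"] L by (simp add: t_def)
    then have "(1 - t)\<^sup>2 * (1 - r\<^sup>2) \<le> (cmod (L - \<theta> (of_real r * \<zeta>)))\<^sup>2 * (1 - r\<^sup>2)"
      using t r2 by (intro mult_right_mono power_mono) auto
    also have "\<dots> \<le> (1 - t\<^sup>2) * c * (1 - r)\<^sup>2"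
      using Julia[OF freq, of "of_real r * \<zeta>"] * z r by (simp add: t_def)
    finally have "((1 - t) * (1 + r)) * ((1 - t) * (1 - r)) \<le> ((1 + t) * c * (1 - r)) * ((1 - t) * (1 - r))"
      by (simp add: power2_eq_square algebra_simps)
    then have 1: "(1 - t) * (1 + r) \<le> (1 + t) * c * (1 - r)"
      by (rule mult_right_le_imp_le) (use t1 r in simp)
    have "(1 - t\<^sup>2) * (1 + r)\<^sup>2 = (1 + t) * (1 + r) * ((1 - t) * (1 + r))"
      by (simp add: power2_eq_square algebra_simps)
    also have "\<dots> \<le> (1 + t) * (1 + r) * ((1 + t) * c * (1 - r))"
      using 1 t r by (intro mult_left_mono) auto
    also have "\<dots> = (1 + t)\<^sup>2 * (c * (1 - r\<^sup>2))" by (simp add: power2_eq_square algebra_simps)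
    also have "\<dots> \<le> 2\<^sup>2 * (c * (1 - r\<^sup>2))"
      using t c r2 by (intro mult_right_mono power_mono) auto
    finally have "(1 - t\<^sup>2) * (1 + r)\<^sup>2 \<le> 4 * (c * (1 - r\<^sup>2))" by simp
    then have "(1 - t\<^sup>2) / (1 - r\<^sup>2) \<le> 4 * c / (1 + r)\<^sup>2"
    proof -
      have *: "a / b \<le> d / e" if "0 < b" "0 < e" "a * e \<le> d * b" for a b d e :: real
        using that by (simp add: field_simps)
      assume "(1 - t\<^sup>2) * (1 + r)\<^sup>2 \<le> 4 * (c * (1 - r\<^sup>2))"
      then show ?thesis using r2 r by (intro *) auto
    qed
    then show ?thesis by (simp add: Julia_quotient_def t_def)
  qed
qed

text \<open>\<open>freq\<close> and \<open>low\<close> together say that c is the lower limit of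
  \<open>Q\<close>. Because 4 / (1 + r)^2 tends to 1, the preceding bound promotes it to the
  limit.\<close>

lemma Q_tendsto:
  assumes freq: "\<And>e. 0 < e \<Longrightarrow> \<exists>\<^sub>F r in at_left 1. Q r \<le> c + e" and c: "0 \<le> c"
    and low: "\<And>e. 0 < e \<Longrightarrow> \<forall>\<^sub>F r in at_left 1. c - e < Q r"
  shows "(Q \<longlongrightarrow> c) (at_left 1)"
proof (rule order_tendstoI)
  fix a assume "a < c"
  then show "\<forall>\<^sub>F r in at_left 1. a < Q r" using low[of "c - a"] by simp
next
  fix a assume "c < a"
  have "((\<lambda>r. 4 / (1 + r)\<^sup>2 * c) \<longlongrightarrow> 4 / (1 + 1)\<^sup>2 * c) (at_left (1::real))"
    by (intro tendsto_intros) auto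
  with \<open>c < a\<close> have "\<forall>\<^sub>F r in at_left (1::real). 4 / (1 + r)\<^sup>2 * c < a"
    by (intro order_tendstoD) auto
  with ev_radial show "\<forall>\<^sub>F r in at_left 1. Q r < a"
  proof eventually_elim
    case (elim r)
    have "Q r \<le> 4 / (1 + r)\<^sup>2 * c" by (rule Q_le[OF freq c]) (use elim in auto)
    with elim show ?case by simp
  qed
qed

text \<open>After rotation by \<open>cnj L\<close> the quotient e satisfies |e|^2 <= c Q by Julia's
  lemma and Re e >= Q (1 + r) / (1 + t) by the triangle inequality. Asymptotically the modulus is at
  most c and the real part at least c, which forces e -> c; \<open>u\<close> is the resulting bound
  for |e - c|^2.\<close>

lemma angular_quotient_tendsto:
  assumes freq: "\<And>e. 0 < e \<Longrightarrow> \<exists>\<^sub>F r in at_left 1. Q r \<le> c + e" and c: "0 \<le> c"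
    and low: "\<And>e. 0 < e \<Longrightarrow> \<forall>\<^sub>F r in at_left 1. c - e < Q r"
  shows "((\<lambda>r. (L - \<theta> (of_real r * \<zeta>)) / of_real (1 - r)) \<longlongrightarrow> of_real c * L) (at_left 1)"
proof -
  define e where "e = (\<lambda>r::real. cnj L * (L - \<theta> (of_real r * \<zeta>)) / of_real (1 - r))"
  define t where "t = (\<lambda>r::real. cmod (\<theta> (of_real r * \<zeta>)))"
  define u where "u = (\<lambda>r. c * Q r - 2 * c * (Q r * (1 + r) / (1 + t r)) + c\<^sup>2)"
  have tl: "(t \<longlongrightarrow> 1) (at_left 1)" unfolding t_def using tendsto_norm[OF lim] L by simp
  have "(u \<longlongrightarrow> c * c - 2 * c * (c * (1 + 1) / (1 + 1)) + c\<^sup>2) (at_left 1)"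
    unfolding u_def by (intro tendsto_intros tl Q_tendsto[OF freq c low]) auto
  then have u0: "((\<lambda>r. sqrt (u r)) \<longlongrightarrow> sqrt 0) (at_left 1)"
    by (intro tendsto_real_sqrt) (simp add: power2_eq_square)
  have "\<forall>\<^sub>F r in at_left 1. cmod (e r - of_real c) \<le> sqrt (u r)"
    using ev_radial
  proof eventually_elim
    case (elim r)
    have z: "cmod (of_real r * \<zeta>) = r" using elim \<zeta> by (simp add: norm_mult)
    have t: "0 \<le> t r" "t r \<le> 1" unfolding t_def using le[of "of_real r * \<zeta>"] z elim by auto
    have r2: "0 < 1 - r\<^sup>2" using elim by (simp add: power_less_one_iff)
    have Qr: "1 - (t r)\<^sup>2 = Q r * (1 - r\<^sup>2)"
      using r2 by (simp add: Julia_quotient_def t_def)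
    have ee: "cmod (e r) = cmod (L - \<theta> (of_real r * \<zeta>)) / (1 - r)"
      using elim L by (simp add: e_def norm_mult norm_divide del: of_real_diff)
    have "cmod (\<zeta> - of_real r * \<zeta>) = cmod (of_real (1 - r) * \<zeta>)" by (simp add: algebra_simps)
    also have "\<dots> = 1 - r" using elim \<zeta> by (simp add: norm_mult del: of_real_diff)
    finally have *: "cmod (\<zeta> - of_real r * \<zeta>) = 1 - r" .
    have "(cmod (L - \<theta> (of_real r * \<zeta>)))\<^sup>2 * (1 - r\<^sup>2) \<le> (1 - (t r)\<^sup>2) * c * (1 - r)\<^sup>2"
      using Julia[OF freq, of "of_real r * \<zeta>"] * z elim by (simp add: t_def)
    also have "\<dots> = (c * Q r * (1 - r)\<^sup>2) * (1 - r\<^sup>2)" unfolding Qr by simp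
    finally have "(cmod (L - \<theta> (of_real r * \<zeta>)))\<^sup>2 \<le> c * Q r * (1 - r)\<^sup>2"
      using r2 by (simp add: mult_le_cancel_right)
    then have 1: "(cmod (e r))\<^sup>2 \<le> c * Q r"
      using elim unfolding ee by (simp add: power_divide divide_le_eq)
    have "cnj L * L = 1" using L complex_norm_square[of L] by (simp add: mult.commute)
    then have "e r = (1 - cnj L * \<theta> (of_real r * \<zeta>)) / of_real (1 - r)"
      by (simp add: e_def right_diff_distrib)
    then have Re: "Re (e r) = (1 - Re (cnj L * \<theta> (of_real r * \<zeta>))) / (1 - r)"
      by (simp only: Re_divide_of_real) simp
    have "Re (cnj L * \<theta> (of_real r * \<zeta>)) \<le> cmod (cnj L * \<theta> (of_real r * \<zeta>))" by (rule complex_Re_le_cmod)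
    also have "\<dots> = t r" using L by (simp add: norm_mult t_def)
    finally have "(1 - t r) / (1 - r) \<le> Re (e r)" unfolding Re using elim by (simp add: divide_right_mono)
    moreover have "(1 - t r) / (1 - r) = Q r * (1 + r) / (1 + t r)"
    proof -
      have "(1 - t r) * (1 + t r) = Q r * ((1 + r) * (1 - r))"
        using Qr by (simp add: power2_eq_square algebra_simps)
      then show ?thesis using elim t by (subst frac_eq_eq) (auto simp: mult.assoc)
    qed
    ultimately have 2: "Q r * (1 + r) / (1 + t r) \<le> Re (e r)" by simp
    have "(cmod (e r - of_real c))\<^sup>2 = (cmod (e r))\<^sup>2 - 2 * c * Re (e r) + c\<^sup>2"
      unfolding cmod_power2 by (simp add: power2_eq_square algebra_simps)
    also have "\<dots> \<le> u r"
      unfolding u_def using 1 mult_left_mono[OF 2, of "2 * c"] c by simp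
    finally show ?case by (rule real_le_rsqrt)
  qed
  then have "((\<lambda>r. e r - of_real c) \<longlongrightarrow> 0) (at_left 1)"
    by (rule Lim_null_comparison) (use u0 in simp)
  then have "(e \<longlongrightarrow> of_real c) (at_left 1)" by (rule LIM_zero_cancel)
  then have "((\<lambda>r. e r * L) \<longlongrightarrow> of_real c * L) (at_left 1)" by (intro tendsto_intros)
  moreover have "e r * L = (L - \<theta> (of_real r * \<zeta>)) / of_real (1 - r)" for r
  proof -
    have "cnj L * L = 1" using L complex_norm_square[of L] by (simp add: mult.commute)
    then show ?thesis unfolding e_def by (metis (no_types, lifting) mult.assoc mult.commute mult_1 times_divide_eq_left)
  qed
  ultimately show ?thesis by simp
qed

end

section \<open>The Julia-Caratheodory theorem\<close>

text \<open>The function is (u + v) / (u - v), whose real part is the Poisson kernel for v in the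
  disc. Written with v in one place only, it is easy to differentiate and to multiply by a factor
  that cancels the pole.\<close>

lemma Re_Cayley:
  fixes u v :: complex
  assumes "cmod u = 1" "v \<noteq> u"
  shows "Re (2 * u / (u - v) - 1) = (1 - (cmod v)\<^sup>2) / (cmod (u - v))\<^sup>2"
proof -
  have "2 * u / (u - v) - 1 = (u + v) / (u - v)"
    using assms by (simp add: field_simps)
  then have "Re (2 * u / (u - v) - 1) = Re ((u + v) * cnj (u - v)) / (cmod (u - v))\<^sup>2"
    by (simp add: Re_complex_div_eq_0 complex_div_cnj [of "u + v"] del: complex_cnj_diff)
  also have "Re ((u + v) * cnj (u - v)) = (cmod u)\<^sup>2 - (cmod v)\<^sup>2"
    unfolding cmod_power2 by (simp add: power2_eq_square algebra_simps)
  finally show ?thesis using assms by simp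
qed

context Julia_point
begin

text \<open>The degenerate case c = 0: Julia's lemma then forces \<theta> to be constant, and the
  half-plane argument, which divides by c, is replaced by this one.\<close>

lemma angular_derivative_zero:
  assumes const: "\<And>z. cmod z < 1 \<Longrightarrow> \<theta> z = L"
  shows "nt_tendsto \<theta> \<zeta> L" "nt_tendsto (deriv \<theta>) \<zeta> 0"
proof -
  have ev: "\<forall>\<^sub>F z in at \<zeta> within stolz_angle \<zeta> \<alpha>. cmod z < 1" for \<alpha>
    by (auto simp: eventually_at_filter stolz_angle_def)
  show "nt_tendsto \<theta> \<zeta> L"
    unfolding nt_tendsto_def
    by (intro allI impI tendsto_eventually eventually_mono[OF ev] const)
  have "deriv \<theta> z = 0" if z: "cmod z < 1" for z
  proof -
    have "\<forall>\<^sub>F w in nhds z. w \<in> ball 0 1" using z by (intro eventually_nhds_in_open) auto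
    then have "\<forall>\<^sub>F w in nhds z. \<theta> w = L" by eventually_elim (use const in auto)
    then have "deriv \<theta> z = deriv (\<lambda>_. L) z" by (rule deriv_cong_ev) simp
    then show ?thesis by simp
  qed
  then show "nt_tendsto (deriv \<theta>) \<zeta> 0"
    unfolding nt_tendsto_def
    by (intro allI impI tendsto_eventually eventually_mono[OF ev])
qed

text \<open>The radial limit of the difference quotient says that the poles of the two Cayley
  transforms in \<open>G\<close> cancel at \<zeta>, i.e. (1 - r) G (r \<zeta>) -> 0. The half-plane
  lemma extends this to Stolz angles, including G', and solving the definition of \<open>G\<close>
  for \<theta> and \<theta>' gives both nontangential limits.\<close>

lemma angular_derivative_pos:
  assumes freq: "\<And>e. 0 < e \<Longrightarrow> \<exists>\<^sub>F r in at_left 1. Q r \<le> c + e" and c: "0 < c"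
    and low: "\<And>e. 0 < e \<Longrightarrow> \<forall>\<^sub>F r in at_left 1. c - e < Q r"
  shows "nt_tendsto \<theta> \<zeta> L" "nt_tendsto (deriv \<theta>) \<zeta> (of_real c * L / \<zeta>)"
proof -
  have Qc: "(Q \<longlongrightarrow> c) (at_left 1)" using Q_tendsto[OF freq _ low] c by simp
  \<comment> \<open>If the unimodular value L were attained inside the disc, Schwarz-Pick would make
    \<theta> constant and \<open>Q\<close> identically 0, against c > 0.\<close>
  have ne: "\<theta> z \<noteq> L" if z: "cmod z < 1" for z
  proof
    assume zL: "\<theta> z = L"
    have "\<theta> w = L" if w: "cmod w < 1" for w
    proof -
      have "0 < (1 - (cmod w)\<^sup>2) * (1 - (cmod z)\<^sup>2)"
        using w z by (intro mult_pos_pos) (auto simp: power_less_one_iff)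
      moreover have "(cmod (1 - cnj L * \<theta> w))\<^sup>2 * ((1 - (cmod w)\<^sup>2) * (1 - (cmod z)\<^sup>2)) \<le> 0"
        using Schwarz_Pick_closed[OF hol le z w] L by (simp add: zL)
      ultimately have "(cmod (1 - cnj L * \<theta> w))\<^sup>2 \<le> 0"
        by (metis mult_le_0_iff not_le zero_le_power2 order.antisym mult_eq_0_iff less_irrefl)
      then have h: "cnj L * \<theta> w = 1" by simp
      have "L * cnj L = 1" using L complex_norm_square[of L] by simp
      then have "\<theta> w = (L * cnj L) * \<theta> w" by simp
      also have "\<dots> = L" by (simp only: mult.assoc h mult_1_right)
      finally show ?thesis .
    qed
    then have "\<forall>\<^sub>F r in at_left 1. Q r = 0"
      using ev_radial by (auto elim!: eventually_mono simp: Julia_quotient_def norm_mult \<zeta> L)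
    then have "(Q \<longlongrightarrow> 0) (at_left 1)" by (rule tendsto_eventually)
    then have "c = 0" using Qc by (intro tendsto_unique[OF _ Qc]) auto
    with c show False by simp
  qed
  have z\<zeta>: "z \<noteq> \<zeta>" if "cmod z < 1" for z using that \<zeta> by auto
  \<comment> \<open>Julia's lemma says exactly that the real part of \<open>(L + \<theta>) / (L - \<theta>) - ((\<zeta> + z) / (\<zeta> - z)) / c\<close> is nonnegative.\<close>
  define G where "G = (\<lambda>z. (2 * L / (L - \<theta> z) - 1) - (2 * \<zeta> / (\<zeta> - z) - 1) / of_real c)"
  have holG: "G holomorphic_on ball 0 1"
    unfolding G_def using c ne z\<zeta> by (intro holomorphic_intros hol) auto
  have reG: "0 \<le> Re (G z)" if z: "cmod z < 1" for z
  proof -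
    have p: "0 < (cmod (L - \<theta> z))\<^sup>2" "0 < (cmod (\<zeta> - z))\<^sup>2"
      using ne[OF z] z\<zeta>[OF z] by auto
    have "Re (G z) = (1 - (cmod (\<theta> z))\<^sup>2) / (cmod (L - \<theta> z))\<^sup>2 - (1 - (cmod z)\<^sup>2) / (cmod (\<zeta> - z))\<^sup>2 / c"
      unfolding G_def minus_complex.sel(1)[of "_ / _ - _"] Re_divide_of_real
      using Re_Cayley[OF L ne[OF z]] Re_Cayley[OF \<zeta> z\<zeta>[OF z]] by (simp only:)
    moreover have "(1 - (cmod z)\<^sup>2) / (cmod (\<zeta> - z))\<^sup>2 / c \<le> (1 - (cmod (\<theta> z))\<^sup>2) / (cmod (L - \<theta> z))\<^sup>2"
    proof -
      have *: "A / B / c \<le> D / E" if "E * A \<le> D * c * B" "0 < B" "0 < E" for A B D E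
        using that c by (simp add: field_simps)
      show ?thesis by (rule * [OF Julia[OF freq z] p(2,1)])
    qed
    ultimately show ?thesis by simp
  qed
  have radG: "((\<lambda>r::real. of_real (1 - r) * G (of_real r * \<zeta>)) \<longlongrightarrow> 0) (at_left 1)"
  proof -
    define q where "q = (\<lambda>r::real. (L - \<theta> (of_real r * \<zeta>)) / of_real (1 - r))"
    have q: "(q \<longlongrightarrow> of_real c * L) (at_left 1)"
      unfolding q_def using angular_quotient_tendsto[OF freq _ low] c by simp
    \<comment> \<open>Multiplied by 1 - r, the first transform tends to 2 / c because q -> c L, and
      so does the second one after division by c.\<close>
    have A: "((\<lambda>r::real. (2 * L / q r - of_real (1 - r)) - (2 - of_real (1 - r)) / of_real c) \<longlongrightarrow>
       (2 * L / (of_real c * L) - of_real (1 - 1)) - (2 - of_real (1 - 1)) / of_real c) (at_left 1)"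
      by (intro tendsto_intros q) (use c L in auto)
    have B: "(2 * L / (of_real c * L) - of_real (1 - 1)) - (2 - of_real (1 - 1)) / of_real c = 0"
      using L by auto
    have "\<forall>\<^sub>F r in at_left 1. (2 * L / q r - of_real (1 - r)) - (2 - of_real (1 - r)) / of_real c
       = of_real (1 - r) * G (of_real r * \<zeta>)"
      using ev_radial
    proof eventually_elim
      case (elim r)
      define d where "d = complex_of_real (1 - r)"
      have d: "d \<noteq> 0" using elim by (simp add: d_def)
      have "\<zeta> - of_real r * \<zeta> = d * \<zeta>" by (simp add: d_def algebra_simps)
      moreover have "\<zeta> \<noteq> 0" using \<zeta> by auto
      ultimately have "2 * \<zeta> / (\<zeta> - of_real r * \<zeta>) = 2 / d" by simp
      moreover have "2 * L / q r = d * (2 * L / (L - \<theta> (of_real r * \<zeta>)))"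
        by (simp add: q_def d_def)
      moreover have "2 = d * (2 / d)" using d by simp
      ultimately show ?case unfolding G_def d_def[symmetric]
        by (simp add: right_diff_distrib diff_divide_distrib d)
    qed
    from Lim_transform_eventually[OF A this] show ?thesis by (simp only: B)
  qed
  have main: "(\<theta> \<longlongrightarrow> L) (at \<zeta> within stolz_angle \<zeta> \<alpha>)"
    "(deriv \<theta> \<longlongrightarrow> of_real c * L / \<zeta>) (at \<zeta> within stolz_angle \<zeta> \<alpha>)" if \<alpha>: "1 < \<alpha>" for \<alpha>
  proof -
    let ?F = "at \<zeta> within stolz_angle \<zeta> \<alpha>"
    note nt = nt_half_plane[OF holG reG \<zeta> radG \<alpha>]
    have nz: "L \<noteq> 0" "\<zeta> \<noteq> 0" "c \<noteq> 0" using L \<zeta> c by auto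
    have ev: "\<forall>\<^sub>F z in ?F. cmod z < 1"
      by (auto simp: eventually_at_filter stolz_angle_def)
    \<comment> \<open>\<open>p\<close> is the difference quotient at the boundary. Solving the
      definition of \<open>G\<close> for it gives a fraction whose denominator tends to 2 \<zeta> /
      c.\<close>
    define p where "p = (\<lambda>z. (L - \<theta> z) / (\<zeta> - z))"
    have A: "((\<lambda>z. 2 * L / ((\<zeta> - z) * G z + (\<zeta> - z) + (2 * \<zeta> - (\<zeta> - z)) / of_real c)) \<longlongrightarrow>
       2 * L / (0 + (\<zeta> - \<zeta>) + (2 * \<zeta> - (\<zeta> - \<zeta>)) / of_real c)) ?F"
      by (intro tendsto_intros nt) (use nz in auto)
    have B: "2 * L / (0 + (\<zeta> - \<zeta>) + (2 * \<zeta> - (\<zeta> - \<zeta>)) / of_real c) = of_real c * L / \<zeta>"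
      using nz by (simp add: field_simps)
    have "\<forall>\<^sub>F z in ?F. 2 * L / ((\<zeta> - z) * G z + (\<zeta> - z) + (2 * \<zeta> - (\<zeta> - z)) / of_real c) = p z"
      using ev
    proof eventually_elim
      case (elim z)
      define d where "d = \<zeta> - z"
      define t where "t = L - \<theta> z"
      have dt: "d \<noteq> 0" "t \<noteq> 0" using ne[OF elim] z\<zeta>[OF elim] by (auto simp: d_def t_def)
      have "d * ((2 * L / t - 1) - (2 * \<zeta> / d - 1) / of_real c) + d + (2 * \<zeta> - d) / of_real c = d * (2 * L) / t"
        using dt nz by (simp add: field_simps)
      then show ?case unfolding G_def p_def d_def[symmetric] t_def[symmetric] using nz dt by simp
    qed
    from Lim_transform_eventually[OF A this] have p: "(p \<longlongrightarrow> of_real c * L / \<zeta>) ?F"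
      by (simp only: B)
    have "((\<lambda>z. L - p z * (\<zeta> - z)) \<longlongrightarrow> L - (of_real c * L / \<zeta>) * (\<zeta> - \<zeta>)) ?F"
      by (intro tendsto_intros p)
    then have A: "((\<lambda>z. L - p z * (\<zeta> - z)) \<longlongrightarrow> L) ?F" by simp
    have "\<forall>\<^sub>F z in ?F. L - p z * (\<zeta> - z) = \<theta> z"
      using ev by eventually_elim (use z\<zeta> in \<open>auto simp: p_def\<close>)
    from Lim_transform_eventually[OF A this] show "(\<theta> \<longlongrightarrow> L) ?F" .
    \<comment> \<open>Differentiating \<open>G\<close> gives G' = 2 L \<theta>' / (L - \<theta>)^2 -
      2 \<zeta> / (c (\<zeta> - z)^2). Multiplied by (\<zeta> - z)^2 and solved for \<theta>', this
      is the expression below.\<close>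
    have A: "((\<lambda>z. ((\<zeta> - z)\<^sup>2 * deriv G z + 2 * \<zeta> / of_real c) * (p z)\<^sup>2 / (2 * L)) \<longlongrightarrow>
        (0 + 2 * \<zeta> / of_real c) * (of_real c * L / \<zeta>)\<^sup>2 / (2 * L)) ?F"
      by (intro tendsto_intros nt p) (use nz in auto)
    have B: "(0 + 2 * \<zeta> / of_real c) * (of_real c * L / \<zeta>)\<^sup>2 / (2 * L) = of_real c * L / \<zeta>"
      using nz by (simp add: field_simps power2_eq_square)
    have "\<forall>\<^sub>F z in ?F. ((\<zeta> - z)\<^sup>2 * deriv G z + 2 * \<zeta> / of_real c) * (p z)\<^sup>2 / (2 * L) = deriv \<theta> z"
      using ev
    proof eventually_elim
      case (elim z)
      have "\<theta> field_differentiable at z"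
        using hol elim by (auto intro: holomorphic_on_imp_differentiable_at)
      then have "(\<theta> has_field_derivative deriv \<theta> z) (at z)"
        using DERIV_deriv_iff_field_differentiable by blast
      then have "(G has_field_derivative (2 * L * deriv \<theta> z / (L - \<theta> z)\<^sup>2 - (2 * \<zeta> / (\<zeta> - z)\<^sup>2) / of_real c)) (at z)"
        unfolding G_def using nz ne[OF elim] z\<zeta>[OF elim]
        by (auto intro!: derivative_eq_intros simp: power2_eq_square)
      then have *: "deriv G z = 2 * L * deriv \<theta> z / (L - \<theta> z)\<^sup>2 - (2 * \<zeta> / (\<zeta> - z)\<^sup>2) / of_real c"
        by (rule DERIV_imp_deriv)
      define d where "d = \<zeta> - z"
      define t where "t = L - \<theta> z"
      have dt: "d \<noteq> 0" "t \<noteq> 0" using ne[OF elim] z\<zeta>[OF elim] by (auto simp: d_def t_def)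
      show ?case unfolding * p_def d_def[symmetric] t_def[symmetric]
        using dt nz by (simp add: field_simps power2_eq_square)
    qed
    from Lim_transform_eventually[OF A this] show "(deriv \<theta> \<longlongrightarrow> of_real c * L / \<zeta>) ?F"
      by (simp only: B)
  qed
  show "nt_tendsto \<theta> \<zeta> L" "nt_tendsto (deriv \<theta>) \<zeta> (of_real c * L / \<zeta>)"
    unfolding nt_tendsto_def using main by auto
qed

text \<open>\<theta>' is bounded on a final piece of the radius, a convex set; the mean value
  inequality then gives |L - \<theta> (r \<zeta>)| <= C (1 - r). This excludes an angular derivative
  when \<open>Q\<close> tends to \<infinity>.\<close>

lemma Q_bounded_if_angular_derivative:
  assumes "has_angular_derivative \<theta> \<zeta>"
  obtains M where "\<forall>\<^sub>F r in at_left 1. Q r \<le> M"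
proof -
  from assms obtain D where "nt_tendsto (deriv \<theta>) \<zeta> D"
    by (auto simp: has_angular_derivative_def)
  then have "((\<lambda>r. cmod (deriv \<theta> (of_real r * \<zeta>))) \<longlongrightarrow> cmod D) (at_left 1)"
    by (intro tendsto_norm nt_tendsto_radial \<zeta>)
  then have "\<forall>\<^sub>F r in at_left 1. cmod (deriv \<theta> (of_real r * \<zeta>)) < cmod D + 1"
    by (intro order_tendstoD) auto
  with ev_radial have "\<forall>\<^sub>F r in at_left 1. (0 < r \<and> r < 1) \<and> cmod (deriv \<theta> (of_real r * \<zeta>)) < cmod D + 1"
    by (rule eventually_conj)
  then obtain b where b: "b < 1" and
    B: "\<And>r. b < r \<Longrightarrow> r < 1 \<Longrightarrow> 0 < r \<and> cmod (deriv \<theta> (of_real r * \<zeta>)) < cmod D + 1"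
    unfolding eventually_at_left[OF zero_less_one] by blast
  define S where "S = (\<lambda>r. of_real r * \<zeta>) ` {b<..<1}"
  have "linear (\<lambda>r::real. of_real r * \<zeta>)"
    by (intro linearI) (simp_all add: algebra_simps scaleR_conv_of_real)
  then have convS: "convex S"
    unfolding S_def by (rule convex_linear_image) (rule convex_real_interval)
  have SD: "cmod u < 1" "cmod (deriv \<theta> u) \<le> cmod D + 1" if "u \<in> S" for u
    using that B \<zeta> by (auto simp: S_def norm_mult less_imp_le)
  have "Q r \<le> 2 * (cmod D + 1)" if r: "b < r" "r < 1" for r
  proof -
    define t where "t = cmod (\<theta> (of_real r * \<zeta>))"
    have r0: "0 < r" using B r by blast
    have bd: "cmod (\<theta> (of_real s * \<zeta>) - \<theta> (of_real r * \<zeta>)) \<le> (cmod D + 1) * \<bar>s - r\<bar>"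
      if s: "b < s" "s < 1" for s
    proof -
      have "cmod (\<theta> (of_real s * \<zeta>) - \<theta> (of_real r * \<zeta>)) \<le> (cmod D + 1) * cmod (of_real s * \<zeta> - of_real r * \<zeta>)"
      proof (rule field_differentiable_bound[OF convS])
        fix u assume u: "u \<in> S"
        then have "\<theta> field_differentiable at u"
          using hol SD(1) by (auto intro: holomorphic_on_imp_differentiable_at)
        then show "(\<theta> has_field_derivative deriv \<theta> u) (at u within S)"
          using DERIV_deriv_iff_field_differentiable has_field_derivative_at_within by blast
        show "cmod (deriv \<theta> u) \<le> cmod D + 1" by (rule SD(2)[OF u])
      qed (use r s in \<open>auto simp: S_def\<close>)
      also have "of_real s * \<zeta> - of_real r * \<zeta> = of_real (s - r) * \<zeta>" by (simp add: algebra_simps)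
      also have "cmod \<dots> = \<bar>s - r\<bar>" using \<zeta> by (simp add: norm_mult del: of_real_diff)
      finally show ?thesis .
    qed
    have "cmod (L - \<theta> (of_real r * \<zeta>)) \<le> (cmod D + 1) * \<bar>1 - r\<bar>"
    proof (rule tendsto_le)
      show "((\<lambda>s. cmod (\<theta> (of_real s * \<zeta>) - \<theta> (of_real r * \<zeta>))) \<longlongrightarrow> cmod (L - \<theta> (of_real r * \<zeta>))) (at_left 1)"
        by (intro tendsto_intros lim)
      show "((\<lambda>s. (cmod D + 1) * \<bar>s - r\<bar>) \<longlongrightarrow> (cmod D + 1) * \<bar>1 - r\<bar>) (at_left 1)"
        by (intro tendsto_intros)
      show "\<forall>\<^sub>F s in at_left 1. cmod (\<theta> (of_real s * \<zeta>) - \<theta> (of_real r * \<zeta>)) \<le> (cmod D + 1) * \<bar>s - r\<bar>"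
        using eventually_at_left_real[OF b] by eventually_elim (auto intro: bd)
    qed simp
    moreover have "1 - t \<le> cmod (L - \<theta> (of_real r * \<zeta>))"
      using norm_triangle_ineq2[of L "\<theta> (of_real r * \<zeta>)"] L by (simp add: t_def)
    ultimately have t1: "1 - t \<le> (cmod D + 1) * (1 - r)" using r by simp
    have t: "0 \<le> t" "t \<le> 1"
      unfolding t_def using le[of "of_real r * \<zeta>"] r0 r \<zeta> by (auto simp: norm_mult)
    have "1 - t\<^sup>2 = (1 + t) * (1 - t)" by (simp add: power2_eq_square algebra_simps)
    also have "\<dots> \<le> 2 * ((cmod D + 1) * (1 - r))"
      using t t1 r by (intro mult_mono) auto
    also have "\<dots> \<le> 2 * ((cmod D + 1) * (1 - r\<^sup>2))"
      using r r0 by (intro mult_left_mono) (auto simp: power2_eq_square mult_left_le)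
    finally have "1 - t\<^sup>2 \<le> 2 * (cmod D + 1) * (1 - r\<^sup>2)" by (simp only: mult.assoc)
    moreover have "0 < 1 - r\<^sup>2" using r r0 by (simp add: power_less_one_iff)
    ultimately show ?thesis
      unfolding Julia_quotient_def t_def[symmetric] by (subst pos_divide_le_eq)
  qed
  then have "\<forall>\<^sub>F r in at_left 1. Q r \<le> 2 * (cmod D + 1)"
    using eventually_at_left_real[OF b] by (auto elim: eventually_mono)
  then show ?thesis by (rule that)
qed

text \<open>Everything is decided by the lower limit \<open>C\<close> of \<open>Q\<close>. If it is
  infinite, \<open>Q\<close> is unbounded and no angular derivative exists; if it equals c <
  \<infinity>, Julia's lemma applies with this c and \<theta>' has the limit c L / \<zeta>, of
  modulus c.\<close>

theorem Julia_Caratheodory: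
  shows "((\<lambda>r. ennreal (Q r)) \<longlongrightarrow> angular_derivative_modulus \<theta> \<zeta>) (at_left 1)"
    and "\<And>r. 0 \<le> r \<Longrightarrow> r < 1 \<Longrightarrow> ennreal (Q r) \<le> ennreal (4 / (1 + r)\<^sup>2) * angular_derivative_modulus \<theta> \<zeta>"
proof -
  define C where "C = Liminf (at_left 1) (\<lambda>r. ennreal (Q r))"
  have low: "\<forall>\<^sub>F r in at_left 1. y < ennreal (Q r)" if "y < C" for y
    using that le_Liminf_iff[of C "at_left 1" "\<lambda>r. ennreal (Q r)"] by (simp add: C_def)
  have "((\<lambda>r. ennreal (Q r)) \<longlongrightarrow> angular_derivative_modulus \<theta> \<zeta>) (at_left 1) \<and>
    (\<forall>r. 0 \<le> r \<longrightarrow> r < 1 \<longrightarrow> ennreal (Q r) \<le> ennreal (4 / (1 + r)\<^sup>2) * angular_derivative_modulus \<theta> \<zeta>)"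
  proof (cases "C = \<infinity>")
    case True
    have "\<not> has_angular_derivative \<theta> \<zeta>"
    proof
      assume "has_angular_derivative \<theta> \<zeta>"
      then obtain M where "\<forall>\<^sub>F r in at_left 1. Q r \<le> M" by (rule Q_bounded_if_angular_derivative)
      moreover have "\<forall>\<^sub>F r in at_left 1. ennreal M < ennreal (Q r)" by (rule low) (simp add: True)
      ultimately have "\<forall>\<^sub>F r in at_left (1::real). False"
        by eventually_elim (use ennreal_leI in \<open>fastforce simp: not_le[symmetric]\<close>)
      then show False by simp
    qed
    then have amod: "angular_derivative_modulus \<theta> \<zeta> = \<infinity>" by (simp add: angular_derivative_modulus_def)
    have "((\<lambda>r. ennreal (Q r)) \<longlongrightarrow> \<infinity>) (at_left 1)"
      by (intro order_tendstoI low) (auto simp: True)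
    then show ?thesis by (auto simp: amod ennreal_mult_eq_top_iff ennreal_mult_top divide_pos_pos)
  next
    case False
    then obtain c where c: "0 \<le> c" "C = ennreal c" by (cases C) auto
    \<comment> \<open>\<open>ennreal\<close> sends negative numbers to 0, so the case c - e < 0 is
      settled by \<open>Q_nonneg\<close> instead.\<close>
    have low': "\<forall>\<^sub>F r in at_left 1. c - e < Q r" if e: "0 < e" for e
    proof (cases "0 \<le> c - e")
      case True
      then have "ennreal (c - e) < C" using e c by (simp add: ennreal_less_iff)
      from low[OF this] ev_radial show ?thesis
        by eventually_elim (use True Q_nonneg in \<open>auto simp: ennreal_less_iff\<close>)
    next
      case False
      then show ?thesis using ev_radial
        by (auto elim!: eventually_mono intro: less_le_trans[OF _ Q_nonneg])
    qed
    have freq: "\<exists>\<^sub>F r in at_left 1. Q r \<le> c + e" if e: "0 < e" for e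
    proof -
      have "C < ennreal (c + e)" using c e by (simp add: ennreal_less_iff)
      then have "\<not> ennreal (c + e) \<le> Liminf (at_left 1) (\<lambda>r. ennreal (Q r))"
        by (simp add: C_def not_le)
      then obtain y where y: "y < ennreal (c + e)" "\<not> (\<forall>\<^sub>F r in at_left 1. y < ennreal (Q r))"
        unfolding le_Liminf_iff by blast
      then have "\<exists>\<^sub>F r in at_left 1. \<not> y < ennreal (Q r)" by (simp add: not_eventually)
      then show ?thesis
      proof (rule frequently_elim1)
        fix r assume "\<not> y < ennreal (Q r)"
        with y have "ennreal (Q r) < ennreal (c + e)" by simp
        then show "Q r \<le> c + e" by (metis ennreal_leI leD linear)
      qed
    qed
    have "nt_tendsto \<theta> \<zeta> L \<and> nt_tendsto (deriv \<theta>) \<zeta> (of_real c * L / \<zeta>)"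
    proof (cases "c = 0")
      case False
      then show ?thesis using angular_derivative_pos[OF freq _ low'] c by auto
    next
      case True
      have "\<theta> z = L" if z: "cmod z < 1" for z
      proof -
        have "(cmod (L - \<theta> z))\<^sup>2 * (1 - (cmod z)\<^sup>2) \<le> 0"
          using Julia[OF freq z] True by simp
        moreover have "0 < 1 - (cmod z)\<^sup>2" using z by (simp add: power_less_one_iff)
        ultimately show ?thesis by (simp add: mult_le_0_iff)
      qed
      from angular_derivative_zero[OF this] True show ?thesis by simp
    qed
    then have nt: "nt_tendsto \<theta> \<zeta> L" "nt_tendsto (deriv \<theta>) \<zeta> (of_real c * L / \<zeta>)" by auto
    then have "has_angular_derivative \<theta> \<zeta>" using L by (auto simp: has_angular_derivative_def)
    moreover have "(THE D. nt_tendsto (deriv \<theta>) \<zeta> D) = of_real c * L / \<zeta>"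
      using nt(2) nt_tendsto_unique[OF \<zeta>] by blast
    ultimately have amod: "angular_derivative_modulus \<theta> \<zeta> = ennreal c"
      using c L \<zeta> by (simp add: angular_derivative_modulus_def norm_mult norm_divide)
    show ?thesis unfolding amod
      using Q_tendsto[OF freq c(1) low'] Q_le[OF freq c(1)] c
      by (auto intro!: tendsto_ennrealI ennreal_leI simp: ennreal_mult[symmetric] simp del: times_divide_eq_left)
  qed
  then show "((\<lambda>r. ennreal (Q r)) \<longlongrightarrow> angular_derivative_modulus \<theta> \<zeta>) (at_left 1)"
    and "\<And>r. 0 \<le> r \<Longrightarrow> r < 1 \<Longrightarrow> ennreal (Q r) \<le> ennreal (4 / (1 + r)\<^sup>2) * angular_derivative_modulus \<theta> \<zeta>"
    by auto
qed

end

section \<open>Parseval's identity on circles\<close>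

text \<open>Nothing is known about a holomorphic function outside the disc, so \<open>\<zeta> \<mapsto> f (r * \<zeta>)\<close> need not be
  measurable for a measure on the whole plane. Restricting to the circle repairs this, and
  \<open>nn_integral_restrict_space\<close> holds without any measurability assumption.\<close>

definition unit_circle :: "complex measure" where
  "unit_circle = restrict_space circle_measure (sphere 0 1)"

lemma sets_circle_measure [simp, measurable_cong]: "sets circle_measure = sets borel"
  and space_circle_measure [simp]: "space circle_measure = UNIV"
  by (simp_all add: circle_measure_def)

lemma borel_measurable_cis [measurable]: "cis \<in> borel_measurable borel"
  by (intro borel_measurable_continuous_onI continuous_intros)

lemma space_unit_circle [simp]: "space unit_circle = sphere 0 1"
  by (simp add: unit_circle_def space_restrict_space)

lemma sets_unit_circle [measurable_cong]: "sets unit_circle = sets (restrict_space borel (sphere 0 1))"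
  unfolding unit_circle_def by (intro sets_restrict_space_cong) simp

lemma AE_circle_measure: "AE \<zeta> in circle_measure. \<zeta> \<in> sphere 0 1"
  unfolding circle_measure_def
  by (subst AE_distr_iff) (simp_all add: uniform_measure_def AE_density pred_def)

lemma AE_unit_circle: "(AE \<zeta> in unit_circle. P \<zeta>) \<longleftrightarrow> (AE \<zeta> in circle_measure. P \<zeta>)"
proof -
  have "(AE \<zeta> in unit_circle. P \<zeta>) \<longleftrightarrow> (AE \<zeta> in circle_measure. \<zeta> \<in> sphere 0 1 \<longrightarrow> P \<zeta>)"
    unfolding unit_circle_def by (rule AE_restrict_space_iff) simp
  also have "\<dots> \<longleftrightarrow> (AE \<zeta> in circle_measure. P \<zeta>)"
    by (rule eventually_subst) (use AE_circle_measure in \<open>auto elim!: eventually_mono\<close>)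
  finally show ?thesis .
qed

lemma nn_integral_unit_circle:
  "(\<integral>\<^sup>+ \<zeta>. F \<zeta> \<partial>unit_circle) = (\<integral>\<^sup>+ \<zeta>. F \<zeta> \<partial>circle_measure)"
proof -
  have "(\<integral>\<^sup>+ \<zeta>. F \<zeta> \<partial>unit_circle) = (\<integral>\<^sup>+ \<zeta>. F \<zeta> * indicator (sphere 0 1) \<zeta> \<partial>circle_measure)"
    unfolding unit_circle_def by (rule nn_integral_restrict_space) simp
  also have "\<dots> = (\<integral>\<^sup>+ \<zeta>. F \<zeta> \<partial>circle_measure)"
    by (rule nn_integral_cong_AE) (use AE_circle_measure in \<open>auto elim!: eventually_mono\<close>)
  finally show ?thesis .
qed

lemma emeasure_unit_circle [simp]: "emeasure unit_circle (sphere 0 1) = 1"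
proof -
  have "emeasure unit_circle (space unit_circle) = (\<integral>\<^sup>+ \<zeta>. 1 \<partial>unit_circle)"
    by (simp del: space_unit_circle)
  also have "\<dots> = (\<integral>\<^sup>+ \<zeta>. 1 \<partial>circle_measure)" by (rule nn_integral_unit_circle)
  also have "\<dots> = emeasure circle_measure UNIV" by simp
  also have "\<dots> = 1"
    unfolding circle_measure_def
    by (subst emeasure_distr) (auto simp: emeasure_uniform_measure_1 ennreal_divide_self)
  finally show ?thesis by simp
qed

interpretation unit_circle: finite_measure unit_circle
  by (rule finite_measureI) simp

lemma borel_measurable_holomorphic_ball:
  assumes "g holomorphic_on ball 0 1" "h \<in> borel_measurable N" "\<And>x. x \<in> space N \<Longrightarrow> cmod (h x) < 1"
  shows "(\<lambda>x. g (h x)) \<in> borel_measurable N"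
proof -
  have g: "g \<in> borel_measurable (restrict_space borel (ball 0 1))"
    by (intro borel_measurable_continuous_on_restrict holomorphic_on_imp_continuous_on assms)
  have h: "h \<in> measurable N (restrict_space borel (ball 0 1))"
    by (rule measurable_restrict_space2) (use assms in auto)
  show ?thesis by (rule measurable_compose[OF h g])
qed

lemma borel_measurable_unit_circle_id [measurable]: "(\<lambda>\<zeta>. \<zeta>) \<in> borel_measurable unit_circle"
  by (subst measurable_cong_sets[OF sets_unit_circle refl]) (simp add: measurable_restrict_space1)

lemma borel_measurable_radius [measurable (raw)]:
  assumes "g holomorphic_on ball 0 1" "0 \<le> r" "r < 1"
  shows "(\<lambda>\<zeta>. g (of_real r * \<zeta>)) \<in> borel_measurable unit_circle"
  by (rule borel_measurable_holomorphic_ball[OF assms(1)]) (use assms in \<open>auto simp: norm_mult\<close>)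

lemma integral_unit_circle:
  fixes F :: "complex \<Rightarrow> complex"
  assumes [measurable]: "F \<in> borel_measurable borel"
  shows "(\<integral>\<zeta>. F \<zeta> \<partial>unit_circle) = (\<integral>t. indicator {0..2*pi} t *\<^sub>R F (cis t) \<partial>lborel) / of_real (2 * pi)"
proof -
  have "(\<integral>\<zeta>. F \<zeta> \<partial>unit_circle) = (\<integral>\<zeta>. indicator (sphere 0 1) \<zeta> *\<^sub>R F \<zeta> \<partial>circle_measure)"
    unfolding unit_circle_def by (rule integral_restrict_space) simp
  also have "\<dots> = (\<integral>\<zeta>. F \<zeta> \<partial>circle_measure)"
  proof (rule integral_cong_AE)
    show "AE \<zeta> in circle_measure. indicator (sphere 0 1) \<zeta> *\<^sub>R F \<zeta> = F \<zeta>"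
      using AE_circle_measure by (auto elim!: eventually_mono)
    have eq: "borel_measurable circle_measure = (borel_measurable borel :: (complex \<Rightarrow> complex) set)"
      by (rule measurable_cong_sets) simp_all
    have [measurable]: "sphere 0 1 \<in> sets (borel :: complex measure)" by simp
    show "(\<lambda>\<zeta>. indicator (sphere 0 1) \<zeta> *\<^sub>R F \<zeta>) \<in> borel_measurable circle_measure"
      "F \<in> borel_measurable circle_measure" unfolding eq by measurable
  qed
  also have "\<dots> = (\<integral>t. F (cis t) \<partial>uniform_measure lborel {0..2*pi})"
    unfolding circle_measure_def by (rule integral_distr) simp_all
  also have "uniform_measure lborel {0..2*pi} = density lborel (\<lambda>t. ennreal (indicator {0..2*pi} t / (2 * pi)))"
    unfolding uniform_measure_def
    by (intro density_cong) (auto simp: divide_ennreal[symmetric] split: split_indicator)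
  also have "(\<integral>t. F (cis t) \<partial>\<dots>) = (\<integral>t. (indicator {0..2*pi} t / (2 * pi)) *\<^sub>R F (cis t) \<partial>lborel)"
    by (rule integral_density) auto
  also have "\<dots> = (\<integral>t. (indicator {0..2*pi} t *\<^sub>R F (cis t)) / of_real (2 * pi) \<partial>lborel)"
    by (intro Bochner_Integration.integral_cong) (auto simp: scaleR_conv_of_real)
  also have "\<dots> = (\<integral>t. indicator {0..2*pi} t *\<^sub>R F (cis t) \<partial>lborel) / of_real (2 * pi)"
    by (rule integral_divide_zero)
  finally show ?thesis .
qed

lemma unit_circle_orthonormal:
  "(\<integral>\<zeta>. \<zeta> ^ j * cnj \<zeta> ^ k \<partial>unit_circle) = (if j = k then 1 else 0)"
proof -
  have cnj_meas: "cnj \<in> borel_measurable borel"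
    by (intro borel_measurable_continuous_onI continuous_intros)
  have [measurable]: "(\<lambda>\<zeta>. \<zeta> ^ j * cnj \<zeta> ^ k) \<in> borel_measurable borel"
    using cnj_meas by measurable
  \<comment> \<open>A real number, since subtraction of natural numbers would truncate for j <
    k.\<close>
  define n where "n = real j - real k"
  have e: "cis t ^ j * cnj (cis t) ^ k = cis (n * t)" for t
    by (simp add: cis_cnj Complex.DeMoivre cis_mult n_def algebra_simps)
  have "(\<integral>\<zeta>. \<zeta> ^ j * cnj \<zeta> ^ k \<partial>unit_circle) = (\<integral>t. indicator {0..2*pi} t *\<^sub>R cis (n * t) \<partial>lborel) / of_real (2 * pi)"
    by (subst integral_unit_circle) (simp_all add: e)
  also have "\<dots> = (if j = k then 1 else 0)"
  proof (cases "j = k")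
    case True
    then have "n = 0" by (simp add: n_def)
    then have "(\<integral>t. indicator {0..2*pi} t *\<^sub>R cis (n * t) \<partial>lborel) = (\<integral>t. indicator {0..2*pi} t *\<^sub>R (1::complex) \<partial>lborel)"
      by simp
    also have "\<dots> = of_real (2 * pi)"
      by (subst integral_scaleR_left) (auto simp: scaleR_conv_of_real)
    finally show ?thesis using True by simp
  next
    case False
    then have n: "n \<noteq> 0" by (simp add: n_def)
    have "(\<integral>t. indicator {0..2*pi} t *\<^sub>R cis (n * t) \<partial>lborel) = cis (n * (2 * pi)) / (\<i> * of_real n) - cis (n * 0) / (\<i> * of_real n)"
    proof (rule integral_FTC_Icc)
      fix t :: real
      have "((\<lambda>z. exp (\<i> * (of_real n * z)) / (\<i> * of_real n)) has_field_derivative exp (\<i> * (of_real n * of_real t))) (at (of_real t))"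
      proof -
        have "\<i> * (x * \<i>) = - x" for x :: complex by (metis i_squared mult.commute mult.left_commute mult_minus1 power2_eq_square power2_i)
        then show ?thesis using n by (auto intro!: derivative_eq_intros)
      qed
      then have "((\<lambda>t. exp (\<i> * (of_real n * of_real t)) / (\<i> * of_real n)) has_vector_derivative
          exp (\<i> * (of_real n * of_real t))) (at t within {0..2*pi})"
        by (rule has_vector_derivative_real_field)
      then show "((\<lambda>t. cis (n * t) / (\<i> * of_real n)) has_vector_derivative cis (n * t)) (at t within {0..2*pi})"
        by (simp add: cis_conv_exp)
    qed (auto intro!: continuous_intros)
    moreover have "cis (n * (2 * pi)) = 1"
    proof -
      have "cis (n * (2 * pi)) = cis (of_int (int j - int k) * (2 * pi))" by (simp add: n_def)
      also have "\<dots> = 1" using cis_multiple_2pi[of "of_int (int j - int k)"] by (simp add: mult.commute)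
      finally show ?thesis .
    qed
    ultimately show ?thesis using False by simp
  qed
  finally show ?thesis .
qed

lemma integrable_unit_circle_bounded:
  fixes F :: "complex \<Rightarrow> 'a::{banach, second_countable_topology}"
  assumes "F \<in> borel_measurable unit_circle" "\<And>\<zeta>. cmod \<zeta> = 1 \<Longrightarrow> norm (F \<zeta>) \<le> B"
  shows "integrable unit_circle F"
  by (rule unit_circle.integrable_const_bound[where B = B]) (use assms in auto)

lemma continuous_unit_circle_measurable:
  fixes F :: "complex \<Rightarrow> 'a::topological_space"
  assumes "continuous_on (sphere 0 1) F"
  shows "F \<in> borel_measurable unit_circle"
  unfolding measurable_cong_sets[OF sets_unit_circle refl]
  by (rule borel_measurable_continuous_on_restrict[OF assms])

lemma integral_unit_circle_poly:
  "(\<integral>\<zeta>. (cmod (\<Sum>k<N. c k * \<zeta> ^ k))\<^sup>2 \<partial>unit_circle) = (\<Sum>k<N. (cmod (c k))\<^sup>2)"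
proof -
  have int: "integrable unit_circle (\<lambda>\<zeta>. c j * cnj (c k) * (\<zeta> ^ j * cnj \<zeta> ^ k))" for j k
    by (rule integrable_unit_circle_bounded[where B = "cmod (c j * cnj (c k))"])
       (auto intro!: continuous_unit_circle_measurable continuous_intros simp: norm_mult norm_power)
  have "complex_of_real (\<integral>\<zeta>. (cmod (\<Sum>k<N. c k * \<zeta> ^ k))\<^sup>2 \<partial>unit_circle)
      = (\<integral>\<zeta>. (\<Sum>j<N. \<Sum>k<N. c j * cnj (c k) * (\<zeta> ^ j * cnj \<zeta> ^ k)) \<partial>unit_circle)"
    unfolding integral_complex_of_real[symmetric] complex_norm_square
    by (intro Bochner_Integration.integral_cong) (simp_all add: sum_product mult_ac)
  also have "\<dots> = (\<Sum>j<N. \<Sum>k<N. c j * cnj (c k) * (if j = k then 1 else 0))"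
    unfolding unit_circle_orthonormal[symmetric]
    by (subst Bochner_Integration.integral_sum, intro Bochner_Integration.integrable_sum int)
       (intro sum.cong refl, subst Bochner_Integration.integral_sum, rule int, simp)
  also have "\<dots> = complex_of_real (\<Sum>k<N. (cmod (c k))\<^sup>2)"
    by (simp add: if_distrib[of "(*) _"] complex_norm_square del: of_real_power cong: if_cong)
  finally show ?thesis by (simp only: of_real_eq_iff)
qed

text \<open>Absolute summability bounds all partial sums by one constant, so dominated convergence
  passes from polynomials to the series. The lemma is applied to dilates with r < 1, whose
  coefficients carry the factor r^k.\<close>

lemma Parseval_series:
  assumes c: "summable (\<lambda>k. cmod (c k))"
  shows "(\<integral>\<^sup>+\<zeta>. ennreal ((cmod (\<Sum>k. c k * \<zeta> ^ k))\<^sup>2) \<partial>unit_circle) = (\<Sum>k. ennreal ((cmod (c k))\<^sup>2))"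
proof -
  define h where "h = (\<lambda>\<zeta>. \<Sum>k. c k * \<zeta> ^ k)"
  define p where "p = (\<lambda>N \<zeta>. \<Sum>k<N. c k * \<zeta> ^ k)"
  have sm: "summable (\<lambda>k. cmod (c k * \<zeta> ^ k))" if "cmod \<zeta> = 1" for \<zeta>
    using c that by (simp add: norm_mult norm_power)
  have lim: "(\<lambda>N. p N \<zeta>) \<longlonglongrightarrow> h \<zeta>" if "cmod \<zeta> = 1" for \<zeta>
    unfolding p_def h_def by (rule summable_LIMSEQ[OF summable_norm_cancel[OF sm[OF that]]])
  have pm [measurable]: "p N \<in> borel_measurable unit_circle" for N
    unfolding p_def by (auto intro!: continuous_unit_circle_measurable continuous_intros)
  have hm [measurable]: "h \<in> borel_measurable unit_circle"
  proof (rule borel_measurable_LIMSEQ_metric)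
    show "p N \<in> borel_measurable unit_circle" for N by (rule pm)
    show "(\<lambda>N. p N \<zeta>) \<longlonglongrightarrow> h \<zeta>" if "\<zeta> \<in> space unit_circle" for \<zeta>
      using that by (intro lim) simp
  qed
  have bound: "cmod (p N \<zeta>) \<le> (\<Sum>k. cmod (c k))" if "cmod \<zeta> = 1" for N \<zeta>
  proof -
    have "cmod (p N \<zeta>) \<le> (\<Sum>k<N. cmod (c k * \<zeta> ^ k))" unfolding p_def by (rule norm_sum)
    also have "\<dots> \<le> (\<Sum>k. cmod (c k))"
      using that c by (simp add: norm_mult norm_power) (intro sum_le_suminf, auto)
    finally show ?thesis .
  qed
  have bound': "cmod (h \<zeta>) \<le> (\<Sum>k. cmod (c k))" if "cmod \<zeta> = 1" for \<zeta>
    by (rule tendsto_upperbound[OF tendsto_norm[OF lim[OF that]]]) (use bound[OF that] in auto)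
  have "(\<lambda>N. \<integral>\<zeta>. (cmod (p N \<zeta>))\<^sup>2 \<partial>unit_circle) \<longlonglongrightarrow> (\<integral>\<zeta>. (cmod (h \<zeta>))\<^sup>2 \<partial>unit_circle)"
  proof (rule integral_dominated_convergence[where w = "\<lambda>_. (\<Sum>k. cmod (c k))\<^sup>2"])
    show "AE \<zeta> in unit_circle. (\<lambda>N. (cmod (p N \<zeta>))\<^sup>2) \<longlonglongrightarrow> (cmod (h \<zeta>))\<^sup>2"
      by (rule AE_I2) (auto intro!: tendsto_intros lim)
    show "AE \<zeta> in unit_circle. norm ((cmod (p N \<zeta>))\<^sup>2) \<le> (\<Sum>k. cmod (c k))\<^sup>2" for N
      by (rule AE_I2) (auto intro!: power_mono bound)
  qed auto
  then have sums: "(\<lambda>k. (cmod (c k))\<^sup>2) sums (\<integral>\<zeta>. (cmod (h \<zeta>))\<^sup>2 \<partial>unit_circle)"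
    unfolding p_def integral_unit_circle_poly sums_def .
  have "(\<integral>\<^sup>+\<zeta>. ennreal ((cmod (h \<zeta>))\<^sup>2) \<partial>unit_circle) = ennreal (\<integral>\<zeta>. (cmod (h \<zeta>))\<^sup>2 \<partial>unit_circle)"
    by (rule nn_integral_eq_integral)
       (auto intro!: integrable_unit_circle_bounded[where B = "(\<Sum>k. cmod (c k))\<^sup>2"] power_mono bound')
  also have "\<dots> = (\<Sum>k. ennreal ((cmod (c k))\<^sup>2))"
    unfolding sums_unique[OF sums]
    by (rule suminf_ennreal2[symmetric, OF _ sums_summable[OF sums]]) simp
  finally show ?thesis unfolding h_def .
qed

section \<open>Taylor series and Parseval's identity on smaller circles\<close>

lemma taylor_sums:
  assumes "g holomorphic_on ball 0 1" "cmod z < 1"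
  shows "(\<lambda>k. taylor_coeff g k * z ^ k) sums g z"
  using holomorphic_power_series[OF assms(1), of z] assms(2) by (simp add: taylor_coeff_def)

lemma taylor_summable_norm:
  assumes "g holomorphic_on ball 0 1" "0 \<le> r" "r < 1"
  shows "summable (\<lambda>k. cmod (taylor_coeff g k) * r ^ k)"
proof -
  \<comment> \<open>Convergence at a point strictly between r and 1 implies absolute convergence at
    r.\<close>
  have "summable (\<lambda>k. taylor_coeff g k * of_real ((1 + r) / 2) ^ k)"
    by (rule sums_summable[OF taylor_sums[OF assms(1)]]) (use assms in \<open>simp del: of_real_divide of_real_add\<close>)
  then have "summable (\<lambda>k. cmod (taylor_coeff g k * of_real r ^ k))"
    by (rule powser_insidea) (use assms in \<open>simp del: of_real_divide of_real_add\<close>)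
  then show ?thesis using assms by (simp add: norm_mult norm_power)
qed

lemma Parseval:
  assumes g: "g holomorphic_on ball 0 1" and r: "0 \<le> r" "r < 1"
  shows "(\<integral>\<^sup>+\<zeta>. ennreal ((cmod (g (of_real r * \<zeta>)))\<^sup>2) \<partial>unit_circle)
    = (\<Sum>k. ennreal ((cmod (taylor_coeff g k))\<^sup>2 * r ^ (2 * k)))"
proof -
  have "(\<integral>\<^sup>+\<zeta>. ennreal ((cmod (g (of_real r * \<zeta>)))\<^sup>2) \<partial>unit_circle)
    = (\<integral>\<^sup>+\<zeta>. ennreal ((cmod (\<Sum>k. (taylor_coeff g k * of_real r ^ k) * \<zeta> ^ k))\<^sup>2) \<partial>unit_circle)"
  proof (rule nn_integral_cong)
    fix \<zeta> assume "\<zeta> \<in> space unit_circle"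
    then have "(\<lambda>k. taylor_coeff g k * (of_real r * \<zeta>) ^ k) sums g (of_real r * \<zeta>)"
      using r by (intro taylor_sums g) (simp add: norm_mult)
    then show "ennreal ((cmod (g (of_real r * \<zeta>)))\<^sup>2) = ennreal ((cmod (\<Sum>k. (taylor_coeff g k * of_real r ^ k) * \<zeta> ^ k))\<^sup>2)"
      by (simp add: sums_iff power_mult_distrib mult.assoc)
  qed
  also have "\<dots> = (\<Sum>k. ennreal ((cmod (taylor_coeff g k * of_real r ^ k))\<^sup>2))"
    by (rule Parseval_series) (use taylor_summable_norm[OF g r] r in \<open>simp add: norm_mult norm_power\<close>)
  also have "\<dots> = (\<Sum>k. ennreal ((cmod (taylor_coeff g k))\<^sup>2 * r ^ (2 * k)))"
    using r by (simp add: norm_mult norm_power power_mult_distrib power_mult[symmetric] mult.commute)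
  finally show ?thesis .
qed

section \<open>Multiplication by an inner function\<close>

text \<open>The convergence theorems for integrals speak of sequences, so r -> 1 is replaced by this
  one. It increases, which makes monotone convergence applicable to the weights.\<close>

definition approach_one :: "nat \<Rightarrow> real" where
  "approach_one m = 1 - 1 / real (m + 1)"

lemma approach_one_bounds: "0 \<le> approach_one m" "approach_one m < 1"
  by (auto simp: approach_one_def)

lemma approach_one_mono: "m \<le> n \<Longrightarrow> approach_one m \<le> approach_one n"
  unfolding approach_one_def by (intro diff_left_mono divide_left_mono) auto

lemma filterlim_approach_one: "filterlim approach_one (at_left 1) sequentially"
proof -
  have "approach_one \<longlonglongrightarrow> 1"
    unfolding approach_one_def by real_asymp
  then show ?thesis
    using approach_one_bounds(2) unfolding filterlim_at
    by (intro conjI always_eventually allI) (auto simp: less_le)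
qed

lemma approach_one_tendsto: "approach_one \<longlonglongrightarrow> 1"
  using filterlim_approach_one unfolding filterlim_at by blast

text \<open>Monotone convergence for counting measure.\<close>

lemma suminf_ennreal_mono_tendsto:
  fixes F :: "nat \<Rightarrow> nat \<Rightarrow> ennreal"
  assumes mono: "\<And>k. incseq (\<lambda>m. F m k)" and lim: "\<And>k. (\<lambda>m. F m k) \<longlonglongrightarrow> f k"
  shows "(\<lambda>m. \<Sum>k. F m k) \<longlonglongrightarrow> (\<Sum>k. f k)"
proof -
  have "f k = (SUP m. F m k)" for k
    using LIMSEQ_unique[OF lim LIMSEQ_SUP[OF mono]] .
  then have "(\<Sum>k. f k) = (SUP m. \<Sum>k. F m k)"
    using ennreal_suminf_SUP_eq[of F] mono by simp
  moreover have "incseq (\<lambda>m. \<Sum>k. F m k)"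
    using mono by (auto simp: incseq_def intro!: suminf_le)
  ultimately show ?thesis using LIMSEQ_SUP[of "\<lambda>m. \<Sum>k. F m k"] by simp
qed

text \<open>Extended-valued, so that it can be used for f \<theta> before that product is known to
  have square-summable coefficients.\<close>

definition hardy_norm_sq :: "(complex \<Rightarrow> complex) \<Rightarrow> ennreal" where
  "hardy_norm_sq g = (\<Sum>k. ennreal ((cmod (taylor_coeff g k))\<^sup>2))"

lemma Parseval_tendsto:
  "(\<lambda>m. \<Sum>k. ennreal ((cmod (taylor_coeff g k))\<^sup>2 * approach_one m ^ (2 * k))) \<longlonglongrightarrow> hardy_norm_sq g"
  unfolding hardy_norm_sq_def
proof (rule suminf_ennreal_mono_tendsto)
  fix k
  show "incseq (\<lambda>m. ennreal ((cmod (taylor_coeff g k))\<^sup>2 * approach_one m ^ (2 * k)))"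
    by (auto simp: incseq_def intro!: ennreal_leI mult_left_mono power_mono approach_one_mono approach_one_bounds)
  have "(\<lambda>m. (cmod (taylor_coeff g k))\<^sup>2 * approach_one m ^ (2 * k)) \<longlonglongrightarrow> (cmod (taylor_coeff g k))\<^sup>2 * 1 ^ (2 * k)"
    by (intro tendsto_intros approach_one_tendsto)
  then show "(\<lambda>m. ennreal ((cmod (taylor_coeff g k))\<^sup>2 * approach_one m ^ (2 * k))) \<longlonglongrightarrow> ennreal ((cmod (taylor_coeff g k))\<^sup>2)"
    by (intro tendsto_ennrealI) simp
qed

lemma H2_hardy_norm_finite:
  assumes "f \<in> H2"
  shows "hardy_norm_sq f < \<infinity>"
proof -
  have "(\<Sum>k. ennreal ((cmod (taylor_coeff f k))\<^sup>2)) \<noteq> \<infinity>"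
    unfolding infinity_ennreal_def
    by (rule ennreal_suminf_neq_top) (use assms in \<open>auto simp: H2_def\<close>)
  then show ?thesis by (simp add: hardy_norm_sq_def less_top)
qed

lemma inner_function_AE:
  assumes "inner_function \<theta>"
  shows "AE \<zeta> in unit_circle. \<exists>L. ((\<lambda>r::real. \<theta> (of_real r * \<zeta>)) \<longlongrightarrow> L) (at_left 1) \<and> cmod L = 1"
  using assms unfolding AE_unit_circle inner_function_def by blast

lemma inner_function_AE_norm:
  assumes "inner_function \<theta>"
  shows "AE \<zeta> in unit_circle. (\<lambda>m. cmod (\<theta> (of_real (approach_one m) * \<zeta>))) \<longlonglongrightarrow> 1"
  using inner_function_AE[OF assms]
proof (rule eventually_mono)
  fix \<zeta> assume "\<exists>L. ((\<lambda>r::real. \<theta> (of_real r * \<zeta>)) \<longlongrightarrow> L) (at_left 1) \<and> cmod L = 1"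
  then obtain L where L: "((\<lambda>r::real. \<theta> (of_real r * \<zeta>)) \<longlongrightarrow> L) (at_left 1)" "cmod L = 1" by blast
  from tendsto_norm[OF filterlim_compose[OF L(1) filterlim_approach_one]] L(2)
  show "(\<lambda>m. cmod (\<theta> (of_real (approach_one m) * \<zeta>))) \<longlonglongrightarrow> 1" by simp
qed

lemma inner_function_holomorphic: "inner_function \<theta> \<Longrightarrow> \<theta> holomorphic_on ball 0 1"
  by (simp add: inner_function_def)

text \<open>The definition only bounds \<open>\<theta>\<close> by some constant. Since all Taylor coefficients of \<open>\<theta>\<^sup>n\<close> have
  modulus at most 1, \<open>\<bar>\<theta> z\<bar>\<^sup>n \<le> 1 / (1 - \<bar>z\<bar>)\<close> for every \<open>n\<close>.\<close>

lemma inner_function_le_1: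
  assumes inner: "inner_function \<theta>" and z: "cmod z < 1"
  shows "cmod (\<theta> z) \<le> 1"
proof -
  note hol = inner_function_holomorphic[OF inner]
  from inner obtain B where B: "\<And>z. cmod z < 1 \<Longrightarrow> cmod (\<theta> z) \<le> B"
    by (fastforce simp: inner_function_def bounded_iff)
  have coeff: "cmod (taylor_coeff (\<lambda>z. \<theta> z ^ n) k) \<le> 1" for n k
  proof -
    have holn: "(\<lambda>z. \<theta> z ^ n) holomorphic_on ball 0 1" by (intro holomorphic_intros hol)
    let ?a = "(cmod (taylor_coeff (\<lambda>z. \<theta> z ^ n) k))\<^sup>2"
    \<comment> \<open>The mean of |\<theta>^n|^2 over circles tends to 1 whatever n is, because B^n
      serves only as a dominating constant. By Parseval this mean bounds each coefficient, up to a
      factor tending to 1.\<close>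
    let ?I = "\<lambda>m. \<integral>\<^sup>+\<zeta>. ennreal ((cmod (\<theta> (of_real (approach_one m) * \<zeta>) ^ n))\<^sup>2) \<partial>unit_circle"
    have "?I \<longlonglongrightarrow> (\<integral>\<^sup>+\<zeta>. 1 \<partial>unit_circle)"
    proof (rule nn_integral_dominated_convergence[where w = "\<lambda>_. ennreal ((B ^ n)\<^sup>2)"])
      show "(\<lambda>\<zeta>. ennreal ((cmod (\<theta> (of_real (approach_one m) * \<zeta>) ^ n))\<^sup>2)) \<in> borel_measurable unit_circle" for m
        using borel_measurable_radius[OF hol approach_one_bounds] by measurable
      show "AE \<zeta> in unit_circle. ennreal ((cmod (\<theta> (of_real (approach_one m) * \<zeta>) ^ n))\<^sup>2) \<le> ennreal ((B ^ n)\<^sup>2)" for m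
        using approach_one_bounds
        by (intro AE_I2 ennreal_leI power_mono) (auto simp: norm_power norm_mult intro!: power_mono B)
      show "AE \<zeta> in unit_circle. (\<lambda>m. ennreal ((cmod (\<theta> (of_real (approach_one m) * \<zeta>) ^ n))\<^sup>2)) \<longlonglongrightarrow> 1"
        using inner_function_AE_norm[OF inner]
      proof (rule eventually_mono)
        fix \<zeta> assume "(\<lambda>m. cmod (\<theta> (of_real (approach_one m) * \<zeta>))) \<longlonglongrightarrow> 1"
        then have "(\<lambda>m. (cmod (\<theta> (of_real (approach_one m) * \<zeta>)) ^ n)\<^sup>2) \<longlonglongrightarrow> (1 ^ n)\<^sup>2"
          by (intro tendsto_intros)
        then have "(\<lambda>m. ennreal ((cmod (\<theta> (of_real (approach_one m) * \<zeta>)) ^ n)\<^sup>2)) \<longlonglongrightarrow> ennreal ((1 ^ n)\<^sup>2)"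
          by (intro tendsto_ennrealI)
        then show "(\<lambda>m. ennreal ((cmod (\<theta> (of_real (approach_one m) * \<zeta>) ^ n))\<^sup>2)) \<longlonglongrightarrow> 1"
          by (simp add: norm_power)
      qed
    qed (auto simp: ennreal_mult_less_top)
    then have I: "?I \<longlonglongrightarrow> ennreal 1" by simp
    have "(\<lambda>m. ?a * approach_one m ^ (2 * k)) \<longlonglongrightarrow> ?a * 1 ^ (2 * k)"
      by (intro tendsto_intros approach_one_tendsto)
    then have A: "(\<lambda>m. ennreal (?a * approach_one m ^ (2 * k))) \<longlonglongrightarrow> ennreal ?a"
      by (intro tendsto_ennrealI) simp
    have "ennreal (?a * approach_one m ^ (2 * k)) \<le> ?I m" for m
    proof -
      let ?F = "\<lambda>k. ennreal ((cmod (taylor_coeff (\<lambda>z. \<theta> z ^ n) k))\<^sup>2 * approach_one m ^ (2 * k))"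
      have "sum ?F {k} \<le> suminf ?F" by (rule sum_le_suminf) auto
      then show ?thesis unfolding Parseval[OF holn approach_one_bounds] by simp
    qed
    then have "ennreal ?a \<le> ennreal 1"
      by (intro LIMSEQ_le[OF A I]) blast
    then have "?a \<le> 1\<^sup>2" by (subst (asm) ennreal_le_iff) auto
    then show ?thesis by (rule power2_le_imp_le) simp
  qed
  have pow: "cmod (\<theta> z) ^ n \<le> 1 / (1 - cmod z)" for n
  proof -
    have holn: "(\<lambda>z. \<theta> z ^ n) holomorphic_on ball 0 1" by (intro holomorphic_intros hol)
    let ?a = "taylor_coeff (\<lambda>z. \<theta> z ^ n)"
    have s: "summable (\<lambda>k. cmod (?a k) * cmod z ^ k)"
      by (rule taylor_summable_norm[OF holn]) (use z in auto)
    have "cmod (\<theta> z ^ n) = cmod (\<Sum>k. ?a k * z ^ k)"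
      using taylor_sums[OF holn z] by (simp add: sums_iff)
    also have "\<dots> \<le> (\<Sum>k. cmod (?a k * z ^ k))"
      by (rule summable_norm) (use s in \<open>simp add: norm_mult norm_power\<close>)
    also have "\<dots> \<le> (\<Sum>k. cmod z ^ k)"
    proof (rule suminf_le)
      show "cmod (?a k * z ^ k) \<le> cmod z ^ k" for k
        using coeff[of n k] by (simp add: norm_mult norm_power mult_left_le_one_le)
    qed (use s z in \<open>auto simp: norm_mult norm_power\<close>)
    also have "\<dots> = 1 / (1 - cmod z)" using z by (simp add: suminf_geometric)
    finally show ?thesis by (simp add: norm_power)
  qed
  show ?thesis
  proof (rule ccontr)
    assume "\<not> cmod (\<theta> z) \<le> 1"
    then obtain n where "1 / (1 - cmod z) < cmod (\<theta> z) ^ n"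
      using real_arch_pow[of "cmod (\<theta> z)"] by auto
    with pow[of n] show False by simp
  qed
qed

text \<open>The squared L^2 norm that f loses on the circle of radius r when it is multiplied by
  \<theta>.\<close>

definition inner_defect :: "(complex \<Rightarrow> complex) \<Rightarrow> (complex \<Rightarrow> complex) \<Rightarrow> real \<Rightarrow> ennreal" where
  "inner_defect f \<theta> r = (\<integral>\<^sup>+\<zeta>. ennreal ((cmod (f (of_real r * \<zeta>)))\<^sup>2 * (1 - (cmod (\<theta> (of_real r * \<zeta>)))\<^sup>2)) \<partial>unit_circle)"

text \<open>Pointwise this is |f|^2 = |f \<theta>|^2 + |f|^2 (1 - |\<theta>|^2), in a form that
  avoids subtraction of extended reals.\<close>

lemma Parseval_inner_defect:
  assumes f: "f holomorphic_on ball 0 1" and inner: "inner_function \<theta>" and r: "0 \<le> r" "r < 1"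
  shows "(\<Sum>k. ennreal ((cmod (taylor_coeff f k))\<^sup>2 * r ^ (2 * k))) =
    (\<Sum>k. ennreal ((cmod (taylor_coeff (\<lambda>z. f z * \<theta> z) k))\<^sup>2 * r ^ (2 * k))) + inner_defect f \<theta> r"
proof -
  note hol = inner_function_holomorphic[OF inner]
  have hg: "(\<lambda>z. f z * \<theta> z) holomorphic_on ball 0 1" by (intro holomorphic_intros f hol)
  note [measurable] = borel_measurable_radius[OF f r] borel_measurable_radius[OF hol r]
  have "(\<integral>\<^sup>+\<zeta>. ennreal ((cmod (f (of_real r * \<zeta>)))\<^sup>2) \<partial>unit_circle) =
    (\<integral>\<^sup>+\<zeta>. ennreal ((cmod (f (of_real r * \<zeta>) * \<theta> (of_real r * \<zeta>)))\<^sup>2) +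
        ennreal ((cmod (f (of_real r * \<zeta>)))\<^sup>2 * (1 - (cmod (\<theta> (of_real r * \<zeta>)))\<^sup>2)) \<partial>unit_circle)"
  proof (rule nn_integral_cong)
    fix \<zeta> assume "\<zeta> \<in> space unit_circle"
    then have "cmod (\<theta> (of_real r * \<zeta>)) \<le> 1"
      using r by (intro inner_function_le_1 inner) (simp add: norm_mult)
    then have "(cmod (\<theta> (of_real r * \<zeta>)))\<^sup>2 \<le> 1" by (simp add: power_le_one)
    then show "ennreal ((cmod (f (of_real r * \<zeta>)))\<^sup>2) = ennreal ((cmod (f (of_real r * \<zeta>) * \<theta> (of_real r * \<zeta>)))\<^sup>2) +
        ennreal ((cmod (f (of_real r * \<zeta>)))\<^sup>2 * (1 - (cmod (\<theta> (of_real r * \<zeta>)))\<^sup>2))"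
      by (subst ennreal_plus[symmetric]) (auto simp: norm_mult power_mult_distrib algebra_simps mult_left_le_one_le)
  qed
  also have "\<dots> = (\<integral>\<^sup>+\<zeta>. ennreal ((cmod (f (of_real r * \<zeta>) * \<theta> (of_real r * \<zeta>)))\<^sup>2) \<partial>unit_circle) + inner_defect f \<theta> r"
    unfolding inner_defect_def by (rule nn_integral_add) measurable
  finally show ?thesis
    unfolding Parseval[OF f r] using Parseval[OF hg r] by simp
qed

lemma H2_tail_tendsto:
  assumes "f \<in> H2"
  shows "(\<lambda>N. \<Sum>k. ennreal (if k < N then 0 else (cmod (taylor_coeff f k))\<^sup>2)) \<longlonglongrightarrow> 0"
proof -
  let ?b = "\<lambda>k. (cmod (taylor_coeff f k))\<^sup>2"
  have s: "summable ?b" using assms by (simp add: H2_def)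
  have sums: "(\<lambda>k. if k < N then 0 else ?b k) sums (suminf ?b - sum ?b {..<N})" for N
  proof -
    have "(\<lambda>k. ?b k - (if k \<in> {..<N} then ?b k else 0)) sums (suminf ?b - sum ?b {..<N})"
      by (intro sums_diff summable_sums s sums_If_finite_set) simp
    moreover have "?b k - (if k \<in> {..<N} then ?b k else 0) = (if k < N then 0 else ?b k)" for k
      by simp
    ultimately show ?thesis by simp
  qed
  have "(\<Sum>k. ennreal (if k < N then 0 else ?b k)) = ennreal (suminf ?b - sum ?b {..<N})" for N
    unfolding sums_unique[OF sums] by (rule suminf_ennreal2[OF _ sums_summable[OF sums]]) simp
  moreover have "(\<lambda>N. ennreal (suminf ?b - sum ?b {..<N})) \<longlonglongrightarrow> ennreal (suminf ?b - suminf ?b)"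
    by (intro tendsto_ennrealI tendsto_intros summable_LIMSEQ s)
  ultimately show ?thesis by simp
qed

text \<open>f is split into its Taylor polynomial of degree below N, bounded by the sum of its
  coefficients, and a remainder measured by Parseval; the factors 2 come from (x + y)^2 <= 2 x^2 + 2
  y^2. This approximation by polynomials takes the place of boundary values of f.\<close>

lemma inner_defect_le:
  assumes f: "f \<in> H2" and inner: "inner_function \<theta>" and r: "0 \<le> r" "r < 1"
  shows "inner_defect f \<theta> r \<le>
    ennreal (2 * (\<Sum>k<N. cmod (taylor_coeff f k))\<^sup>2) * (\<integral>\<^sup>+\<zeta>. ennreal (1 - (cmod (\<theta> (of_real r * \<zeta>)))\<^sup>2) \<partial>unit_circle)
     + 2 * (\<Sum>k. ennreal (if k < N then 0 else (cmod (taylor_coeff f k))\<^sup>2))"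
proof -
  note hol = inner_function_holomorphic[OF inner]
  have hf: "f holomorphic_on ball 0 1" using f by (simp add: H2_def)
  note [measurable] = borel_measurable_radius[OF hf r] borel_measurable_radius[OF hol r]
  let ?a = "taylor_coeff f"
  define C where "C = (\<Sum>k<N. cmod (?a k))"
  define c where "c = (\<lambda>k. (if k < N then 0 else ?a k) * of_real r ^ k)"
  have sc: "summable (\<lambda>k. cmod (c k))"
    by (rule summable_comparison_test'[OF taylor_summable_norm[OF hf r], of 0])
       (use r in \<open>auto simp: c_def norm_mult norm_power\<close>)
  have hm: "(\<lambda>\<zeta>. \<Sum>k. c k * \<zeta> ^ k) \<in> borel_measurable unit_circle"
    by (intro borel_measurable_suminf borel_measurable_times borel_measurable_power borel_measurable_unit_circle_id) simp
  have "inner_defect f \<theta> r \<le> (\<integral>\<^sup>+\<zeta>. ennreal (2 * C\<^sup>2) * ennreal (1 - (cmod (\<theta> (of_real r * \<zeta>)))\<^sup>2)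
      + 2 * ennreal ((cmod (\<Sum>k. c k * \<zeta> ^ k))\<^sup>2) \<partial>unit_circle)"
    unfolding inner_defect_def
  proof (rule nn_integral_mono)
    fix \<zeta> assume "\<zeta> \<in> space unit_circle"
    then have \<zeta>: "cmod \<zeta> = 1" by simp
    let ?z = "of_real r * \<zeta>"
    have z: "cmod ?z < 1" using r \<zeta> by (simp add: norm_mult)
    have t: "cmod (\<theta> ?z) \<le> 1" by (rule inner_function_le_1[OF inner z])
    then have t2: "(cmod (\<theta> ?z))\<^sup>2 \<le> 1" by (simp add: power_le_one)
    define P where "P = (\<Sum>k<N. ?a k * ?z ^ k)"
    have 1: "(\<lambda>k. ?a k * ?z ^ k - (if k \<in> {..<N} then ?a k * ?z ^ k else 0)) sums (f ?z - P)"
      unfolding P_def by (intro sums_diff taylor_sums hf z sums_If_finite_set) simp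
    have "(\<lambda>k. c k * \<zeta> ^ k) = (\<lambda>k. ?a k * ?z ^ k - (if k \<in> {..<N} then ?a k * ?z ^ k else 0))"
      by (auto simp: c_def power_mult_distrib)
    with 1 have fP: "(\<Sum>k. c k * \<zeta> ^ k) = f ?z - P" by (simp add: sums_iff)
    have "cmod P \<le> (\<Sum>k<N. cmod (?a k * ?z ^ k))" unfolding P_def by (rule norm_sum)
    also have "\<dots> \<le> C" unfolding C_def
      by (intro sum_mono) (use r \<zeta> in \<open>auto simp: norm_mult norm_power power_le_one mult_left_le\<close>)
    finally have P: "(cmod P)\<^sup>2 \<le> C\<^sup>2" by (intro power_mono) auto
    have "cmod (f ?z) \<le> cmod P + cmod (f ?z - P)" using norm_triangle_ineq[of P "f ?z - P"] by simp
    then have "(cmod (f ?z))\<^sup>2 \<le> (cmod P + cmod (f ?z - P))\<^sup>2" by (intro power_mono) auto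
    also have "\<dots> \<le> 2 * (cmod P)\<^sup>2 + 2 * (cmod (f ?z - P))\<^sup>2"
      using sum_squares_bound[of "cmod P" "cmod (f ?z - P)"] by (simp add: power2_sum)
    finally have "(cmod (f ?z))\<^sup>2 \<le> 2 * C\<^sup>2 + 2 * (cmod (f ?z - P))\<^sup>2" using P by simp
    then have "(cmod (f ?z))\<^sup>2 * (1 - (cmod (\<theta> ?z))\<^sup>2) \<le> (2 * C\<^sup>2 + 2 * (cmod (f ?z - P))\<^sup>2) * (1 - (cmod (\<theta> ?z))\<^sup>2)"
      using t2 by (intro mult_right_mono) auto
    also have "\<dots> \<le> 2 * C\<^sup>2 * (1 - (cmod (\<theta> ?z))\<^sup>2) + 2 * (cmod (f ?z - P))\<^sup>2"
      using t2 mult_left_le[of "1 - (cmod (\<theta> ?z))\<^sup>2" "2 * (cmod (f ?z - P))\<^sup>2"]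
      by (simp add: distrib_right)
    finally have "ennreal ((cmod (f ?z))\<^sup>2 * (1 - (cmod (\<theta> ?z))\<^sup>2)) \<le>
      ennreal (2 * C\<^sup>2 * (1 - (cmod (\<theta> ?z))\<^sup>2) + 2 * (cmod (f ?z - P))\<^sup>2)" by (rule ennreal_leI)
    also have "\<dots> = ennreal (2 * C\<^sup>2) * ennreal (1 - (cmod (\<theta> ?z))\<^sup>2) + 2 * ennreal ((cmod (f ?z - P))\<^sup>2)"
      using t2 by (simp add: ennreal_mult ennreal_plus)
    finally show "ennreal ((cmod (f ?z))\<^sup>2 * (1 - (cmod (\<theta> ?z))\<^sup>2)) \<le>
      ennreal (2 * C\<^sup>2) * ennreal (1 - (cmod (\<theta> ?z))\<^sup>2) + 2 * ennreal ((cmod (\<Sum>k. c k * \<zeta> ^ k))\<^sup>2)"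
      unfolding fP .
  qed
  also have "\<dots> = ennreal (2 * C\<^sup>2) * (\<integral>\<^sup>+\<zeta>. ennreal (1 - (cmod (\<theta> (of_real r * \<zeta>)))\<^sup>2) \<partial>unit_circle)
     + 2 * (\<integral>\<^sup>+\<zeta>. ennreal ((cmod (\<Sum>k. c k * \<zeta> ^ k))\<^sup>2) \<partial>unit_circle)"
    using hm by (subst nn_integral_add) (simp_all add: nn_integral_cmult)
  also have "(\<integral>\<^sup>+\<zeta>. ennreal ((cmod (\<Sum>k. c k * \<zeta> ^ k))\<^sup>2) \<partial>unit_circle) = (\<Sum>k. ennreal ((cmod (c k))\<^sup>2))"
    by (rule Parseval_series[OF sc])
  finally have 1: "inner_defect f \<theta> r \<le>
      ennreal (2 * C\<^sup>2) * (\<integral>\<^sup>+\<zeta>. ennreal (1 - (cmod (\<theta> (of_real r * \<zeta>)))\<^sup>2) \<partial>unit_circle)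
      + 2 * (\<Sum>k. ennreal ((cmod (c k))\<^sup>2))" .
  have "(\<Sum>k. ennreal ((cmod (c k))\<^sup>2)) \<le> (\<Sum>k. ennreal (if k < N then 0 else (cmod (?a k))\<^sup>2))"
  proof (rule suminf_le[OF _ summableI summableI], rule ennreal_leI)
    fix k
    have "(r ^ k)\<^sup>2 \<le> 1" using r by (intro power_le_one) auto
    then have "(cmod (?a k))\<^sup>2 * (r ^ k)\<^sup>2 \<le> (cmod (?a k))\<^sup>2" by (intro mult_left_le) auto
    then show "(cmod (c k))\<^sup>2 \<le> (if k < N then 0 else (cmod (?a k))\<^sup>2)"
      using r by (simp add: c_def norm_mult norm_power power_mult_distrib)
  qed
  then show ?thesis
    unfolding C_def[symmetric] by (intro order_trans[OF 1] add_left_mono mult_left_mono) simp_all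
qed

lemma inner_defect_tendsto_0:
  assumes f: "f \<in> H2" and inner: "inner_function \<theta>"
  shows "(\<lambda>m. inner_defect f \<theta> (approach_one m)) \<longlonglongrightarrow> 0"
proof (rule order_tendstoI)
  note hol = inner_function_holomorphic[OF inner]
  fix a :: ennreal assume a: "0 < a"
  let ?T = "\<lambda>N. \<Sum>k. ennreal (if k < N then 0 else (cmod (taylor_coeff f k))\<^sup>2)"
  have "(\<lambda>N. 2 * ?T N) \<longlonglongrightarrow> 2 * 0"
    by (intro ennreal_tendsto_cmult H2_tail_tendsto f) simp
  then have "\<forall>\<^sub>F N in sequentially. 2 * ?T N < a" using a by (intro order_tendstoD) auto
  \<comment> \<open>N is fixed first, so that the factor in front of the mean of 1 - |\<theta>|^2 no
    longer changes when r tends to 1.\<close>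
  then obtain N where N: "2 * ?T N < a" by (auto simp: eventually_sequentially)
  define D where "D = (\<lambda>m. \<integral>\<^sup>+\<zeta>. ennreal (1 - (cmod (\<theta> (of_real (approach_one m) * \<zeta>)))\<^sup>2) \<partial>unit_circle)"
  have "D \<longlonglongrightarrow> (\<integral>\<^sup>+\<zeta>. 0 \<partial>unit_circle)"
    unfolding D_def
  proof (rule nn_integral_dominated_convergence[where w = "\<lambda>_. 1"])
    show "(\<lambda>\<zeta>. ennreal (1 - (cmod (\<theta> (of_real (approach_one m) * \<zeta>)))\<^sup>2)) \<in> borel_measurable unit_circle" for m
      using borel_measurable_radius[OF hol approach_one_bounds] by measurable
    show "AE \<zeta> in unit_circle. (\<lambda>m. ennreal (1 - (cmod (\<theta> (of_real (approach_one m) * \<zeta>)))\<^sup>2)) \<longlonglongrightarrow> 0"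
      using inner_function_AE_norm[OF inner]
    proof (rule eventually_mono)
      fix \<zeta> assume "(\<lambda>m. cmod (\<theta> (of_real (approach_one m) * \<zeta>))) \<longlonglongrightarrow> 1"
      then have "(\<lambda>m. 1 - (cmod (\<theta> (of_real (approach_one m) * \<zeta>)))\<^sup>2) \<longlonglongrightarrow> 1 - 1\<^sup>2"
        by (intro tendsto_intros)
      then have "(\<lambda>m. ennreal (1 - (cmod (\<theta> (of_real (approach_one m) * \<zeta>)))\<^sup>2)) \<longlonglongrightarrow> ennreal (1 - 1\<^sup>2)"
        by (rule tendsto_ennrealI)
      then show "(\<lambda>m. ennreal (1 - (cmod (\<theta> (of_real (approach_one m) * \<zeta>)))\<^sup>2)) \<longlonglongrightarrow> 0" by simp
    qed
  qed (auto simp: ennreal_le_1)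
  then have "(\<lambda>m. ennreal (2 * (\<Sum>k<N. cmod (taylor_coeff f k))\<^sup>2) * D m + 2 * ?T N) \<longlonglongrightarrow>
      ennreal (2 * (\<Sum>k<N. cmod (taylor_coeff f k))\<^sup>2) * 0 + 2 * ?T N"
    by (intro tendsto_add ennreal_tendsto_cmult tendsto_const) simp_all
  then have "\<forall>\<^sub>F m in sequentially. ennreal (2 * (\<Sum>k<N. cmod (taylor_coeff f k))\<^sup>2) * D m + 2 * ?T N < a"
    using N by (intro order_tendstoD) auto
  then show "\<forall>\<^sub>F m in sequentially. inner_defect f \<theta> (approach_one m) < a"
  proof (rule eventually_mono)
    fix m
    assume "ennreal (2 * (\<Sum>k<N. cmod (taylor_coeff f k))\<^sup>2) * D m + 2 * ?T N < a"
    with inner_defect_le[OF f inner approach_one_bounds, of m N]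
    show "inner_defect f \<theta> (approach_one m) < a" unfolding D_def by (rule le_less_trans)
  qed
qed auto

text \<open>Multiplication by \<theta> is an isometry of H^2: the defect between f and f \<theta> on
  the circle of radius r vanishes as r tends to 1.\<close>

lemma hardy_norm_inner_mult:
  assumes f: "f \<in> H2" and inner: "inner_function \<theta>"
  shows "hardy_norm_sq (\<lambda>z. f z * \<theta> z) = hardy_norm_sq f"
proof -
  have hf: "f holomorphic_on ball 0 1" using f by (simp add: H2_def)
  let ?P = "\<lambda>g m. \<Sum>k. ennreal ((cmod (taylor_coeff g k))\<^sup>2 * approach_one m ^ (2 * k))"
  have "(\<lambda>m. ?P (\<lambda>z. f z * \<theta> z) m + inner_defect f \<theta> (approach_one m)) \<longlonglongrightarrow> hardy_norm_sq (\<lambda>z. f z * \<theta> z) + 0"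
    by (intro tendsto_add Parseval_tendsto inner_defect_tendsto_0 f inner)
  then have "?P f \<longlonglongrightarrow> hardy_norm_sq (\<lambda>z. f z * \<theta> z)"
    using Parseval_inner_defect[OF hf inner approach_one_bounds] by simp
  from LIMSEQ_unique[OF this Parseval_tendsto] show ?thesis .
qed

section \<open>Dirichlet sums\<close>

definition partial_weight :: "real \<Rightarrow> nat \<Rightarrow> real" where
  "partial_weight r k = (\<Sum>j\<in>{1..k}. r ^ (2 * j))"

text \<open>This is S_r of the overview; at r = 1 it is the normalized Dirichlet integral. Index 0
  may be included because its weight is an empty sum.\<close>

definition dirichlet_sum :: "real \<Rightarrow> (complex \<Rightarrow> complex) \<Rightarrow> ennreal" where
  "dirichlet_sum r g = (\<Sum>k. ennreal (partial_weight r k * (cmod (taylor_coeff g k))\<^sup>2))"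

lemma partial_weight_geometric: "(1 - r\<^sup>2) * partial_weight r k = r\<^sup>2 * (1 - r ^ (2 * k))"
proof (induction k)
  case (Suc k)
  have *: "partial_weight r (Suc k) = partial_weight r k + r ^ (2 * Suc k)"
    by (simp add: partial_weight_def)
  show ?case unfolding * distrib_left Suc.IH by (simp add: algebra_simps power2_eq_square)
qed (simp add: partial_weight_def)

lemma partial_weight_nonneg: "0 \<le> r \<Longrightarrow> 0 \<le> partial_weight r k"
  by (simp add: partial_weight_def sum_nonneg)

lemma partial_weight_1 [simp]: "partial_weight 1 k = real k"
  by (simp add: partial_weight_def)

text \<open>Termwise this is (1 - r^2) (r^2 + ... + r^(2k)) + r^2 r^(2k) = r^2.\<close>

lemma dirichlet_sum_Parseval:
  assumes r: "0 \<le> r" "r < 1"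
  shows "ennreal (1 - r\<^sup>2) * dirichlet_sum r g +
    ennreal (r\<^sup>2) * (\<Sum>k. ennreal ((cmod (taylor_coeff g k))\<^sup>2 * r ^ (2 * k))) = ennreal (r\<^sup>2) * hardy_norm_sq g"
proof -
  let ?b = "\<lambda>k. (cmod (taylor_coeff g k))\<^sup>2"
  have r2: "0 \<le> 1 - r\<^sup>2" using r by (simp add: power_le_one)
  have "ennreal (1 - r\<^sup>2) * dirichlet_sum r g + ennreal (r\<^sup>2) * (\<Sum>k. ennreal (?b k * r ^ (2 * k)))
    = (\<Sum>k. ennreal (1 - r\<^sup>2) * ennreal (partial_weight r k * ?b k) + ennreal (r\<^sup>2) * ennreal (?b k * r ^ (2 * k)))"
    unfolding dirichlet_sum_def ennreal_suminf_cmult[symmetric] by (rule suminf_add) auto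
  also have "\<dots> = (\<Sum>k. ennreal (r\<^sup>2) * ennreal (?b k))"
  proof (rule suminf_cong)
    fix k
    have "ennreal (1 - r\<^sup>2) * ennreal (partial_weight r k * ?b k) + ennreal (r\<^sup>2) * ennreal (?b k * r ^ (2 * k))
       = ennreal ((1 - r\<^sup>2) * (partial_weight r k * ?b k) + r\<^sup>2 * (?b k * r ^ (2 * k)))"
      using r r2 partial_weight_nonneg[of r k] by (simp add: ennreal_mult ennreal_plus)
    also have "(1 - r\<^sup>2) * (partial_weight r k * ?b k) = r\<^sup>2 * (1 - r ^ (2 * k)) * ?b k"
      by (simp only: partial_weight_geometric[symmetric] mult.assoc)
    also have "\<dots> + r\<^sup>2 * (?b k * r ^ (2 * k)) = r\<^sup>2 * ?b k" by (simp add: algebra_simps)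
    finally show "ennreal (1 - r\<^sup>2) * ennreal (partial_weight r k * ?b k) + ennreal (r\<^sup>2) * ennreal (?b k * r ^ (2 * k))
        = ennreal (r\<^sup>2) * ennreal (?b k)" by (simp add: ennreal_mult)
  qed
  also have "\<dots> = ennreal (r\<^sup>2) * hardy_norm_sq g"
    unfolding hardy_norm_sq_def by (rule ennreal_suminf_cmult)
  finally show ?thesis .
qed

text \<open>The integrand of the final formula for r < 1.\<close>

definition inner_excess :: "(complex \<Rightarrow> complex) \<Rightarrow> (complex \<Rightarrow> complex) \<Rightarrow> complex \<Rightarrow> real \<Rightarrow> ennreal" where
  "inner_excess f \<theta> \<zeta> r = ennreal (r\<^sup>2 * (cmod (f (of_real r * \<zeta>)))\<^sup>2 * (1 - (cmod (\<theta> (of_real r * \<zeta>)))\<^sup>2) / (1 - r\<^sup>2))"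

text \<open>The formula for a unit mass at r < 1. The Parseval form of the Dirichlet sum for f and
  for f \<theta> has the same right side by the isometry, so the two left sides differ by the defect
  only.\<close>

lemma dirichlet_sum_inner_mult:
  assumes f: "f \<in> H2" and inner: "inner_function \<theta>" and r: "0 \<le> r" "r < 1"
  shows "dirichlet_sum r (\<lambda>z. f z * \<theta> z) = dirichlet_sum r f + (\<integral>\<^sup>+\<zeta>. inner_excess f \<theta> \<zeta> r \<partial>unit_circle)"
proof -
  note hol = inner_function_holomorphic[OF inner]
  have hf: "f holomorphic_on ball 0 1" using f by (simp add: H2_def)
  note [measurable] = borel_measurable_radius[OF hf r] borel_measurable_radius[OF hol r]
  let ?P = "\<lambda>g. \<Sum>k. ennreal ((cmod (taylor_coeff g k))\<^sup>2 * r ^ (2 * k))"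
  let ?g = "\<lambda>z. f z * \<theta> z"
  let ?a = "ennreal (1 - r\<^sup>2)" and ?b = "ennreal (r\<^sup>2)"
  have r2: "0 < 1 - r\<^sup>2" using r by (simp add: power_less_one_iff)
  \<comment> \<open>The common summand \<open>?b * ?P ?g\<close> can be cancelled in the extended
    reals only after it is known to be finite.\<close>
  have "?P ?g \<le> hardy_norm_sq ?g" unfolding hardy_norm_sq_def
    by (intro suminf_le ennreal_leI mult_left_le) (use r in \<open>auto simp: power_le_one\<close>)
  also have "\<dots> < \<infinity>" using hardy_norm_inner_mult[OF f inner] H2_hardy_norm_finite[OF f] by simp
  finally have fin: "?b * ?P ?g \<noteq> \<infinity>" by (simp add: ennreal_mult_eq_top_iff less_top)
  have "?a * dirichlet_sum r ?g + ?b * ?P ?g = ?a * dirichlet_sum r f + ?b * ?P f"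
    unfolding dirichlet_sum_Parseval[OF r] hardy_norm_inner_mult[OF f inner] ..
  also have "\<dots> = (?a * dirichlet_sum r f + ?b * inner_defect f \<theta> r) + ?b * ?P ?g"
    unfolding Parseval_inner_defect[OF hf inner r] by (simp add: distrib_left add_ac)
  finally have eq: "?a * dirichlet_sum r ?g = ?a * dirichlet_sum r f + ?b * inner_defect f \<theta> r"
    using fin by (simp add: add.commute[of _ "?b * ?P ?g"] ennreal_add_left_cancel)
  have inv: "ennreal (1 / (1 - r\<^sup>2)) * ?a = 1"
    using r2 by (simp add: ennreal_mult[symmetric] del: ennreal_mult)
  have "dirichlet_sum r ?g = ennreal (1 / (1 - r\<^sup>2)) * (?a * dirichlet_sum r ?g)"
    by (simp add: mult.assoc[symmetric] inv)
  also have "\<dots> = ennreal (1 / (1 - r\<^sup>2)) * ?a * dirichlet_sum r f + ennreal (1 / (1 - r\<^sup>2)) * ?b * inner_defect f \<theta> r"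
    unfolding eq by (simp add: distrib_left mult.assoc)
  also have "ennreal (1 / (1 - r\<^sup>2)) * ?b = ennreal (r\<^sup>2 / (1 - r\<^sup>2))"
    using r2 by (subst ennreal_mult[symmetric]) auto
  also have "ennreal (r\<^sup>2 / (1 - r\<^sup>2)) * inner_defect f \<theta> r = (\<integral>\<^sup>+\<zeta>. inner_excess f \<theta> \<zeta> r \<partial>unit_circle)"
  proof -
    have m: "(\<lambda>\<zeta>. ennreal ((cmod (f (of_real r * \<zeta>)))\<^sup>2 * (1 - (cmod (\<theta> (of_real r * \<zeta>)))\<^sup>2))) \<in> borel_measurable unit_circle"
      by measurable
    have "ennreal (r\<^sup>2 / (1 - r\<^sup>2)) * ennreal ((cmod (f (of_real r * \<zeta>)))\<^sup>2 * (1 - (cmod (\<theta> (of_real r * \<zeta>)))\<^sup>2)) = inner_excess f \<theta> \<zeta> r" for \<zeta>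
      unfolding inner_excess_def using r2 by (subst ennreal_mult'[symmetric]) (auto simp: mult.assoc)
    then show ?thesis unfolding inner_defect_def nn_integral_cmult[OF m, symmetric] by simp
  qed
  finally show ?thesis by (simp add: inv)
qed

lemma dirichlet_sum_tendsto: "(\<lambda>m. dirichlet_sum (approach_one m) g) \<longlonglongrightarrow> dirichlet_sum 1 g"
  unfolding dirichlet_sum_def
proof (rule suminf_ennreal_mono_tendsto)
  fix k
  show "incseq (\<lambda>m. ennreal (partial_weight (approach_one m) k * (cmod (taylor_coeff g k))\<^sup>2))"
    unfolding partial_weight_def incseq_def
    by (intro allI impI ennreal_leI mult_right_mono sum_mono power_mono approach_one_mono approach_one_bounds) auto
  show "(\<lambda>m. ennreal (partial_weight (approach_one m) k * (cmod (taylor_coeff g k))\<^sup>2))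
      \<longlonglongrightarrow> ennreal (partial_weight 1 k * (cmod (taylor_coeff g k))\<^sup>2)"
    unfolding partial_weight_def by (intro tendsto_ennrealI tendsto_intros approach_one_tendsto)
qed

section \<open>The square integral of the derivative along radii\<close>

lemma taylor_coeff_deriv: "taylor_coeff (deriv f) k = of_nat (Suc k) * taylor_coeff f (Suc k)"
proof -
  have "(deriv ^^ k) (deriv f) = (deriv ^^ Suc k) f" by (simp add: funpow_swap1)
  then show ?thesis
    unfolding taylor_coeff_def fact_Suc of_nat_mult by (simp del: of_nat_Suc funpow.simps)
qed

text \<open>Half-open, so that s \<zeta> stays in the open disc, where f' is holomorphic and hence
  measurable.\<close>

abbreviation unit_interval :: "real measure" where
  "unit_interval \<equiv> restrict_space lborel {0..<1}"

lemma nn_integral_power_unit_interval: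
  "(\<integral>\<^sup>+s. ennreal (s ^ n) \<partial>unit_interval) = ennreal (1 / real (Suc n))"
proof -
  have "(\<integral>\<^sup>+s. ennreal (s ^ n) \<partial>unit_interval) = (\<integral>\<^sup>+s. ennreal (s ^ n) * indicator {0..<1} s \<partial>lborel)"
    by (rule nn_integral_restrict_space) simp
  also have "\<dots> = (\<integral>\<^sup>+s. ennreal (s ^ n) * indicator {0..1} s \<partial>lborel)"
    by (rule nn_integral_cong_AE, rule AE_mp[OF AE_lborel_singleton[of 1]]) (auto split: split_indicator)
  also have "\<dots> = ennreal (1 ^ Suc n / real (Suc n) - 0 ^ Suc n / real (Suc n))"
  proof (rule nn_integral_FTC_Icc)
    show "DERIV (\<lambda>s. s ^ Suc n / real (Suc n)) s :> s ^ n" for s :: real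
      by (intro derivative_eq_intros) (auto simp del: of_nat_Suc)
  qed auto
  finally show ?thesis by (simp del: of_nat_Suc)
qed

lemma borel_measurable_deriv_pair:
  assumes f: "f holomorphic_on ball 0 1"
  shows "(\<lambda>(\<zeta>, s). deriv f (of_real s * \<zeta>)) \<in> borel_measurable (unit_circle \<Otimes>\<^sub>M unit_interval)"
proof -
  have hd: "deriv f holomorphic_on ball 0 1" by (intro holomorphic_deriv f) auto
  have "(\<lambda>p. of_real (snd p) * fst p :: complex) \<in> borel_measurable (unit_circle \<Otimes>\<^sub>M unit_interval)"
    by (intro borel_measurable_times borel_measurable_of_real)
     (auto intro: measurable_compose[OF measurable_fst] measurable_compose[OF measurable_snd] borel_measurable_unit_circle_id simp: measurable_restrict_space1)
  then have "(\<lambda>p. deriv f (of_real (snd p) * fst p)) \<in> borel_measurable (unit_circle \<Otimes>\<^sub>M unit_interval)"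
    by (rule borel_measurable_holomorphic_ball[OF hd]) (auto simp: space_pair_measure space_restrict_space norm_mult)
  then show ?thesis by (simp add: case_prod_beta')
qed

interpretation unit_interval: sigma_finite_measure unit_interval
  by (rule sigma_finite_measure_restrict_space) (auto intro: sigma_finite_lborel)

lemma borel_measurable_nn_integral_deriv:
  assumes f: "f holomorphic_on ball 0 1"
  shows "(\<lambda>\<zeta>. \<integral>\<^sup>+s. ennreal ((cmod (deriv f (of_real s * \<zeta>)))\<^sup>2) \<partial>unit_interval) \<in> borel_measurable unit_circle"
  using borel_measurable_deriv_pair[OF f]
  by (intro unit_interval.borel_measurable_nn_integral) (simp add: case_prod_beta')

text \<open>Parseval for f' on each circle and the integral of s^(2k) over [0,1) give (k + 1)^2 /
  (2k + 1) <= k + 1 as weight of the coefficient of index k + 1. The measure ds dm lacks the factor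
  2 s of area measure, hence an inequality; it is used only to infer finiteness along almost every
  radius.\<close>

lemma nn_integral_deriv_le:
  assumes f: "f holomorphic_on ball 0 1"
  shows "(\<integral>\<^sup>+\<zeta>. (\<integral>\<^sup>+s. ennreal ((cmod (deriv f (of_real s * \<zeta>)))\<^sup>2) \<partial>unit_interval) \<partial>unit_circle) \<le> dirichlet_sum 1 f"
proof -
  have hd: "deriv f holomorphic_on ball 0 1" by (intro holomorphic_deriv f) auto
  interpret P: pair_sigma_finite unit_circle unit_interval ..
  have "(\<integral>\<^sup>+\<zeta>. (\<integral>\<^sup>+s. ennreal ((cmod (deriv f (of_real s * \<zeta>)))\<^sup>2) \<partial>unit_interval) \<partial>unit_circle)
     = (\<integral>\<^sup>+s. (\<integral>\<^sup>+\<zeta>. ennreal ((cmod (deriv f (of_real s * \<zeta>)))\<^sup>2) \<partial>unit_circle) \<partial>unit_interval)"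
    using borel_measurable_deriv_pair[OF f] by (intro P.Fubini'[symmetric]) (simp add: case_prod_beta')
  also have "\<dots> = (\<integral>\<^sup>+s. (\<Sum>k. ennreal ((cmod (taylor_coeff (deriv f) k))\<^sup>2 * s ^ (2 * k))) \<partial>unit_interval)"
    by (intro nn_integral_cong Parseval hd) (auto simp: space_restrict_space)
  also have "\<dots> = (\<Sum>k. \<integral>\<^sup>+s. ennreal ((cmod (taylor_coeff (deriv f) k))\<^sup>2 * s ^ (2 * k)) \<partial>unit_interval)"
    by (rule nn_integral_suminf) (auto intro!: measurable_restrict_space1)
  also have "\<dots> = (\<Sum>k. ennreal ((cmod (taylor_coeff (deriv f) k))\<^sup>2) * ennreal (1 / real (Suc (2 * k))))"
  proof (rule suminf_cong)
    fix k
    show "(\<integral>\<^sup>+s. ennreal ((cmod (taylor_coeff (deriv f) k))\<^sup>2 * s ^ (2 * k)) \<partial>unit_interval) =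
      ennreal ((cmod (taylor_coeff (deriv f) k))\<^sup>2) * ennreal (1 / real (Suc (2 * k)))"
      unfolding nn_integral_power_unit_interval[symmetric]
      by (subst nn_integral_cmult[symmetric]) (auto intro!: measurable_restrict_space1 simp: ennreal_mult')
  qed
  also have "\<dots> \<le> (\<Sum>k. ennreal (real (Suc k) * (cmod (taylor_coeff f (Suc k)))\<^sup>2))"
  proof (rule suminf_le[OF _ summableI summableI])
    fix k
    have "(real (Suc k))\<^sup>2 * (1 / real (Suc (2 * k))) \<le> real (Suc k)"
      by (simp add: divide_simps power2_eq_square)
    then have "(real (Suc k))\<^sup>2 * (1 / real (Suc (2 * k))) * (cmod (taylor_coeff f (Suc k)))\<^sup>2 \<le> real (Suc k) * (cmod (taylor_coeff f (Suc k)))\<^sup>2"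
      by (intro mult_right_mono) auto
    then show "ennreal ((cmod (taylor_coeff (deriv f) k))\<^sup>2) * ennreal (1 / real (Suc (2 * k))) \<le>
        ennreal (real (Suc k) * (cmod (taylor_coeff f (Suc k)))\<^sup>2)"
      unfolding taylor_coeff_deriv norm_mult norm_of_nat power_mult_distrib
      by (subst ennreal_mult[symmetric]) (auto intro!: ennreal_leI simp: mult_ac simp del: of_nat_Suc)
  qed
  also have "\<dots> = dirichlet_sum 1 f"
    unfolding dirichlet_sum_def partial_weight_1
    using suminf_offset[OF summableI, of "\<lambda>k. ennreal (real k * (cmod (taylor_coeff f k))\<^sup>2)" 1] by simp
  finally show ?thesis .
qed

section \<open>Radial limits of functions with finite Dirichlet sum\<close>

text \<open>Cauchy-Schwarz for \<open>f'\<close> on a radius, in the form \<open>2 * x * l \<le> x\<^sup>2 + l\<^sup>2\<close> with a free parameter \<open>l\<close>.\<close>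

lemma radial_increment_bound:
  assumes f: "f holomorphic_on ball 0 1" and \<zeta>: "cmod \<zeta> = 1"
    and M: "(\<integral>\<^sup>+s. ennreal ((cmod (deriv f (of_real s * \<zeta>)))\<^sup>2) \<partial>unit_interval) \<le> ennreal M" and M0: "0 \<le> M"
    and rt: "0 \<le> r" "r \<le> t" "t < 1" and l: "0 < l"
  shows "cmod (f (of_real t * \<zeta>) - f (of_real r * \<zeta>)) \<le> l * (t - r) / 2 + M / (2 * l)"
proof -
  have hd: "deriv f holomorphic_on ball 0 1" by (intro holomorphic_deriv f) auto
  let ?d = "\<lambda>s::real. \<zeta> * deriv f (of_real s * \<zeta>)"
  have in_ball: "of_real s * \<zeta> \<in> ball 0 1" if "s \<in> {r..t}" for s
    using that rt \<zeta> by (simp add: norm_mult)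
  have "continuous_on {r..t} (\<lambda>s. deriv f (of_real s * \<zeta>))"
    by (rule continuous_on_compose2[OF holomorphic_on_imp_continuous_on[OF hd]])
       (use in_ball in \<open>auto intro!: continuous_intros\<close>)
  then have cont: "continuous_on {r..t} ?d" "continuous_on {r..t} (\<lambda>s. (cmod (deriv f (of_real s * \<zeta>)))\<^sup>2)"
    by (auto intro!: continuous_intros)
  have ftc: "(?d has_integral (f (of_real t * \<zeta>) - f (of_real r * \<zeta>))) {r..t}"
  proof (rule fundamental_theorem_of_calculus[OF rt(2)])
    fix s assume s: "s \<in> {r..t}"
    then have "f field_differentiable at (of_real s * \<zeta>)"
      using f in_ball by (auto intro: holomorphic_on_imp_differentiable_at)
    then have "(f has_field_derivative deriv f (of_real s * \<zeta>)) (at (of_real s * \<zeta>))"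
      using DERIV_deriv_iff_field_differentiable by blast
    then have "((\<lambda>z. f (z * \<zeta>)) has_field_derivative deriv f (of_real s * \<zeta>) * \<zeta>) (at (of_real s))"
      by (rule DERIV_chain2) (auto intro!: derivative_eq_intros)
    then have "((\<lambda>z. f (z * \<zeta>)) has_field_derivative ?d s) (at (of_real s))"
      by (simp only: mult.commute)
    then show "((\<lambda>s. f (of_real s * \<zeta>)) has_vector_derivative ?d s) (at s within {r..t})"
      by (rule has_vector_derivative_real_field)
  qed
  define q where "q = (\<lambda>s. (cmod (deriv f (of_real s * \<zeta>)))\<^sup>2)"
  have qi: "q integrable_on {r..t}" unfolding q_def using cont(2) by (rule integrable_continuous_real)
  have "(\<integral>\<^sup>+s. indicator {r..t} s * q s \<partial>lborel) = integral {r..t} q"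
    by (rule nn_integral_has_integral_lebesgue[OF _ integrable_integral[OF qi]]) (simp add: q_def)
  moreover have "(\<integral>\<^sup>+s. indicator {r..t} s * q s \<partial>lborel) \<le> (\<integral>\<^sup>+s. ennreal (q s) * indicator {0..<1} s \<partial>lborel)"
    using rt by (intro nn_integral_mono) (auto split: split_indicator)
  moreover have "(\<integral>\<^sup>+s. ennreal (q s) * indicator {0..<1} s \<partial>lborel) = (\<integral>\<^sup>+s. ennreal (q s) \<partial>unit_interval)"
    by (rule nn_integral_restrict_space[symmetric]) simp
  ultimately have "ennreal (integral {r..t} q) \<le> ennreal M" using M by (simp add: q_def)
  then have qM: "integral {r..t} q \<le> M" using M0 by simp
  have "cmod (integral {r..t} ?d) \<le> integral {r..t} (\<lambda>s. l / 2 + q s / (2 * l))"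
  proof (rule integral_norm_bound_integral)
    show "?d integrable_on {r..t}" using ftc by blast
    show "(\<lambda>s. l / 2 + q s / (2 * l)) integrable_on {r..t}"
      unfolding q_def by (intro integrable_continuous_real continuous_intros cont) (use l in auto)
    fix s
    let ?x = "cmod (deriv f (of_real s * \<zeta>))"
    have "0 \<le> (?x - l)\<^sup>2" by simp
    then have "2 * l * ?x \<le> l\<^sup>2 + ?x\<^sup>2" by (simp add: power2_diff algebra_simps)
    then have "?x \<le> (l\<^sup>2 + ?x\<^sup>2) / (2 * l)" using l by (simp add: pos_le_divide_eq mult.commute)
    also have "\<dots> = l / 2 + q s / (2 * l)" using l by (simp add: q_def field_simps power2_eq_square)
    finally show "cmod (?d s) \<le> l / 2 + q s / (2 * l)" using \<zeta> by (simp add: norm_mult)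
  qed
  also have "integral {r..t} (\<lambda>s. l / 2 + q s / (2 * l)) = l * (t - r) / 2 + integral {r..t} q / (2 * l)"
    using rt qi by (subst integral_add) (auto intro: integrable_on_divide)
  also have "\<dots> \<le> l * (t - r) / 2 + M / (2 * l)"
    using qM l by (intro add_left_mono divide_right_mono) auto
  finally show ?thesis using integral_unique[OF ftc] by simp
qed

text \<open>A square-integrable derivative makes increments along the radius at most a constant
  times sqrt (1 - r), so the Cauchy criterion applies. The factor (1 + M) / 2 collects the two
  balanced terms of the increment bound.\<close>

lemma radial_limit_exists:
  assumes f: "f holomorphic_on ball 0 1" and \<zeta>: "cmod \<zeta> = 1"
    and fin: "(\<integral>\<^sup>+s. ennreal ((cmod (deriv f (of_real s * \<zeta>)))\<^sup>2) \<partial>unit_interval) < \<infinity>"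
  shows "\<exists>L. ((\<lambda>r::real. f (of_real r * \<zeta>)) \<longlongrightarrow> L) (at_left 1)"
proof -
  obtain M where M0: "0 \<le> M" and
    M: "(\<integral>\<^sup>+s. ennreal ((cmod (deriv f (of_real s * \<zeta>)))\<^sup>2) \<partial>unit_interval) = ennreal M"
    using fin by (cases "\<integral>\<^sup>+s. ennreal ((cmod (deriv f (of_real s * \<zeta>)))\<^sup>2) \<partial>unit_interval") auto
  define e where "e = (\<lambda>r. sqrt (1 - r) * ((1 + M) / 2))"
  have bound: "cmod (f (of_real t * \<zeta>) - f (of_real r * \<zeta>)) \<le> e r" if rt: "0 \<le> r" "r \<le> t" "t < 1" for r t
  proof -
    define u where "u = sqrt (1 - r)" \<comment> \<open>\<open>l = 1 / u\<close> balances the two terms\<close>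
    have u: "0 < u" "u * u = 1 - r" using rt by (auto simp: u_def)
    have "cmod (f (of_real t * \<zeta>) - f (of_real r * \<zeta>)) \<le> (1 / u) * (t - r) / 2 + M / (2 * (1 / u))"
      by (rule radial_increment_bound[OF f \<zeta> _ M0 rt]) (use M u in auto)
    also have "\<dots> \<le> (1 / u) * (u * u) / 2 + M / (2 * (1 / u))"
      using u rt by (intro add_right_mono divide_right_mono mult_left_mono) auto
    also have "\<dots> = e r" using u by (simp add: e_def u_def[symmetric] field_simps)
    finally show ?thesis .
  qed
  have e0: "(e \<longlongrightarrow> 0) (at_left 1)"
  proof -
    have "(e \<longlongrightarrow> sqrt (1 - 1) * ((1 + M) / 2)) (at_left 1)" unfolding e_def by (intro tendsto_intros)
    then show ?thesis by simp
  qed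
  let ?X = "\<lambda>m. f (of_real (approach_one m) * \<zeta>)"
  \<comment> \<open>Completeness gives a limit along the sequence; the same increment bound then
    carries it over to all r.\<close>
  have "Cauchy ?X"
  proof (rule metric_CauchyI)
    fix d :: real assume "0 < d"
    with filterlim_compose[OF e0 filterlim_approach_one] have "\<forall>\<^sub>F m in sequentially. e (approach_one m) < d / 2"
      by (intro order_tendstoD) auto
    then obtain N where N: "e (approach_one N) < d / 2" by (auto simp: eventually_sequentially)
    have "dist (?X m) (?X N) < d / 2" if "N \<le> m" for m
      using bound[OF approach_one_bounds(1) approach_one_mono[OF that] approach_one_bounds(2)] N
      by (simp add: dist_norm)
    then show "\<exists>N. \<forall>m\<ge>N. \<forall>n\<ge>N. dist (?X m) (?X n) < d"
      by (meson dist_triangle_half_l dist_commute dist_triangle_half_r)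
  qed
  then obtain L where L: "?X \<longlonglongrightarrow> L" using Cauchy_convergent_iff convergent_def by blast
  have "cmod (f (of_real r * \<zeta>) - L) \<le> e r" if r: "0 < r" "r < 1" for r
  proof -
    have "\<forall>\<^sub>F m in sequentially. r < approach_one m"
      using approach_one_tendsto r by (intro order_tendstoD)
    then have "\<forall>\<^sub>F m in sequentially. cmod (f (of_real r * \<zeta>) - ?X m) \<le> e r"
      by eventually_elim (use bound r approach_one_bounds in \<open>simp add: norm_minus_commute\<close>)
    moreover have "(\<lambda>m. cmod (f (of_real r * \<zeta>) - ?X m)) \<longlonglongrightarrow> cmod (f (of_real r * \<zeta>) - L)"
      by (intro tendsto_intros L)
    ultimately show ?thesis by (intro tendsto_upperbound) auto
  qed
  then have "\<forall>\<^sub>F r in at_left 1. norm (f (of_real r * \<zeta>) - L) \<le> e r"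
    using eventually_at_left_real[OF zero_less_one] by (auto elim: eventually_mono)
  then have "((\<lambda>r. f (of_real r * \<zeta>) - L) \<longlongrightarrow> 0) (at_left 1)"
    using e0 by (rule Lim_null_comparison)
  then have "((\<lambda>r. f (of_real r * \<zeta>)) \<longlongrightarrow> L) (at_left 1)" by (rule LIM_zero_cancel)
  then show ?thesis by blast
qed

lemma radial_limit_tendsto:
  assumes "\<exists>L. ((\<lambda>r::real. f (of_real r * \<zeta>)) \<longlongrightarrow> L) (at_left 1)"
  shows "((\<lambda>r::real. f (of_real r * \<zeta>)) \<longlongrightarrow> radial_limit f \<zeta>) (at_left 1)"
proof -
  from assms obtain L where L: "((\<lambda>r::real. f (of_real r * \<zeta>)) \<longlongrightarrow> L) (at_left 1)" by blast
  then have "radial_limit f \<zeta> = L"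
    unfolding radial_limit_def using tendsto_Lim[OF _ L] by auto
  with L show ?thesis by simp
qed

lemma AE_radial_limit:
  assumes f: "f holomorphic_on ball 0 1" and D: "dirichlet_sum 1 f < \<infinity>"
  shows "AE \<zeta> in unit_circle. ((\<lambda>r::real. f (of_real r * \<zeta>)) \<longlongrightarrow> radial_limit f \<zeta>) (at_left 1)"
proof -
  let ?h = "\<lambda>\<zeta>. \<integral>\<^sup>+s. ennreal ((cmod (deriv f (of_real s * \<zeta>)))\<^sup>2) \<partial>unit_interval"
  have "(\<integral>\<^sup>+\<zeta>. ?h \<zeta> \<partial>unit_circle) \<noteq> \<infinity>"
    using order_le_less_trans[OF nn_integral_deriv_le[OF f] D] by simp
  then have "AE \<zeta> in unit_circle. ?h \<zeta> \<noteq> \<infinity>"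
    by (rule nn_integral_PInf_AE[OF borel_measurable_nn_integral_deriv[OF f]])
  then show ?thesis
    by (rule AE_mp) (auto intro!: AE_I2 radial_limit_tendsto radial_limit_exists f simp: less_top)
qed

lemma summable_dirichlet:
  assumes "dirichlet_sum 1 f < \<infinity>"
  shows "summable (\<lambda>k. real k * (cmod (taylor_coeff f k))\<^sup>2)"
  using assms unfolding dirichlet_sum_def partial_weight_1
  by (intro summable_suminf_not_top) auto

lemma Parseval_difference:
  assumes f: "f holomorphic_on ball 0 1" and r: "0 \<le> r" "r < 1" and s: "0 \<le> s" "s < 1"
  shows "(\<integral>\<^sup>+\<zeta>. ennreal ((cmod (f (of_real r * \<zeta>) - f (of_real s * \<zeta>)))\<^sup>2) \<partial>unit_circle)
    = (\<Sum>k. ennreal ((cmod (taylor_coeff f k))\<^sup>2 * (r ^ k - s ^ k)\<^sup>2))"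
proof -
  let ?c = "\<lambda>k. taylor_coeff f k * of_real (r ^ k - s ^ k)"
  have "(\<integral>\<^sup>+\<zeta>. ennreal ((cmod (f (of_real r * \<zeta>) - f (of_real s * \<zeta>)))\<^sup>2) \<partial>unit_circle)
    = (\<integral>\<^sup>+\<zeta>. ennreal ((cmod (\<Sum>k. ?c k * \<zeta> ^ k))\<^sup>2) \<partial>unit_circle)"
  proof (rule nn_integral_cong)
    fix \<zeta> assume "\<zeta> \<in> space unit_circle"
    then have "(\<lambda>k. taylor_coeff f k * (of_real r * \<zeta>) ^ k - taylor_coeff f k * (of_real s * \<zeta>) ^ k)
        sums (f (of_real r * \<zeta>) - f (of_real s * \<zeta>))"
      using r s by (intro sums_diff taylor_sums f) (simp_all add: norm_mult)
    moreover have "taylor_coeff f k * (of_real r * \<zeta>) ^ k - taylor_coeff f k * (of_real s * \<zeta>) ^ k = ?c k * \<zeta> ^ k" for k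
      by (simp add: power_mult_distrib algebra_simps)
    ultimately show "ennreal ((cmod (f (of_real r * \<zeta>) - f (of_real s * \<zeta>)))\<^sup>2) = ennreal ((cmod (\<Sum>k. ?c k * \<zeta> ^ k))\<^sup>2)"
      using sums_unique by fastforce
  qed
  also have "\<dots> = (\<Sum>k. ennreal ((cmod (?c k))\<^sup>2))"
  proof (rule Parseval_series, rule summable_comparison_test')
    show "summable (\<lambda>k. cmod (taylor_coeff f k) * r ^ k + cmod (taylor_coeff f k) * s ^ k)"
      by (intro summable_add taylor_summable_norm f r s)
    fix k
    have "\<bar>r ^ k - s ^ k\<bar> \<le> r ^ k + s ^ k"
      using r s by (simp add: abs_le_iff)
    then show "norm (cmod (?c k)) \<le> cmod (taylor_coeff f k) * r ^ k + cmod (taylor_coeff f k) * s ^ k"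
      unfolding norm_mult norm_of_real real_norm_def abs_mult distrib_left[symmetric] abs_abs abs_norm_cancel
      by (intro mult_left_mono) auto
  qed
  also have "\<dots> = (\<Sum>k. ennreal ((cmod (taylor_coeff f k))\<^sup>2 * (r ^ k - s ^ k)\<^sup>2))"
    unfolding norm_mult norm_of_real power_mult_distrib power2_abs ..
  finally show ?thesis .
qed

text \<open>The factor 1 - r^k suppresses low frequencies, so this behaves like a tail of the
  Dirichlet sum. It is the majorant of the L^2 error between f (r \<zeta>) and f \<zeta>, divided by
  1 - r.\<close>

definition dirichlet_tail :: "(complex \<Rightarrow> complex) \<Rightarrow> real \<Rightarrow> ennreal" where
  "dirichlet_tail f r = (\<Sum>k. ennreal (real k * (cmod (taylor_coeff f k))\<^sup>2 * (1 - r ^ k)))"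

lemma dirichlet_tail_tendsto:
  assumes D: "dirichlet_sum 1 f < \<infinity>"
  shows "(\<lambda>m. dirichlet_tail f (approach_one m)) \<longlonglongrightarrow> 0"
proof -
  let ?b = "\<lambda>k. real k * (cmod (taylor_coeff f k))\<^sup>2"
  have s: "summable ?b" by (rule summable_dirichlet[OF D])
  have r1: "0 \<le> approach_one m ^ k" "approach_one m ^ k \<le> 1" for m k
    using approach_one_bounds[of m] by (auto intro: power_le_one)
  have le: "norm (?b k * (1 - approach_one m ^ k)) \<le> ?b k" for m k
    using r1[of m k] by (simp add: abs_mult mult_left_le)
  have "((\<lambda>m. \<Sum>k. ?b k * (1 - approach_one m ^ k)) \<longlongrightarrow> (\<Sum>k. 0)) sequentially"
  proof (rule conjunct2[OF conjunct2[OF tannerys_theorem]])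
    show "((\<lambda>m. ?b k * (1 - approach_one m ^ k)) \<longlongrightarrow> 0) sequentially" for k
    proof -
      have "(\<lambda>m. ?b k * (1 - approach_one m ^ k)) \<longlonglongrightarrow> ?b k * (1 - 1 ^ k)"
        by (intro tendsto_intros approach_one_tendsto)
      then show ?thesis by simp
    qed
    show "\<forall>\<^sub>F (k, m) in at_top \<times>\<^sub>F sequentially. norm (?b k * (1 - approach_one m ^ k)) \<le> ?b k"
      using le by (intro always_eventually) auto
  qed (use s in auto)
  then have "(\<lambda>m. ennreal (\<Sum>k. ?b k * (1 - approach_one m ^ k))) \<longlonglongrightarrow> ennreal 0"
    by (intro tendsto_ennrealI) simp
  moreover have "dirichlet_tail f (approach_one m) = ennreal (\<Sum>k. ?b k * (1 - approach_one m ^ k))" for m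
    unfolding dirichlet_tail_def
  proof (rule suminf_ennreal2)
    show "0 \<le> ?b k * (1 - approach_one m ^ k)" for k using r1[of m k] by simp
    show "summable (\<lambda>k. ?b k * (1 - approach_one m ^ k))"
      by (rule summable_comparison_test'[OF s le])
  qed
  ultimately show ?thesis by simp
qed

text \<open>Parseval for the difference of the dilates to radii r and s, and Fatou's lemma for s ->
  1, bound the error by the sum of |f_k|^2 (1 - r^k)^2. The prefactor 1 / (1 - r) is the crude bound
  for Q_r; it consumes one of the two factors 1 - r^k.\<close>

lemma radial_L2_error:
  assumes f: "f holomorphic_on ball 0 1" and r: "0 \<le> r" "r < 1"
    and fs: "AE \<zeta> in unit_circle. (\<lambda>m. f (of_real (approach_one m) * \<zeta>)) \<longlonglongrightarrow> fs \<zeta>"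
  shows "ennreal (1 / (1 - r)) * (\<integral>\<^sup>+\<zeta>. ennreal ((cmod (f (of_real r * \<zeta>) - fs \<zeta>))\<^sup>2) \<partial>unit_circle) \<le> dirichlet_tail f r"
proof -
  let ?u = "\<lambda>m \<zeta>. ennreal ((cmod (f (of_real r * \<zeta>) - f (of_real (approach_one m) * \<zeta>)))\<^sup>2)"
  have um: "?u m \<in> borel_measurable unit_circle" for m
    using borel_measurable_radius[OF f r] borel_measurable_radius[OF f approach_one_bounds[of m]] by measurable
  have "(\<integral>\<^sup>+\<zeta>. ennreal ((cmod (f (of_real r * \<zeta>) - fs \<zeta>))\<^sup>2) \<partial>unit_circle) = (\<integral>\<^sup>+\<zeta>. liminf (\<lambda>m. ?u m \<zeta>) \<partial>unit_circle)"
  proof (rule nn_integral_cong_AE, use fs in \<open>rule AE_mp\<close>, intro AE_I2 impI)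
    fix \<zeta> assume "(\<lambda>m. f (of_real (approach_one m) * \<zeta>)) \<longlonglongrightarrow> fs \<zeta>"
    then have "(\<lambda>m. ?u m \<zeta>) \<longlonglongrightarrow> ennreal ((cmod (f (of_real r * \<zeta>) - fs \<zeta>))\<^sup>2)"
      by (intro tendsto_ennrealI tendsto_intros)
    then show "ennreal ((cmod (f (of_real r * \<zeta>) - fs \<zeta>))\<^sup>2) = liminf (\<lambda>m. ?u m \<zeta>)"
      by (rule lim_imp_Liminf[OF sequentially_bot, symmetric])
  qed
  also have "\<dots> \<le> liminf (\<lambda>m. integral\<^sup>N unit_circle (?u m))"
    by (rule nn_integral_liminf[OF um])
  also have "\<dots> \<le> liminf (\<lambda>m. \<Sum>k. ennreal ((cmod (taylor_coeff f k))\<^sup>2 * (1 - r ^ k)\<^sup>2))"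
  proof (rule Liminf_mono)
    have "\<forall>\<^sub>F m in sequentially. r < approach_one m"
      using approach_one_tendsto r by (intro order_tendstoD)
    then show "\<forall>\<^sub>F m in sequentially. integral\<^sup>N unit_circle (?u m) \<le> (\<Sum>k. ennreal ((cmod (taylor_coeff f k))\<^sup>2 * (1 - r ^ k)\<^sup>2))"
    proof eventually_elim
      case (elim m)
      have "(r ^ k - approach_one m ^ k)\<^sup>2 \<le> (1 - r ^ k)\<^sup>2" for k
      proof -
        have "r ^ k \<le> approach_one m ^ k" "approach_one m ^ k \<le> 1"
          using elim r approach_one_bounds[of m] by (auto intro: power_mono power_le_one)
        then have "(approach_one m ^ k - r ^ k)\<^sup>2 \<le> (1 - r ^ k)\<^sup>2" by (intro power_mono) auto
        then show ?thesis by (simp add: power2_commute)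
      qed
      then show ?case
        unfolding Parseval_difference[OF f r approach_one_bounds]
        by (intro suminf_le ennreal_leI mult_left_mono) auto
    qed
  qed
  also have "\<dots> = (\<Sum>k. ennreal ((cmod (taylor_coeff f k))\<^sup>2 * (1 - r ^ k)\<^sup>2))"
    by (simp add: Liminf_const)
  finally have "ennreal (1 / (1 - r)) * (\<integral>\<^sup>+\<zeta>. ennreal ((cmod (f (of_real r * \<zeta>) - fs \<zeta>))\<^sup>2) \<partial>unit_circle)
     \<le> ennreal (1 / (1 - r)) * (\<Sum>k. ennreal ((cmod (taylor_coeff f k))\<^sup>2 * (1 - r ^ k)\<^sup>2))"
    by (rule mult_left_mono) simp
  also have "\<dots> = (\<Sum>k. ennreal (1 / (1 - r)) * ennreal ((cmod (taylor_coeff f k))\<^sup>2 * (1 - r ^ k)\<^sup>2))"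
    by (rule ennreal_suminf_cmult[symmetric])
  also have "\<dots> \<le> dirichlet_tail f r"
    unfolding dirichlet_tail_def
  proof (rule suminf_le[OF _ summableI summableI])
    fix k
    let ?b = "(cmod (taylor_coeff f k))\<^sup>2"
    have rk: "0 \<le> 1 - r ^ k" using r by (simp add: power_le_one)
    \<comment> \<open>Bernoulli's inequality turns the weight 1 / (1 - r) into the Dirichlet weight
      k.\<close>
    have "1 - r ^ k \<le> real k * (1 - r)"
      using Bernoulli_inequality[of "r - 1" k] r by (simp add: algebra_simps)
    then have "(1 / (1 - r)) * (1 - r ^ k) \<le> real k" using r by (simp add: pos_divide_le_eq)
    then have "(1 / (1 - r)) * (1 - r ^ k) * (?b * (1 - r ^ k)) \<le> real k * (?b * (1 - r ^ k))"
      using rk by (intro mult_right_mono) auto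
    then have "(1 / (1 - r)) * (?b * (1 - r ^ k)\<^sup>2) \<le> real k * ?b * (1 - r ^ k)"
      by (simp add: power2_eq_square mult_ac)
    then show "ennreal (1 / (1 - r)) * ennreal (?b * (1 - r ^ k)\<^sup>2) \<le> ennreal (real k * ?b * (1 - r ^ k))"
      using r by (subst ennreal_mult[symmetric]) (auto intro!: ennreal_leI)
  qed
  finally show ?thesis .
qed

section \<open>Carleson's formula\<close>

lemma inner_excess_eq:
  "inner_excess f \<theta> \<zeta> r = ennreal (r\<^sup>2 * (cmod (f (of_real r * \<zeta>)))\<^sup>2) * ennreal (Julia_quotient \<theta> \<zeta> r)"
  unfolding inner_excess_def Julia_quotient_def by (subst ennreal_mult'[symmetric]) auto

lemma borel_measurable_Julia_quotient:
  assumes "\<theta> holomorphic_on ball 0 1" "0 \<le> r" "r < 1"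
  shows "(\<lambda>\<zeta>. Julia_quotient \<theta> \<zeta> r) \<in> borel_measurable unit_circle"
  unfolding Julia_quotient_def using borel_measurable_radius[OF assms] by measurable

lemma borel_measurable_inner_excess:
  assumes "f holomorphic_on ball 0 1" "\<theta> holomorphic_on ball 0 1" "0 \<le> r" "r < 1"
  shows "(\<lambda>\<zeta>. inner_excess f \<theta> \<zeta> r) \<in> borel_measurable unit_circle"
  unfolding inner_excess_eq
  using borel_measurable_radius[OF assms(1,3,4)] borel_measurable_Julia_quotient[OF assms(2-4)] by measurable

lemma Julia_quotient_le:
  assumes inner: "inner_function \<theta>" and \<zeta>: "cmod \<zeta> = 1" and r: "0 \<le> r" "r < 1"
  shows "Julia_quotient \<theta> \<zeta> r \<le> 1 / (1 - r)"
proof -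
  have "Julia_quotient \<theta> \<zeta> r \<le> 1 / (1 - r\<^sup>2)"
    unfolding Julia_quotient_def using r by (intro divide_right_mono) (auto simp: power_le_one)
  also have "\<dots> \<le> 1 / (1 - r)"
    using r by (intro divide_left_mono mult_pos_pos) (auto simp: power2_eq_square mult_left_le power_less_one_iff[of r 2, unfolded power2_eq_square])
  finally show ?thesis .
qed

text \<open>The coefficient of |b|^2 can be made as close to 1 as desired, at the expense of that of
  |a - b|^2. A fixed factor such as 2 would not lead to equality in the limit.\<close>

lemma cmod_sq_le_convex:
  fixes a b :: complex
  assumes "0 < e"
  shows "(cmod a)\<^sup>2 \<le> (1 + e) * (cmod b)\<^sup>2 + (1 + 1 / e) * (cmod (a - b))\<^sup>2"
proof -
  have "cmod a \<le> cmod b + cmod (a - b)" using norm_triangle_ineq[of b "a - b"] by simp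
  then have "(cmod a)\<^sup>2 \<le> (cmod b + cmod (a - b))\<^sup>2" by (intro power_mono) auto
  also have "\<dots> = (cmod b)\<^sup>2 + (cmod (a - b))\<^sup>2 + 2 * cmod b * cmod (a - b)" by (simp add: power2_sum)
  also have "2 * cmod b * cmod (a - b) \<le> e * (cmod b)\<^sup>2 + (1 / e) * (cmod (a - b))\<^sup>2"
  proof -
    have "0 \<le> (e * cmod b - cmod (a - b))\<^sup>2 / e" using assms by simp
    also have "\<dots> = e * (cmod b)\<^sup>2 + (1 / e) * (cmod (a - b))\<^sup>2 - 2 * cmod b * cmod (a - b)"
      using assms by (simp add: power2_diff field_simps power2_eq_square)
    finally show ?thesis by simp
  qed
  finally show ?thesis by (simp add: algebra_simps)
qed

text \<open>This settles an infinite Dirichlet sum of f, where radial limits are not at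
  hand.\<close>

lemma dirichlet_sum_inner_mult_ge:
  assumes f: "f \<in> H2" and inner: "inner_function \<theta>"
  shows "dirichlet_sum 1 f \<le> dirichlet_sum 1 (\<lambda>z. f z * \<theta> z)"
  by (rule LIMSEQ_le[OF dirichlet_sum_tendsto dirichlet_sum_tendsto])
     (auto simp: dirichlet_sum_inner_mult[OF f inner approach_one_bounds])

text \<open>Fatou's lemma for the excess integrals along \<open>approach_one\<close>.
  \<open>fs\<close> and \<open>q\<close> are any pointwise limits almost everywhere, so that
  measurable versions can be inserted later.\<close>

lemma Carleson_formula_lower:
  assumes f: "f \<in> H2" and inner: "inner_function \<theta>"
    and fs: "AE \<zeta> in unit_circle. (\<lambda>m. f (of_real (approach_one m) * \<zeta>)) \<longlonglongrightarrow> fs \<zeta>"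
    and q: "AE \<zeta> in unit_circle. (\<lambda>m. ennreal (Julia_quotient \<theta> \<zeta> (approach_one m))) \<longlonglongrightarrow> q \<zeta>"
  shows "dirichlet_sum 1 f + (\<integral>\<^sup>+\<zeta>. ennreal ((cmod (fs \<zeta>))\<^sup>2) * q \<zeta> \<partial>unit_circle)
    \<le> dirichlet_sum 1 (\<lambda>z. f z * \<theta> z)"
proof -
  note hol = inner_function_holomorphic[OF inner]
  have hf: "f holomorphic_on ball 0 1" using f by (simp add: H2_def)
  define K where "K = (\<lambda>m. \<integral>\<^sup>+\<zeta>. inner_excess f \<theta> \<zeta> (approach_one m) \<partial>unit_circle)"
  have "(\<integral>\<^sup>+\<zeta>. ennreal ((cmod (fs \<zeta>))\<^sup>2) * q \<zeta> \<partial>unit_circle) \<le> (\<integral>\<^sup>+\<zeta>. liminf (\<lambda>m. inner_excess f \<theta> \<zeta> (approach_one m)) \<partial>unit_circle)"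
  proof (rule nn_integral_mono_AE, use fs q in eventually_elim)
    case (elim \<zeta>)
    \<comment> \<open>Where \<open>fs\<close> vanishes, \<open>q\<close> may be infinite and the
      limit of the product is indeterminate. There the left side is 0, since 0 * \<infinity> = 0 in
      the extended reals.\<close>
    show ?case
    proof (cases "fs \<zeta> = 0")
      case False
      have "(\<lambda>m. (approach_one m)\<^sup>2 * (cmod (f (of_real (approach_one m) * \<zeta>)))\<^sup>2) \<longlonglongrightarrow> 1\<^sup>2 * (cmod (fs \<zeta>))\<^sup>2"
        by (intro tendsto_intros approach_one_tendsto elim)
      then have "(\<lambda>m. ennreal ((approach_one m)\<^sup>2 * (cmod (f (of_real (approach_one m) * \<zeta>)))\<^sup>2)) \<longlonglongrightarrow> ennreal ((cmod (fs \<zeta>))\<^sup>2)"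
        by (intro tendsto_ennrealI) simp
      then have "(\<lambda>m. inner_excess f \<theta> \<zeta> (approach_one m)) \<longlonglongrightarrow> ennreal ((cmod (fs \<zeta>))\<^sup>2) * q \<zeta>"
        unfolding inner_excess_eq using False by (intro tendsto_mult_ennreal elim) auto
      from lim_imp_Liminf[OF sequentially_bot this] show ?thesis by simp
    qed simp
  qed
  also have "\<dots> \<le> liminf K"
    unfolding K_def
    by (rule nn_integral_liminf) (rule borel_measurable_inner_excess[OF hf hol approach_one_bounds])
  finally have JK: "(\<integral>\<^sup>+\<zeta>. ennreal ((cmod (fs \<zeta>))\<^sup>2) * q \<zeta> \<partial>unit_circle) \<le> liminf K" .
  \<comment> \<open>\<open>K\<close> itself need not be known to converge; its running infima
    increase to the lower limit and can be added to a convergent sequence.\<close>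
  define g where "g = (\<lambda>m. INF n\<in>{m..}. K n)"
  have "g \<longlonglongrightarrow> (SUP m. g m)"
    by (rule LIMSEQ_SUP) (auto simp: g_def incseq_def intro!: INF_superset_mono)
  then have "g \<longlonglongrightarrow> liminf K" by (simp add: g_def liminf_SUP_INF)
  then have "(\<lambda>m. dirichlet_sum (approach_one m) f + g m) \<longlonglongrightarrow> dirichlet_sum 1 f + liminf K"
    by (intro tendsto_add dirichlet_sum_tendsto)
  moreover have "dirichlet_sum (approach_one m) f + g m \<le> dirichlet_sum (approach_one m) (\<lambda>z. f z * \<theta> z)" for m
    unfolding dirichlet_sum_inner_mult[OF f inner approach_one_bounds] K_def[symmetric] g_def
    by (intro add_left_mono) (auto simp: K_def intro: INF_lower)
  ultimately have "dirichlet_sum 1 f + liminf K \<le> dirichlet_sum 1 (\<lambda>z. f z * \<theta> z)"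
    by (intro LIMSEQ_le[OF _ dirichlet_sum_tendsto]) auto
  with JK show ?thesis by (meson add_left_mono order_trans)
qed

text \<open>The two bounds for the Julia quotient are used side by side: the one by \<open>q\<close>
  on the term with |fs|^2, and 1 / (1 - r) on the squared difference, where the L^2 error estimate
  applies.\<close>

lemma inner_excess_integral_le:
  assumes f: "f \<in> H2" and inner: "inner_function \<theta>" and e: "0 < e"
    and fsm: "fs \<in> borel_measurable unit_circle"
    and fs: "AE \<zeta> in unit_circle. (\<lambda>m. f (of_real (approach_one m) * \<zeta>)) \<longlonglongrightarrow> fs \<zeta>"
    and qm: "q \<in> borel_measurable unit_circle"
    and r: "0 \<le> r" "r < 1"
    and q_le: "AE \<zeta> in unit_circle. ennreal (Julia_quotient \<theta> \<zeta> r) \<le> ennreal (4 / (1 + r)\<^sup>2) * q \<zeta>"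
  shows "(\<integral>\<^sup>+\<zeta>. inner_excess f \<theta> \<zeta> r \<partial>unit_circle) \<le>
    ennreal ((1 + e) * (4 / (1 + r)\<^sup>2)) * (\<integral>\<^sup>+\<zeta>. ennreal ((cmod (fs \<zeta>))\<^sup>2) * q \<zeta> \<partial>unit_circle)
    + ennreal (1 + 1 / e) * dirichlet_tail f r"
proof -
  have hf: "f holomorphic_on ball 0 1" using f by (simp add: H2_def)
  note [measurable] = fsm qm borel_measurable_radius[OF hf r]
  have "(\<integral>\<^sup>+\<zeta>. inner_excess f \<theta> \<zeta> r \<partial>unit_circle) \<le>
    (\<integral>\<^sup>+\<zeta>. ennreal ((1 + e) * (4 / (1 + r)\<^sup>2)) * (ennreal ((cmod (fs \<zeta>))\<^sup>2) * q \<zeta>)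
      + ennreal (1 + 1 / e) * (ennreal (1 / (1 - r)) * ennreal ((cmod (f (of_real r * \<zeta>) - fs \<zeta>))\<^sup>2)) \<partial>unit_circle)"
  proof (rule nn_integral_mono_AE, use q_le AE_space in eventually_elim)
    case (elim \<zeta>)
    define Q where "Q = ennreal (Julia_quotient \<theta> \<zeta> r)"
    define F where "F = ennreal ((cmod (fs \<zeta>))\<^sup>2)"
    define G where "G = ennreal ((cmod (f (of_real r * \<zeta>) - fs \<zeta>))\<^sup>2)"
    have Q1: "Q \<le> ennreal (1 / (1 - r))"
      unfolding Q_def using elim r by (intro ennreal_leI Julia_quotient_le[OF inner]) auto
    have "r\<^sup>2 * (cmod (f (of_real r * \<zeta>)))\<^sup>2 \<le> 1 * (cmod (f (of_real r * \<zeta>)))\<^sup>2"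
      using r by (intro mult_right_mono) (auto simp: power_le_one)
    also have "\<dots> \<le> (1 + e) * (cmod (fs \<zeta>))\<^sup>2 + (1 + 1 / e) * (cmod (f (of_real r * \<zeta>) - fs \<zeta>))\<^sup>2"
      using cmod_sq_le_convex[OF e] by simp
    finally have "inner_excess f \<theta> \<zeta> r \<le> ennreal ((1 + e) * (cmod (fs \<zeta>))\<^sup>2 + (1 + 1 / e) * (cmod (f (of_real r * \<zeta>) - fs \<zeta>))\<^sup>2) * Q"
      unfolding inner_excess_eq Q_def by (intro mult_right_mono ennreal_leI) auto
    also have "\<dots> = (ennreal (1 + e) * F + ennreal (1 + 1 / e) * G) * Q"
    proof -
      have "ennreal ((1 + e) * (cmod (fs \<zeta>))\<^sup>2) = ennreal (1 + e) * F"
        "ennreal ((1 + 1 / e) * (cmod (f (of_real r * \<zeta>) - fs \<zeta>))\<^sup>2) = ennreal (1 + 1 / e) * G"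
        unfolding F_def G_def by (intro ennreal_mult; use e in simp)+
      then show ?thesis using e by (subst ennreal_plus) (simp_all only:, simp_all)
    qed
    also have "\<dots> = ennreal (1 + e) * F * Q + ennreal (1 + 1 / e) * G * Q" by (rule distrib_right)
    also have "\<dots> \<le> ennreal (1 + e) * F * (ennreal (4 / (1 + r)\<^sup>2) * q \<zeta>) + ennreal (1 + 1 / e) * G * ennreal (1 / (1 - r))"
      using elim(1) Q1 unfolding Q_def by (intro add_mono mult_left_mono) auto
    also have "\<dots> = (ennreal (1 + e) * ennreal (4 / (1 + r)\<^sup>2)) * (F * q \<zeta>) + ennreal (1 + 1 / e) * (ennreal (1 / (1 - r)) * G)"
      by (simp only: mult_ac)
    also have "ennreal (1 + e) * ennreal (4 / (1 + r)\<^sup>2) = ennreal ((1 + e) * (4 / (1 + r)\<^sup>2))"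
      using e by (intro ennreal_mult[symmetric]) auto
    finally show ?case unfolding F_def G_def .
  qed
  also have "\<dots> = ennreal ((1 + e) * (4 / (1 + r)\<^sup>2)) * (\<integral>\<^sup>+\<zeta>. ennreal ((cmod (fs \<zeta>))\<^sup>2) * q \<zeta> \<partial>unit_circle)
      + ennreal (1 + 1 / e) * (ennreal (1 / (1 - r)) * (\<integral>\<^sup>+\<zeta>. ennreal ((cmod (f (of_real r * \<zeta>) - fs \<zeta>))\<^sup>2) \<partial>unit_circle))"
    by (subst nn_integral_add, measurable) (subst nn_integral_cmult, measurable)+
  also have "\<dots> \<le> ennreal ((1 + e) * (4 / (1 + r)\<^sup>2)) * (\<integral>\<^sup>+\<zeta>. ennreal ((cmod (fs \<zeta>))\<^sup>2) * q \<zeta> \<partial>unit_circle)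
      + ennreal (1 + 1 / e) * dirichlet_tail f r"
    by (intro add_left_mono mult_left_mono radial_L2_error[OF hf r fs]) simp
  finally show ?thesis .
qed

lemma Carleson_formula_upper:
  assumes f: "f \<in> H2" and inner: "inner_function \<theta>" and D: "dirichlet_sum 1 f < \<infinity>"
    and fsm: "fs \<in> borel_measurable unit_circle"
    and fs: "AE \<zeta> in unit_circle. (\<lambda>m. f (of_real (approach_one m) * \<zeta>)) \<longlonglongrightarrow> fs \<zeta>"
    and qm: "q \<in> borel_measurable unit_circle"
    and q_le: "\<And>m. AE \<zeta> in unit_circle. ennreal (Julia_quotient \<theta> \<zeta> (approach_one m)) \<le> ennreal (4 / (1 + approach_one m)\<^sup>2) * q \<zeta>"
  shows "dirichlet_sum 1 (\<lambda>z. f z * \<theta> z) \<le>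
    dirichlet_sum 1 f + (\<integral>\<^sup>+\<zeta>. ennreal ((cmod (fs \<zeta>))\<^sup>2) * q \<zeta> \<partial>unit_circle)"
proof -
  define J where "J = (\<integral>\<^sup>+\<zeta>. ennreal ((cmod (fs \<zeta>))\<^sup>2) * q \<zeta> \<partial>unit_circle)"
  show ?thesis
  proof (cases "J = \<infinity>")
    case True
    then show ?thesis unfolding J_def by simp
  next
    case False
    \<comment> \<open>Here r tends to 1 while e stays fixed, so the large factor 1 + 1/e multiplies
      a null sequence. Finiteness of \<open>J\<close> makes multiplication by \<open>J\<close>
      continuous, both here and in the later limit e -> 0.\<close>
    have le: "dirichlet_sum 1 (\<lambda>z. f z * \<theta> z) \<le> dirichlet_sum 1 f + ennreal (1 + e) * J" if e: "0 < e" for e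
    proof -
      have "(\<lambda>m. (1 + e) * (4 / (1 + approach_one m)\<^sup>2)) \<longlonglongrightarrow> (1 + e) * (4 / (1 + 1)\<^sup>2)"
        by (intro tendsto_intros approach_one_tendsto) simp
      then have "(\<lambda>m. ennreal ((1 + e) * (4 / (1 + approach_one m)\<^sup>2))) \<longlonglongrightarrow> ennreal (1 + e)"
        by (intro tendsto_ennrealI) simp
      then have "(\<lambda>m. ennreal ((1 + e) * (4 / (1 + approach_one m)\<^sup>2)) * J) \<longlonglongrightarrow> ennreal (1 + e) * J"
        using False e by (intro tendsto_mult_ennreal tendsto_const) auto
      moreover have "(\<lambda>m. ennreal (1 + 1 / e) * dirichlet_tail f (approach_one m)) \<longlonglongrightarrow> ennreal (1 + 1 / e) * 0"
        by (intro ennreal_tendsto_cmult dirichlet_tail_tendsto D) simp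
      ultimately have "(\<lambda>m. dirichlet_sum (approach_one m) f + (ennreal ((1 + e) * (4 / (1 + approach_one m)\<^sup>2)) * J
            + ennreal (1 + 1 / e) * dirichlet_tail f (approach_one m)))
        \<longlonglongrightarrow> dirichlet_sum 1 f + (ennreal (1 + e) * J + ennreal (1 + 1 / e) * 0)"
        by (intro tendsto_add dirichlet_sum_tendsto)
      moreover have "dirichlet_sum (approach_one m) (\<lambda>z. f z * \<theta> z) \<le> dirichlet_sum (approach_one m) f +
          (ennreal ((1 + e) * (4 / (1 + approach_one m)\<^sup>2)) * J + ennreal (1 + 1 / e) * dirichlet_tail f (approach_one m))" for m
        unfolding dirichlet_sum_inner_mult[OF f inner approach_one_bounds] J_def
        by (intro add_left_mono inner_excess_integral_le f inner e fsm fs qm approach_one_bounds q_le)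
      ultimately have "dirichlet_sum 1 (\<lambda>z. f z * \<theta> z) \<le> dirichlet_sum 1 f + (ennreal (1 + e) * J + ennreal (1 + 1 / e) * 0)"
        by (intro LIMSEQ_le[OF dirichlet_sum_tendsto]) auto
      then show ?thesis by simp
    qed
    have "((\<lambda>e::real. ennreal (1 + e)) \<longlongrightarrow> ennreal (1 + 0)) (at_right 0)"
      by (intro tendsto_ennrealI tendsto_intros)
    then have "((\<lambda>e::real. ennreal (1 + e) * J) \<longlongrightarrow> ennreal (1 + 0) * J) (at_right 0)"
      using False by (intro tendsto_mult_ennreal tendsto_const) auto
    then have "((\<lambda>e::real. dirichlet_sum 1 f + ennreal (1 + e) * J) \<longlongrightarrow> dirichlet_sum 1 f + ennreal (1 + 0) * J) (at_right 0)"
      by (intro tendsto_add tendsto_const)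
    moreover have "\<forall>\<^sub>F e in at_right (0::real). dirichlet_sum 1 (\<lambda>z. f z * \<theta> z) \<le> dirichlet_sum 1 f + ennreal (1 + e) * J"
      using eventually_at_right_less by eventually_elim (rule le)
    ultimately have "dirichlet_sum 1 (\<lambda>z. f z * \<theta> z) \<le> dirichlet_sum 1 f + ennreal (1 + 0) * J"
      by (intro tendsto_lowerbound) auto
    then show ?thesis by (simp add: J_def)
  qed
qed

lemma AE_Julia_point:
  assumes inner: "inner_function \<theta>"
  shows "AE \<zeta> in unit_circle. \<exists>L. Julia_point \<theta> \<zeta> L"
  using inner_function_AE[OF inner] AE_space
  by eventually_elim
     (auto simp: Julia_point_def intro: inner_function_holomorphic inner_function_le_1 inner)

text \<open>The integrand in terms of \<open>radial_limit\<close> and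
  \<open>angular_derivative_modulus\<close> does not come with measurability. A measurable function
  equal to it almost everywhere is therefore handed out, so that the caller can add and scale
  integrals.\<close>

proposition Carleson_formula:
  assumes f: "f \<in> H2" and inner: "inner_function \<theta>" and D: "dirichlet_sum 1 f < \<infinity>"
  obtains B where "B \<in> borel_measurable unit_circle"
    and "AE \<zeta> in unit_circle. ennreal ((cmod (radial_limit f \<zeta>))\<^sup>2) * angular_derivative_modulus \<theta> \<zeta> = B \<zeta>"
    and "dirichlet_sum 1 (\<lambda>z. f z * \<theta> z) = dirichlet_sum 1 f + (\<integral>\<^sup>+\<zeta>. B \<zeta> \<partial>unit_circle)"
proof -
  note hol = inner_function_holomorphic[OF inner]
  have hf: "f holomorphic_on ball 0 1" using f by (simp add: H2_def)
  \<comment> \<open>measurable versions of the radial limit and of the angular derivative\<close>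
  define fs where "fs = (\<lambda>\<zeta>. lim (\<lambda>m. f (of_real (approach_one m) * \<zeta>)))"
  define q where "q = (\<lambda>\<zeta>. liminf (\<lambda>m. ennreal (Julia_quotient \<theta> \<zeta> (approach_one m))))"
  have fsm: "fs \<in> borel_measurable unit_circle"
    unfolding fs_def by (intro borel_measurable_lim_metric borel_measurable_radius[OF hf approach_one_bounds])
  have qm: "q \<in> borel_measurable unit_circle"
    unfolding q_def
    by (intro borel_measurable_liminf measurable_compose[OF borel_measurable_Julia_quotient[OF hol approach_one_bounds] measurable_ennreal])
  have fsl: "AE \<zeta> in unit_circle. (\<lambda>m. f (of_real (approach_one m) * \<zeta>)) \<longlonglongrightarrow> radial_limit f \<zeta>"
    using AE_radial_limit[OF hf D]
    by eventually_elim (rule filterlim_compose[OF _ filterlim_approach_one])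
  have fs_eq: "AE \<zeta> in unit_circle. fs \<zeta> = radial_limit f \<zeta>"
    using fsl by eventually_elim (simp add: fs_def limI)
  have fs: "AE \<zeta> in unit_circle. (\<lambda>m. f (of_real (approach_one m) * \<zeta>)) \<longlonglongrightarrow> fs \<zeta>"
    using fsl fs_eq by eventually_elim simp
  have ql: "AE \<zeta> in unit_circle. (\<lambda>m. ennreal (Julia_quotient \<theta> \<zeta> (approach_one m))) \<longlonglongrightarrow> angular_derivative_modulus \<theta> \<zeta>"
    using AE_Julia_point[OF inner]
    by eventually_elim (blast intro: filterlim_compose[OF Julia_point.Julia_Caratheodory(1) filterlim_approach_one])
  have q_eq: "AE \<zeta> in unit_circle. q \<zeta> = angular_derivative_modulus \<theta> \<zeta>"
    using ql by eventually_elim (simp only: q_def, rule lim_imp_Liminf[OF sequentially_bot])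
  have q: "AE \<zeta> in unit_circle. (\<lambda>m. ennreal (Julia_quotient \<theta> \<zeta> (approach_one m))) \<longlonglongrightarrow> q \<zeta>"
    using ql q_eq by eventually_elim (simp only:)
  have q_le: "AE \<zeta> in unit_circle. ennreal (Julia_quotient \<theta> \<zeta> (approach_one m)) \<le> ennreal (4 / (1 + approach_one m)\<^sup>2) * q \<zeta>" for m
    using AE_Julia_point[OF inner] q_eq
    by eventually_elim (use Julia_point.Julia_Caratheodory(2)[OF _ approach_one_bounds] in \<open>simp only:, blast\<close>)
  show ?thesis
  proof (rule that)
    show "(\<lambda>\<zeta>. ennreal ((cmod (fs \<zeta>))\<^sup>2) * q \<zeta>) \<in> borel_measurable unit_circle"
      using fsm qm by measurable
    show "AE \<zeta> in unit_circle. ennreal ((cmod (radial_limit f \<zeta>))\<^sup>2) * angular_derivative_modulus \<theta> \<zeta> = ennreal ((cmod (fs \<zeta>))\<^sup>2) * q \<zeta>"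
      using fs_eq q_eq by eventually_elim (simp only:)
    show "dirichlet_sum 1 (\<lambda>z. f z * \<theta> z) = dirichlet_sum 1 f + (\<integral>\<^sup>+\<zeta>. ennreal ((cmod (fs \<zeta>))\<^sup>2) * q \<zeta> \<partial>unit_circle)"
      by (intro antisym Carleson_formula_upper[OF f inner D fsm fs qm q_le] Carleson_formula_lower[OF f inner fs q])
  qed
qed

section \<open>Integration over the radius\<close>

lemma borel_measurable_dirichlet_sum [measurable]: "(\<lambda>r. dirichlet_sum r g) \<in> borel_measurable borel"
  unfolding dirichlet_sum_def partial_weight_def by measurable

lemma w_norm_sq_eq_dirichlet_sum:
  assumes sigma: "sets \<sigma> = sets (restrict_space borel {0..1::real})"
  shows "w_norm_sq (\<lambda>n. \<Sum>k\<in>{1..n}. \<integral>\<^sup>+x. ennreal (x ^ (2 * k)) \<partial>\<sigma>) g = (\<integral>\<^sup>+r. dirichlet_sum r g \<partial>\<sigma>)"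
proof -
  have meas: "h \<in> borel_measurable \<sigma>" if "h \<in> borel_measurable borel" for h :: "real \<Rightarrow> ennreal"
    using that unfolding measurable_cong_sets[OF sigma refl] by (rule measurable_restrict_space1)
  have sp: "space \<sigma> = {0..1}" using sets_eq_imp_space_eq[OF sigma] by (simp add: space_restrict_space)
  have m: "(\<lambda>r. ennreal (r ^ (2 * j))) \<in> borel_measurable \<sigma>" for j
    by (rule meas) measurable
  have ms: "(\<lambda>r. \<Sum>j\<in>{1..n}. ennreal (r ^ (2 * j))) \<in> borel_measurable \<sigma>" for n
    by (intro borel_measurable_sum m)
  let ?b = "\<lambda>k. (cmod (taylor_coeff g k))\<^sup>2"
  have "w_norm_sq (\<lambda>n. \<Sum>k\<in>{1..n}. \<integral>\<^sup>+x. ennreal (x ^ (2 * k)) \<partial>\<sigma>) g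
    = (\<Sum>k. \<integral>\<^sup>+r. ennreal (partial_weight r (Suc k) * ?b (Suc k)) \<partial>\<sigma>)"
    unfolding w_norm_sq_def
  proof (rule suminf_cong)
    fix k
    have "(\<Sum>j\<in>{1..Suc k}. \<integral>\<^sup>+x. ennreal (x ^ (2 * j)) \<partial>\<sigma>) * ennreal (?b (Suc k))
      = (\<integral>\<^sup>+r. (\<Sum>j\<in>{1..Suc k}. ennreal (r ^ (2 * j))) * ennreal (?b (Suc k)) \<partial>\<sigma>)"
      by (simp only: nn_integral_multc[OF ms] nn_integral_sum[OF m])
    also have "\<dots> = (\<integral>\<^sup>+r. ennreal (partial_weight r (Suc k) * ?b (Suc k)) \<partial>\<sigma>)"
    proof (rule nn_integral_cong)
      fix r assume "r \<in> space \<sigma>"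
      then have r: "0 \<le> r" by (simp add: sp)
      show "(\<Sum>j\<in>{1..Suc k}. ennreal (r ^ (2 * j))) * ennreal (?b (Suc k)) = ennreal (partial_weight r (Suc k) * ?b (Suc k))"
        unfolding partial_weight_def using r
        by (subst sum_ennreal) (auto simp: ennreal_mult'' simp del: sum.cl_ivl_Suc)
    qed
    finally show "(\<Sum>j\<in>{1..Suc k}. \<integral>\<^sup>+x. ennreal (x ^ (2 * j)) \<partial>\<sigma>) * ennreal (?b (Suc k))
      = (\<integral>\<^sup>+r. ennreal (partial_weight r (Suc k) * ?b (Suc k)) \<partial>\<sigma>)" .
  qed
  also have "\<dots> = (\<integral>\<^sup>+r. (\<Sum>k. ennreal (partial_weight r (Suc k) * ?b (Suc k))) \<partial>\<sigma>)"
    by (rule nn_integral_suminf[symmetric], rule meas) (unfold partial_weight_def, measurable)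
  also have "\<dots> = (\<integral>\<^sup>+r. dirichlet_sum r g \<partial>\<sigma>)"
  proof (rule nn_integral_cong)
    fix r
    show "(\<Sum>k. ennreal (partial_weight r (Suc k) * ?b (Suc k))) = dirichlet_sum r g"
      unfolding dirichlet_sum_def
      using suminf_offset[OF summableI, of "\<lambda>k. ennreal (partial_weight r k * ?b k)" 1]
      by (simp add: partial_weight_def del: sum.cl_ivl_Suc)
  qed
  finally show ?thesis .
qed

text \<open>On [0,1] the second branch is reached only at the point 1, so it contributes the mass of
  that point. Measurability of \<open>h\<close> is asked on [0,1) only, where r \<zeta> lies in the
  disc.\<close>

lemma nn_integral_split_at_1:
  assumes sigma: "sets \<sigma> = sets (restrict_space borel {0..1::real})"
    and h: "h \<in> borel_measurable (restrict_space \<sigma> {0..<1})"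
  shows "(\<integral>\<^sup>+r. (if r < 1 then h r else c) \<partial>\<sigma>) = (\<integral>\<^sup>+r. h r \<partial>restrict_space \<sigma> {0..<1}) + c * emeasure \<sigma> {1}"
proof -
  have sp: "space \<sigma> = {0..1}" using sets_eq_imp_space_eq[OF sigma] by (simp add: space_restrict_space)
  have cap: "{0..<1} \<inter> {0..1} = {0..<1::real}" by auto
  have A: "{0..<1} \<in> sets \<sigma>" and S: "{1} \<in> sets \<sigma>"
    unfolding sigma by (auto simp: sets_restrict_space_iff)
  have hm: "(\<lambda>r. h r * indicator {0..<1} r) \<in> borel_measurable \<sigma>"
    using h A by (subst (asm) borel_measurable_restrict_space_iff_ennreal) (simp_all add: sp cap)
  have "(\<integral>\<^sup>+r. (if r < 1 then h r else c) \<partial>\<sigma>) = (\<integral>\<^sup>+r. h r * indicator {0..<1} r + c * indicator {1} r \<partial>\<sigma>)"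
    by (rule nn_integral_cong) (auto simp: sp split: split_indicator)
  also have "\<dots> = (\<integral>\<^sup>+r. h r * indicator {0..<1} r \<partial>\<sigma>) + c * emeasure \<sigma> {1}"
    using hm S by (subst nn_integral_add) (auto simp: nn_integral_cmult_indicator)
  also have "(\<integral>\<^sup>+r. h r * indicator {0..<1} r \<partial>\<sigma>) = (\<integral>\<^sup>+r. h r \<partial>restrict_space \<sigma> {0..<1})"
    by (rule nn_integral_restrict_space[symmetric]) (use A in \<open>simp add: sp cap\<close>)
  finally show ?thesis .
qed

lemma Fubini_inner_excess:
  assumes sigma: "sets \<sigma> = sets (restrict_space borel {0..<1::real})"
    and mom: "(\<integral>\<^sup>+ x. ennreal (x^2) \<partial>\<sigma>) < \<infinity>"
    and f: "f holomorphic_on ball 0 1" and \<theta>: "\<theta> holomorphic_on ball 0 1"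
  shows "\<And>\<zeta>. \<zeta> \<in> space unit_circle \<Longrightarrow> (\<lambda>r. inner_excess f \<theta> \<zeta> r) \<in> borel_measurable \<sigma>"
    and "(\<lambda>\<zeta>. \<integral>\<^sup>+r. inner_excess f \<theta> \<zeta> r \<partial>\<sigma>) \<in> borel_measurable unit_circle"
    and "(\<lambda>r. \<integral>\<^sup>+\<zeta>. inner_excess f \<theta> \<zeta> r \<partial>unit_circle) \<in> borel_measurable \<sigma>"
    and "(\<integral>\<^sup>+\<zeta>. \<integral>\<^sup>+r. inner_excess f \<theta> \<zeta> r \<partial>\<sigma> \<partial>unit_circle) = (\<integral>\<^sup>+r. \<integral>\<^sup>+\<zeta>. inner_excess f \<theta> \<zeta> r \<partial>unit_circle \<partial>\<sigma>)"
proof -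
  have meas: "(\<lambda>x. x) \<in> borel_measurable \<sigma>"
    unfolding measurable_cong_sets[OF sigma refl] by (rule measurable_restrict_space1) simp
  have sp: "space \<sigma> = {0..<1}" using sets_eq_imp_space_eq[OF sigma] by (simp add: space_restrict_space)
  \<comment> \<open>The factor r^2 of the integrand is separated so that it can be moved into the
    measure.\<close>
  define e where "e = (\<lambda>\<zeta> r. ennreal ((cmod (f (of_real r * \<zeta>)))\<^sup>2 * (1 - (cmod (\<theta> (of_real r * \<zeta>)))\<^sup>2) / (1 - r\<^sup>2)))"
  have ex: "inner_excess f \<theta> \<zeta> r = ennreal (r\<^sup>2) * e \<zeta> r" for \<zeta> r
    unfolding inner_excess_def e_def by (subst ennreal_mult'[symmetric]) (auto simp: mult.assoc)
  \<comment> \<open>\<open>\<sigma>\<close> may have infinite mass at 0 and thus fail to be sigma-finite, but \<open>x\<^sup>2 d\<sigma>\<close> is finite.\<close>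
  define \<tau> where "\<tau> = density \<sigma> (\<lambda>x. ennreal (x\<^sup>2))"
  have x2: "(\<lambda>x. ennreal (x\<^sup>2)) \<in> borel_measurable \<sigma>" using meas by measurable
  have sets\<tau>: "sets \<tau> = sets \<sigma>" and sp\<tau>: "space \<tau> = {0..<1}" by (simp_all add: \<tau>_def sp)
  have "finite_measure \<tau>"
  proof (rule finite_measureI)
    have "emeasure \<tau> (space \<tau>) = (\<integral>\<^sup>+ x. ennreal (x\<^sup>2) * indicator (space \<sigma>) x \<partial>\<sigma>)"
      unfolding \<tau>_def using x2 by (simp add: emeasure_density)
    also have "\<dots> = (\<integral>\<^sup>+ x. ennreal (x\<^sup>2) \<partial>\<sigma>)" by (rule nn_integral_cong) simp
    finally show "emeasure \<tau> (space \<tau>) \<noteq> \<infinity>" using mom by simp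
  qed
  then interpret \<tau>: finite_measure \<tau> .
  interpret P: pair_sigma_finite unit_circle \<tau> ..
  have mult: "(\<lambda>p. of_real (snd p) * fst p :: complex) \<in> borel_measurable (unit_circle \<Otimes>\<^sub>M \<tau>)"
  proof -
    have id: "(\<lambda>x. x) \<in> borel_measurable \<tau>" using meas by (simp add: measurable_cong_sets[OF sets\<tau> refl])
    have "(\<lambda>p. snd p) \<in> borel_measurable (unit_circle \<Otimes>\<^sub>M \<tau>)" "(\<lambda>p. fst p) \<in> borel_measurable (unit_circle \<Otimes>\<^sub>M \<tau>)"
      by (rule measurable_compose[OF measurable_snd id], rule measurable_compose[OF measurable_fst borel_measurable_unit_circle_id])
    then show ?thesis by measurable
  qed
  have comp: "(\<lambda>p. g (of_real (snd p) * fst p)) \<in> borel_measurable (unit_circle \<Otimes>\<^sub>M \<tau>)"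
    if "g holomorphic_on ball 0 1" for g :: "complex \<Rightarrow> complex"
    by (rule borel_measurable_holomorphic_ball[OF that mult]) (auto simp: space_pair_measure sp\<tau> norm_mult)
  have em: "(\<lambda>(\<zeta>, r). e \<zeta> r) \<in> borel_measurable (unit_circle \<Otimes>\<^sub>M \<tau>)"
  proof -
    have "(\<lambda>p. snd p) \<in> borel_measurable (unit_circle \<Otimes>\<^sub>M \<tau>)"
      using measurable_compose[OF measurable_snd, of "\<lambda>x. x" \<tau> borel unit_circle] meas
      by (simp add: measurable_cong_sets[OF sets\<tau> refl])
    then show ?thesis
      using comp[OF f] comp[OF \<theta>] unfolding e_def case_prod_beta' by measurable
  qed
  have er: "e \<zeta> \<in> borel_measurable \<sigma>" if "\<zeta> \<in> space unit_circle" for \<zeta>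
    using measurable_compose_Pair1[OF that em] by (simp add: measurable_cong_sets[OF sets\<tau> refl])
  show "(\<lambda>r. inner_excess f \<theta> \<zeta> r) \<in> borel_measurable \<sigma>" if "\<zeta> \<in> space unit_circle" for \<zeta>
    unfolding ex using er[OF that] x2 by measurable
  have int_r: "(\<integral>\<^sup>+r. inner_excess f \<theta> \<zeta> r \<partial>\<sigma>) = (\<integral>\<^sup>+r. e \<zeta> r \<partial>\<tau>)" if "\<zeta> \<in> space unit_circle" for \<zeta>
    unfolding ex \<tau>_def by (rule nn_integral_density[OF x2 er[OF that], symmetric])
  have m1: "(\<lambda>\<zeta>. \<integral>\<^sup>+r. e \<zeta> r \<partial>\<tau>) \<in> borel_measurable unit_circle"
    by (rule \<tau>.borel_measurable_nn_integral[OF em])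
  then show "(\<lambda>\<zeta>. \<integral>\<^sup>+r. inner_excess f \<theta> \<zeta> r \<partial>\<sigma>) \<in> borel_measurable unit_circle"
    by (subst measurable_cong[OF int_r])
  have m2: "(\<lambda>r. \<integral>\<^sup>+\<zeta>. e \<zeta> r \<partial>unit_circle) \<in> borel_measurable \<sigma>"
    using unit_circle.borel_measurable_nn_integral[of "\<lambda>r \<zeta>. e \<zeta> r" \<tau>] measurable_pair_swap[OF em]
    by (simp add: measurable_cong_sets[OF sets\<tau> refl])
  have int_z: "(\<integral>\<^sup>+\<zeta>. inner_excess f \<theta> \<zeta> r \<partial>unit_circle) = ennreal (r\<^sup>2) * (\<integral>\<^sup>+\<zeta>. e \<zeta> r \<partial>unit_circle)" if "r \<in> space \<sigma>" for r
    unfolding ex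
  proof (rule nn_integral_cmult)
    show "(\<lambda>\<zeta>. e \<zeta> r) \<in> borel_measurable unit_circle"
    proof -
      have "r \<in> space \<tau>" using that by (simp add: sp sp\<tau>)
      from measurable_Pair1[OF em this] show ?thesis by (simp only: prod.case)
    qed
  qed
  show "(\<lambda>r. \<integral>\<^sup>+\<zeta>. inner_excess f \<theta> \<zeta> r \<partial>unit_circle) \<in> borel_measurable \<sigma>"
    using m2 meas by (subst measurable_cong[OF int_z]) measurable
  have "(\<integral>\<^sup>+\<zeta>. \<integral>\<^sup>+r. inner_excess f \<theta> \<zeta> r \<partial>\<sigma> \<partial>unit_circle) = (\<integral>\<^sup>+\<zeta>. \<integral>\<^sup>+r. e \<zeta> r \<partial>\<tau> \<partial>unit_circle)"
    by (rule nn_integral_cong) (rule int_r)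
  also have "\<dots> = (\<integral>\<^sup>+r. \<integral>\<^sup>+\<zeta>. e \<zeta> r \<partial>unit_circle \<partial>\<tau>)" by (rule P.Fubini'[OF em, symmetric])
  also have "\<dots> = (\<integral>\<^sup>+r. ennreal (r\<^sup>2) * (\<integral>\<^sup>+\<zeta>. e \<zeta> r \<partial>unit_circle) \<partial>\<sigma>)"
    unfolding \<tau>_def by (rule nn_integral_density[OF x2 m2])
  also have "\<dots> = (\<integral>\<^sup>+r. \<integral>\<^sup>+\<zeta>. inner_excess f \<theta> \<zeta> r \<partial>unit_circle \<partial>\<sigma>)"
    by (rule nn_integral_cong) (rule int_z[symmetric])
  finally show "(\<integral>\<^sup>+\<zeta>. \<integral>\<^sup>+r. inner_excess f \<theta> \<zeta> r \<partial>\<sigma> \<partial>unit_circle) = (\<integral>\<^sup>+r. \<integral>\<^sup>+\<zeta>. inner_excess f \<theta> \<zeta> r \<partial>unit_circle \<partial>\<sigma>)" .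
qed

theorem theorem3p5:
  fixes \<sigma> :: "real measure" and f \<theta> :: "complex \<Rightarrow> complex"
    and \<gamma> w :: "nat \<Rightarrow> ennreal"
  assumes sigma: "sets \<sigma> = sets (restrict_space borel {0..1::real})"
    and mom: "(\<integral>\<^sup>+ x. ennreal (x^2) \<partial>\<sigma>) < \<infinity>"
    and gamma: "\<And>k. \<gamma> k = (\<integral>\<^sup>+ x. ennreal (x^(2*k)) \<partial>\<sigma>)"
    and w: "\<And>n. w n = (\<Sum>k\<in>{1..n}. \<gamma> k)"
    and f: "f \<in> H2"
    and inner: "inner_function \<theta>"
  shows "w_norm_sq w (\<lambda>z. f z * \<theta> z) =
           w_norm_sq w f +
           (\<integral>\<^sup>+ \<zeta>. (\<integral>\<^sup>+ r.
              (if r < 1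
               then ennreal (r^2 * (cmod (f (of_real r * \<zeta>)))^2
                             * (1 - (cmod (\<theta> (of_real r * \<zeta>)))^2) / (1 - r^2))
               else ennreal ((cmod (radial_limit f \<zeta>))^2) * angular_derivative_modulus \<theta> \<zeta>)
            \<partial>\<sigma>) \<partial>circle_measure)"
proof -
  note hol = inner_function_holomorphic[OF inner]
  have hf: "f holomorphic_on ball 0 1" using f by (simp add: H2_def)
  \<comment> \<open>The point 1 is split off: radii below 1 are handled by Tonelli's theorem, the
    mass at 1 by Carleson's formula.\<close>
  define \<sigma>0 where "\<sigma>0 = restrict_space \<sigma> {0..<1}"
  define s1 where "s1 = emeasure \<sigma> {1}"
  let ?g = "\<lambda>z. f z * \<theta> z"
  let ?B = "\<lambda>\<zeta>. ennreal ((cmod (radial_limit f \<zeta>))^2) * angular_derivative_modulus \<theta> \<zeta>"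
  have sp: "space \<sigma> = {0..1}" using sets_eq_imp_space_eq[OF sigma] by (simp add: space_restrict_space)
  have sets0: "sets \<sigma>0 = sets (restrict_space borel {0..<1})"
  proof -
    have "sets \<sigma>0 = sets (restrict_space (restrict_space borel {0..1}) {0..<1::real})"
      unfolding \<sigma>0_def by (rule sets_restrict_space_cong[OF sigma])
    also have "\<dots> = sets (restrict_space borel {0..<1})"
    proof -
      have "{0..1} \<inter> {0..<1} = {0..<1::real}" by auto
      then show ?thesis by (subst sets_restrict_restrict_space) simp
    qed
    finally show ?thesis .
  qed
  have sp0: "space \<sigma>0 = {0..<1}" using sets_eq_imp_space_eq[OF sets0] by (simp add: space_restrict_space)
  have mom0: "(\<integral>\<^sup>+ x. ennreal (x^2) \<partial>\<sigma>0) < \<infinity>"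
  proof -
    have "{0..<1} \<inter> space \<sigma> \<in> sets \<sigma>" unfolding sp sigma by (auto simp: sets_restrict_space_iff)
    then have "(\<integral>\<^sup>+ x. ennreal (x^2) \<partial>\<sigma>0) = (\<integral>\<^sup>+ x. ennreal (x^2) * indicator {0..<1} x \<partial>\<sigma>)"
      unfolding \<sigma>0_def by (rule nn_integral_restrict_space)
    also have "\<dots> \<le> (\<integral>\<^sup>+ x. ennreal (x^2) \<partial>\<sigma>)" by (rule nn_integral_mono) (auto split: split_indicator)
    finally show ?thesis using mom by (rule le_less_trans)
  qed
  have dm: "(\<lambda>r. dirichlet_sum r h) \<in> borel_measurable \<sigma>0" for h
    unfolding measurable_cong_sets[OF sets0 refl] by (rule measurable_restrict_space1) measurable
  note ex = Fubini_inner_excess[OF sets0 mom0 hf hol]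
  have w': "w = (\<lambda>n. \<Sum>k\<in>{1..n}. \<integral>\<^sup>+x. ennreal (x ^ (2 * k)) \<partial>\<sigma>)"
    using w gamma by (intro ext) simp
  have wn: "w_norm_sq w h = (\<integral>\<^sup>+r. dirichlet_sum r h \<partial>\<sigma>0) + dirichlet_sum 1 h * s1" for h
  proof -
    have "w_norm_sq w h = (\<integral>\<^sup>+r. (if r < 1 then dirichlet_sum r h else dirichlet_sum 1 h) \<partial>\<sigma>)"
      unfolding w' w_norm_sq_eq_dirichlet_sum[OF sigma] by (rule nn_integral_cong) (auto simp: sp)
    then show ?thesis
      using nn_integral_split_at_1[OF sigma] dm unfolding \<sigma>0_def s1_def by simp
  qed
  define A where "A = (\<lambda>\<zeta>. \<integral>\<^sup>+r. inner_excess f \<theta> \<zeta> r \<partial>\<sigma>0)"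
  have Am: "A \<in> borel_measurable unit_circle" unfolding A_def by (rule ex(2))
  have "(\<integral>\<^sup>+r. dirichlet_sum r ?g \<partial>\<sigma>0) = (\<integral>\<^sup>+r. dirichlet_sum r f + (\<integral>\<^sup>+\<zeta>. inner_excess f \<theta> \<zeta> r \<partial>unit_circle) \<partial>\<sigma>0)"
    by (intro nn_integral_cong dirichlet_sum_inner_mult f inner) (auto simp: sp0)
  also have "\<dots> = (\<integral>\<^sup>+r. dirichlet_sum r f \<partial>\<sigma>0) + (\<integral>\<^sup>+\<zeta>. A \<zeta> \<partial>unit_circle)"
    unfolding A_def ex(4) by (intro nn_integral_add dm ex(3))
  finally have int0: "(\<integral>\<^sup>+r. dirichlet_sum r ?g \<partial>\<sigma>0) = (\<integral>\<^sup>+r. dirichlet_sum r f \<partial>\<sigma>0) + (\<integral>\<^sup>+\<zeta>. A \<zeta> \<partial>unit_circle)" .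
  have rhs: "(\<integral>\<^sup>+ \<zeta>. (\<integral>\<^sup>+ r. (if r < 1 then ennreal (r^2 * (cmod (f (of_real r * \<zeta>)))^2 * (1 - (cmod (\<theta> (of_real r * \<zeta>)))^2) / (1 - r^2))
        else ?B \<zeta>) \<partial>\<sigma>) \<partial>circle_measure) = (\<integral>\<^sup>+ \<zeta>. A \<zeta> + ?B \<zeta> * s1 \<partial>unit_circle)"
    unfolding nn_integral_unit_circle[symmetric] inner_excess_def[symmetric] A_def \<sigma>0_def s1_def
    by (intro nn_integral_cong nn_integral_split_at_1[OF sigma] ex(1)[unfolded \<sigma>0_def])
  \<comment> \<open>\<open>A\<close> stays under the integral on the right because additivity
    requires a measurable summand, which only the version B supplies. If s1 = 0, the boundary terms
    vanish even where they involve \<infinity>, as 0 * \<infinity> = 0.\<close>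
  have boundary: "dirichlet_sum 1 ?g * s1 + (\<integral>\<^sup>+ \<zeta>. A \<zeta> \<partial>unit_circle) =
      dirichlet_sum 1 f * s1 + (\<integral>\<^sup>+ \<zeta>. A \<zeta> + ?B \<zeta> * s1 \<partial>unit_circle)"
  proof (cases "s1 = 0")
    case False
    show ?thesis
    proof (cases "dirichlet_sum 1 f = \<infinity>")
      case True
      \<comment> \<open>With s1 > 0 both sides are now \<infinity>, whatever the boundary integrand
        is.\<close>
      then have "dirichlet_sum 1 ?g = \<infinity>" using dirichlet_sum_inner_mult_ge[OF f inner] by (simp add: top_unique)
      with True \<open>s1 \<noteq> 0\<close> show ?thesis by (simp add: ennreal_top_mult)
    next
      case D: False
      from D have "dirichlet_sum 1 f < \<infinity>" by (simp add: less_top)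
      then obtain B where B: "B \<in> borel_measurable unit_circle" "AE \<zeta> in unit_circle. ?B \<zeta> = B \<zeta>"
        "dirichlet_sum 1 ?g = dirichlet_sum 1 f + (\<integral>\<^sup>+\<zeta>. B \<zeta> \<partial>unit_circle)"
        by (rule Carleson_formula[OF f inner])
      have "(\<integral>\<^sup>+ \<zeta>. A \<zeta> + ?B \<zeta> * s1 \<partial>unit_circle) = (\<integral>\<^sup>+ \<zeta>. A \<zeta> + B \<zeta> * s1 \<partial>unit_circle)"
        by (rule nn_integral_cong_AE) (use B(2) in eventually_elim, simp only:)
      also have "\<dots> = (\<integral>\<^sup>+ \<zeta>. A \<zeta> \<partial>unit_circle) + (\<integral>\<^sup>+ \<zeta>. B \<zeta> \<partial>unit_circle) * s1"
        using Am B(1) by (subst nn_integral_add) (auto simp: nn_integral_multc)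
      finally show ?thesis unfolding B(3) by (simp add: distrib_right add_ac)
    qed
  qed simp
  have "w_norm_sq w ?g = (\<integral>\<^sup>+r. dirichlet_sum r f \<partial>\<sigma>0) + (dirichlet_sum 1 ?g * s1 + (\<integral>\<^sup>+ \<zeta>. A \<zeta> \<partial>unit_circle))"
    unfolding wn int0 by (simp only: add_ac)
  then show ?thesis unfolding boundary rhs wn[of f] by (simp only: add.assoc)
qed

end
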